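(* Let $\rho,\tilde\rho$ be probability measures on $\mathbb{S}$, let $(\gamma^J,\tilde\gamma^J,Q^J,\hat Q^J)_{J\in\mathcal{J}}$ be a one-sided coupled update rule for $(\rho,\tilde\rho)$, and let $(w_J)_{J\in\mathcal{J}}$ be a family of strictly positive weights. Define for $i,j\in I$ $$W_{ij}:=\mathbf{1}_{i=j}\sum_{J\in\mathcal{J}:i\in J}w_J,\qquad R_{ij}:=\sup_{x,z\in\mathbb{S}:\,x^{I\setminus\{j\}}=z^{I\setminus\{j\}}}\frac{1}{\eta_j(x_j,z_j)}\sum_{J\in\mathcal{J}:i\in J}w_J\,Q^J_{x,z}\eta_i,$$ $$a_j:=\sum_{J\in\mathcal{J}:j\in J}w_J\int^{*}\tilde\rho(dx)\,\hat Q^J_x\eta_j ,$$ where $Q^J_{x,z}$ and $\hat Q^J_x$ are evaluated at the restrictions of $x,z$ to $I_{\le\tau(J)}$, and where $R_{ij}:=0$ when $\tau(j)>\tau(i)$. Assume that $\gamma^J$ is quasilocal for every $J\in\mathcal{J}$, that $$\sum_{j\in I}D_{ij}\,(\rho\otimes\tilde\rho)\eta_j<\infty\quad\text{for all }i\in I,\qquad\text{where}\qquad D:=\sum_{n=0}^\infty(W^{-1}R)^n,$$ and that $$W_{ii}\le 1\quad\text{and}\quad \lim_{n\to\infty}\sum_{j\in I}(\mathrm{Id}-W+R)^n_{ij}\,(\rho\otimes\tilde\rho)\eta_j=0\quad\text{for all } i\in I.$$ Then $$|\rho f-\tilde\rho f|\le\sum_{i,j\in I}\delta_if\,D_{ij}\,W_{jj}^{-1}a_j$$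 for any bounded and measurable quasilocal function $f:\mathbb{S}\to\mathbb{R}$ such that $\delta_if<\infty$ for all $i\in I$.
   Context: Sites and configurations. $I$ is a finite or countably infinite set (of sites); $\mathcal{I}$ is the set of finite subsets of $I$. To each $i\in I$ is associated a measurable space $\mathbb{S}^i$ with a metric $\eta_i$ that is measurable as a function on $\mathbb{S}^i\times\mathbb{S}^i$. $\mathbb{S}^J:=\prod_{i\in J}\mathbb{S}^i$ for $J\subseteq I$, and $\mathbb{S}:=\mathbb{S}^I$ (product $\sigma$-algebras). For $x\in\mathbb{S}$, $x^J:=(x_i)_{i\in J}$; for disjoint $J,K$, $x^Jy^K$ is the element of $\mathbb{S}^{J\cup K}$ with coordinates $x^J$ on $J$ and $y^K$ on $K$. A cover of $I$ is a collection $\mathcal{J}\subseteq\mathcal{I}$ of finite subsets such that every $i\in I$ lies in at least one $J\in\mathcal{J}$. Functions. For $f:\mathbb{S}\to\mathbb{R}$, $J\in\mathcal{I}$, $x\in\mathbb{S}$ let $f^J_x(z):=f(z^Jx^{I\setminus J})$. $f$ is quasilocal if $\lim_{J\in\mathcal{I}}|f^J_x(z)-f(z)|=0$ for all $x,z\in\mathbb{S}$, the limit being that of the net indexed by $\mathcal{I}$ directed by inclusion (equivalently, $f_x^{J_k}(z)\to f(z)$ along every increasing sequence of finite sets $J_k$ with $\bigcup_kJ_k=I$). Quasilocality of functions on $\mathbb{S}^{K}$, $K\subseteq I$, is defined in the same way with index set $K$. Define $$\delta_if:=\sup_{x,z\in\mathbb{S}:\,x^{I\setminus\{i\}}=z^{I\setminus\{i\}}}\frac{|f(x)-f(z)|}{\eta_i(x_i,z_i)}.$$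 Suprema of ratios of this type are over pairs that differ exactly at the indicated site (so that the denominator is positive), and equal $0$ if there are no such pairs. Matrices. Matrices indexed by $I$ have entries in $[0,\infty]$, are multiplied in the usual way with the convention $\infty\cdot0=0$, and $A^0=\mathrm{Id}:=(\mathbf{1}_{i=j})_{i,j\in I}$. Kernels. A transition kernel $\gamma$ from $\Omega$ to $\Omega'$ is a map $\omega\mapsto\gamma_\omega$ into probability measures on $\Omega'$ with $\omega\mapsto\gamma_\omega(A)$ measurable for each measurable $A$; $(\gamma f)(\omega)=\int\gamma_\omega(d\omega')f(\omega')$. A kernel between product spaces is quasilocal if $\gamma f$ is quasilocal for every bounded measurable quasilocal $f$. One-sided setting. $\tau:I\to\mathbb{Z}$ is a given function. $I_{\le k}:=\{i\in I:\tau(i)\le k\}$, $\mathbb{S}_{\le k}:=\mathbb{S}^{I_{\le k}}$, and $\rho_{\le k}$ is the marginal of $\rho$ on $\mathbb{S}_{\le k}$. A one-sided local update rule for $\rho$ is a collection $(\gamma^J)_{J\in\mathcal{J}}$ where: (1) $\mathcal{J}$ is a cover of $I$ such that $\min_{i\in J}\tau(i)=\max_{i\in J}\tau(i)=:\tau(J)$ for every $J\in\mathcal{J}$; (2) $\gamma^J$ is a transition kernel from $\mathbb{S}_{\le\tau(J)}$ to $\mathbb{S}^J$; (3) $\rho_{\le\tau(J)}$ is $\gamma^J$-invariant for every $J\in\mathcal{J}$, i.e. $\int\rho_{\le\tau(J)}(dx)f(x)=\int\rho_{\le\tau(J)}(dx)\gamma^J_x(dz^J)f(z^Jx^{I_{\le\tau(J)}\setminus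 J})$ for every bounded measurable $f$ on $\mathbb{S}_{\le\tau(J)}$. A one-sided coupled update rule for $(\rho,\tilde\rho)$ is a collection of transition kernels $(\gamma^J,\tilde\gamma^J,Q^J,\hat Q^J)_{J\in\mathcal{J}}$ such that: (1) $(\gamma^J)_{J\in\mathcal{J}}$ and $(\tilde\gamma^J)_{J\in\mathcal{J}}$ are one-sided local update rules for $\rho$ and $\tilde\rho$, respectively; (2) $Q^J_{x,z}$ is a coupling of $\gamma^J_x,\gamma^J_z$ (a probability on $\mathbb{S}^J\times\mathbb{S}^J$ with these marginals) for $J\in\mathcal{J}$ and $x,z\in\mathbb{S}_{\le\tau(J)}$ with $\operatorname{card}\{i:x_i\ne z_i\}=1$; (3) $\hat Q^J_x$ is a coupling of $\gamma^J_x,\tilde\gamma^J_x$ for $J\in\mathcal{J}$ and $x\in\mathbb{S}_{\le\tau(J)}$. Other notation. $\mu f=\int f\,d\mu$. For a probability $Q$ on $\mathbb{S}^J\times\mathbb{S}^J$ and $i\in J$, $Q\eta_i:=\int\eta_i(\omega_i,\omega_i')\,Q(d\omega,d\omega')\in[0,\infty]$; $(\rho\otimes\tilde\rho)\eta_j:=\int\eta_j(x_j,z_j)\,\rho(dx)\,\tilde\rho(dz)$. $\int^{*}f(x)\,\rho(dx):=\inf\{\int g\,d\rho: f\le g,\ g\text{ measurable}\}$ is the outer integral. *)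

theory Defs
  imports "HOL-Probability.Probability"
begin

text \<open>
  Sites are the elements of a set I of type 'i set. The spaces attached to the sites are measures
  S i on one common type 'a, of which only \<open>space\<close> and \<open>sets\<close> are used; distinct sites may have
  distinct underlying sets. Configurations over a set K of sites are the elements of
  \<open>space (PiM K S)\<close>, that is, functions that are \<open>undefined\<close> outside K.
  \<open>Metric_space\<close> also asks for nonnegativity and symmetry off the carrier; this is harmless, since
  the values of \<open>\<eta> i\<close> off \<open>space (S i)\<close> are never used.
\<close>

definition site_spaces :: "'i set \<Rightarrow> ('i \<Rightarrow> 'a measure) \<Rightarrow> ('i \<Rightarrow> 'a \<Rightarrow> 'a \<Rightarrow> real) \<Rightarrow> bool" where
  "site_spaces I S \<eta> \<longleftrightarrow>
     countable I \<and>
     (\<forall>i\<in>I. Metric_space (space (S i)) (\<eta> i) \<and>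
             (\<lambda>(u, v). \<eta> i u v) \<in> borel_measurable (S i \<Otimes>\<^sub>M S i))"

definition prob_measure_on :: "'b measure \<Rightarrow> 'b measure \<Rightarrow> bool" where
  "prob_measure_on N \<mu> \<longleftrightarrow> prob_space \<mu> \<and> sets \<mu> = sets N"

definition bounded_measurable :: "'b measure \<Rightarrow> ('b \<Rightarrow> real) \<Rightarrow> bool" where
  "bounded_measurable N f \<longleftrightarrow> f \<in> borel_measurable N \<and> bounded (f ` space N)"

definition is_cover :: "'i set \<Rightarrow> 'i set set \<Rightarrow> bool" where
  "is_cover I \<J> \<longleftrightarrow> (\<forall>J\<in>\<J>. finite J \<and> J \<subseteq> I) \<and> (\<forall>i\<in>I. \<exists>J\<in>\<J>. i \<in> J)"


subsection \<open>Quasilocality, local oscillations\<close>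

definition quasilocal :: "'i set \<Rightarrow> ('i \<Rightarrow> 'a measure) \<Rightarrow> (('i \<Rightarrow> 'a) \<Rightarrow> real) \<Rightarrow> bool" where
  "quasilocal K S f \<longleftrightarrow>
     (\<forall>x\<in>space (PiM K S). \<forall>z\<in>space (PiM K S).
        ((\<lambda>J. \<bar>f (merge J (K - J) (z, x)) - f z\<bar>) \<longlongrightarrow> 0) (finite_subsets_at_top K))"

definition differ_only_at ::
    "'i set \<Rightarrow> ('i \<Rightarrow> 'a measure) \<Rightarrow> 'i \<Rightarrow> (('i \<Rightarrow> 'a) \<times> ('i \<Rightarrow> 'a)) set" where
  "differ_only_at I S i =
     {(x, z). x \<in> space (PiM I S) \<and> z \<in> space (PiM I S) \<and>
              (\<forall>k\<in>I - {i}. x k = z k) \<and> x i \<noteq> z i}"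

text \<open>The supremum of the empty set in \<open>ennreal\<close> is 0.\<close>

definition osc ::
    "'i set \<Rightarrow> ('i \<Rightarrow> 'a measure) \<Rightarrow> ('i \<Rightarrow> 'a \<Rightarrow> 'a \<Rightarrow> real) \<Rightarrow> 'i \<Rightarrow> (('i \<Rightarrow> 'a) \<Rightarrow> real) \<Rightarrow> ennreal" where
  "osc I S \<eta> i f = (SUP (x, z)\<in>differ_only_at I S i. ennreal (\<bar>f x - f z\<bar> / \<eta> i (x i) (z i)))"


subsection \<open>Matrices with entries in [0, infinity]\<close>

type_synonym 'i mat = "'i \<Rightarrow> 'i \<Rightarrow> ennreal"

definition mat_id :: "'i mat" where
  "mat_id i j = (if i = j then 1 else 0)"

definition mat_mult :: "'i set \<Rightarrow> 'i mat \<Rightarrow> 'i mat \<Rightarrow> 'i mat" where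
  "mat_mult I A B i j = (\<Sum>\<^sub>\<infinity>k\<in>I. A i k * B k j)"

primrec mat_power :: "'i set \<Rightarrow> 'i mat \<Rightarrow> nat \<Rightarrow> 'i mat" where
  "mat_power I A 0 = mat_id"
| "mat_power I A (Suc n) = mat_mult I A (mat_power I A n)"

text \<open>The inverse of a diagonal matrix.\<close>

definition diag_inverse :: "'i mat \<Rightarrow> 'i mat" where
  "diag_inverse A i j = (if i = j then inverse (A i i) else 0)"


subsection \<open>Kernels, couplings, integrals of the metrics\<close>

definition transition_kernel :: "'b measure \<Rightarrow> 'c measure \<Rightarrow> ('b \<Rightarrow> 'c measure) \<Rightarrow> bool" where
  "transition_kernel N N' \<kappa> \<longleftrightarrow> \<kappa> \<in> N \<rightarrow>\<^sub>M prob_algebra N'"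

definition quasilocal_kernel ::
    "'i set \<Rightarrow> 'i set \<Rightarrow> ('i \<Rightarrow> 'a measure) \<Rightarrow> (('i \<Rightarrow> 'a) \<Rightarrow> ('i \<Rightarrow> 'a) measure) \<Rightarrow> bool" where
  "quasilocal_kernel K L S \<kappa> \<longleftrightarrow>
     (\<forall>f. bounded_measurable (PiM L S) f \<and> quasilocal L S f \<longrightarrow>
          quasilocal K S (\<lambda>x. \<integral>\<omega>. f \<omega> \<partial>\<kappa> x))"

definition is_coupling :: "'b measure \<Rightarrow> ('b \<times> 'b) measure \<Rightarrow> 'b measure \<Rightarrow> 'b measure \<Rightarrow> bool" where
  "is_coupling N Q \<mu> \<nu> \<longleftrightarrow>
     prob_measure_on (N \<Otimes>\<^sub>M N) Q \<and> distr Q N fst = \<mu> \<and> distr Q N snd = \<nu>"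

definition metric_integral ::
    "('i \<Rightarrow> 'a \<Rightarrow> 'a \<Rightarrow> real) \<Rightarrow> 'i \<Rightarrow> (('i \<Rightarrow> 'a) \<times> ('i \<Rightarrow> 'a)) measure \<Rightarrow> ennreal" where
  "metric_integral \<eta> i Q = (\<integral>\<^sup>+ (\<omega>, \<omega>'). ennreal (\<eta> i (\<omega> i) (\<omega>' i)) \<partial>Q)"

definition outer_integral :: "'b measure \<Rightarrow> ('b \<Rightarrow> ennreal) \<Rightarrow> ennreal" where
  "outer_integral \<mu> f = Inf {\<integral>\<^sup>+ x. g x \<partial>\<mu> | g. g \<in> borel_measurable \<mu> \<and> (\<forall>x\<in>space \<mu>. f x \<le> g x)}"


subsection \<open>One-sided update rules\<close>

definition sites_upto :: "'i set \<Rightarrow> ('i \<Rightarrow> int) \<Rightarrow> int \<Rightarrow> 'i set" where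
  "sites_upto I \<tau> k = {i\<in>I. \<tau> i \<le> k}"

text \<open>The common value of \<open>\<tau>\<close> on J; only used when \<open>\<tau>\<close> is constant on the nonempty finite set J.\<close>

definition level :: "('i \<Rightarrow> int) \<Rightarrow> 'i set \<Rightarrow> int" where
  "level \<tau> J = Min (\<tau> ` J)"

definition past :: "'i set \<Rightarrow> ('i \<Rightarrow> int) \<Rightarrow> 'i set \<Rightarrow> 'i set" where
  "past I \<tau> J = sites_upto I \<tau> (level \<tau> J)"

definition marginal ::
    "'i set \<Rightarrow> ('i \<Rightarrow> 'a measure) \<Rightarrow> ('i \<Rightarrow> 'a) measure \<Rightarrow> ('i \<Rightarrow> 'a) measure" where
  "marginal K S \<rho> = distr \<rho> (PiM K S) (\<lambda>x. restrict x K)"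

definition kernel_invariant ::
    "'i set \<Rightarrow> 'i set \<Rightarrow> ('i \<Rightarrow> 'a measure) \<Rightarrow> ('i \<Rightarrow> 'a) measure \<Rightarrow>
     (('i \<Rightarrow> 'a) \<Rightarrow> ('i \<Rightarrow> 'a) measure) \<Rightarrow> bool" where
  "kernel_invariant K J S \<mu> \<kappa> \<longleftrightarrow>
     (\<forall>f. bounded_measurable (PiM K S) f \<longrightarrow>
        (\<integral>x. f x \<partial>\<mu>) = (\<integral>x. (\<integral>z. f (merge J (K - J) (z, x)) \<partial>\<kappa> x) \<partial>\<mu>))"

text \<open>The minimum of \<open>\<tau>\<close> over J exists only for nonempty J, so nonemptiness is part of the definition.\<close>

definition one_sided_local_update_rule ::
    "'i set \<Rightarrow> ('i \<Rightarrow> 'a measure) \<Rightarrow> ('i \<Rightarrow> int) \<Rightarrow> 'i set set \<Rightarrow> ('i \<Rightarrow> 'a) measure \<Rightarrow>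
     ('i set \<Rightarrow> ('i \<Rightarrow> 'a) \<Rightarrow> ('i \<Rightarrow> 'a) measure) \<Rightarrow> bool" where
  "one_sided_local_update_rule I S \<tau> \<J> \<rho> \<gamma> \<longleftrightarrow>
     is_cover I \<J> \<and>
     (\<forall>J\<in>\<J>. J \<noteq> {} \<and> Min (\<tau> ` J) = Max (\<tau> ` J)) \<and>
     (\<forall>J\<in>\<J>. transition_kernel (PiM (past I \<tau> J) S) (PiM J S) (\<gamma> J)) \<and>
     (\<forall>J\<in>\<J>. kernel_invariant (past I \<tau> J) J S (marginal (past I \<tau> J) S \<rho>) (\<gamma> J))"

definition single_site_pairs ::
    "'i set \<Rightarrow> ('i \<Rightarrow> 'a measure) \<Rightarrow> (('i \<Rightarrow> 'a) \<times> ('i \<Rightarrow> 'a)) set" where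
  "single_site_pairs K S =
     {(x, z). x \<in> space (PiM K S) \<and> z \<in> space (PiM K S) \<and> card {i\<in>K. x i \<noteq> z i} = 1}"

text \<open>
  The kernels Q J take the pair of configurations as argument and are kernels on the set of pairs
  that differ at exactly one site, with the trace sigma-algebra; their values elsewhere are
  unconstrained.
\<close>

definition one_sided_coupled_update_rule ::
    "'i set \<Rightarrow> ('i \<Rightarrow> 'a measure) \<Rightarrow> ('i \<Rightarrow> int) \<Rightarrow> 'i set set \<Rightarrow>
     ('i \<Rightarrow> 'a) measure \<Rightarrow> ('i \<Rightarrow> 'a) measure \<Rightarrow>
     ('i set \<Rightarrow> ('i \<Rightarrow> 'a) \<Rightarrow> ('i \<Rightarrow> 'a) measure) \<Rightarrow>
     ('i set \<Rightarrow> ('i \<Rightarrow> 'a) \<Rightarrow> ('i \<Rightarrow> 'a) measure) \<Rightarrow>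
     ('i set \<Rightarrow> ('i \<Rightarrow> 'a) \<times> ('i \<Rightarrow> 'a) \<Rightarrow> (('i \<Rightarrow> 'a) \<times> ('i \<Rightarrow> 'a)) measure) \<Rightarrow>
     ('i set \<Rightarrow> ('i \<Rightarrow> 'a) \<Rightarrow> (('i \<Rightarrow> 'a) \<times> ('i \<Rightarrow> 'a)) measure) \<Rightarrow> bool" where
  "one_sided_coupled_update_rule I S \<tau> \<J> \<rho> \<rho>' \<gamma> \<gamma>' Q Qh \<longleftrightarrow>
     one_sided_local_update_rule I S \<tau> \<J> \<rho> \<gamma> \<and>
     one_sided_local_update_rule I S \<tau> \<J> \<rho>' \<gamma>' \<and>
     (\<forall>J\<in>\<J>.
        transition_kernel
          (restrict_space (PiM (past I \<tau> J) S \<Otimes>\<^sub>M PiM (past I \<tau> J) S) (single_site_pairs (past I \<tau> J) S))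
          (PiM J S \<Otimes>\<^sub>M PiM J S) (Q J) \<and>
        (\<forall>(x, z)\<in>single_site_pairs (past I \<tau> J) S. is_coupling (PiM J S) (Q J (x, z)) (\<gamma> J x) (\<gamma> J z))) \<and>
     (\<forall>J\<in>\<J>.
        transition_kernel (PiM (past I \<tau> J) S) (PiM J S \<Otimes>\<^sub>M PiM J S) (Qh J) \<and>
        (\<forall>x\<in>space (PiM (past I \<tau> J) S). is_coupling (PiM J S) (Qh J x) (\<gamma> J x) (\<gamma>' J x)))"


subsection \<open>The matrices W, R, D and the vector a\<close>

definition W_mat :: "'i set set \<Rightarrow> ('i set \<Rightarrow> real) \<Rightarrow> 'i mat" where
  "W_mat \<J> w i j = (if i = j then \<Sum>\<^sub>\<infinity>J\<in>{J\<in>\<J>. i \<in> J}. ennreal (w J) else 0)"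

definition R_mat ::
    "'i set \<Rightarrow> ('i \<Rightarrow> 'a measure) \<Rightarrow> ('i \<Rightarrow> 'a \<Rightarrow> 'a \<Rightarrow> real) \<Rightarrow> ('i \<Rightarrow> int) \<Rightarrow> 'i set set \<Rightarrow>
     ('i set \<Rightarrow> real) \<Rightarrow>
     ('i set \<Rightarrow> ('i \<Rightarrow> 'a) \<times> ('i \<Rightarrow> 'a) \<Rightarrow> (('i \<Rightarrow> 'a) \<times> ('i \<Rightarrow> 'a)) measure) \<Rightarrow> 'i mat" where
  "R_mat I S \<eta> \<tau> \<J> w Q i j =
     (if \<tau> j > \<tau> i then 0
      else SUP (x, z)\<in>differ_only_at I S j.
        (1 / ennreal (\<eta> j (x j) (z j))) *
        (\<Sum>\<^sub>\<infinity>J\<in>{J\<in>\<J>. i \<in> J}.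
           ennreal (w J) *
           metric_integral \<eta> i (Q J (restrict x (past I \<tau> J), restrict z (past I \<tau> J)))))"

definition D_mat :: "'i set \<Rightarrow> 'i mat \<Rightarrow> 'i mat \<Rightarrow> 'i mat" where
  "D_mat I W R i j = (\<Sum>n. mat_power I (mat_mult I (diag_inverse W) R) n i j)"

definition a_vec ::
    "'i set \<Rightarrow> ('i \<Rightarrow> 'a \<Rightarrow> 'a \<Rightarrow> real) \<Rightarrow> ('i \<Rightarrow> int) \<Rightarrow> 'i set set \<Rightarrow> ('i set \<Rightarrow> real) \<Rightarrow>
     ('i \<Rightarrow> 'a) measure \<Rightarrow>
     ('i set \<Rightarrow> ('i \<Rightarrow> 'a) \<Rightarrow> (('i \<Rightarrow> 'a) \<times> ('i \<Rightarrow> 'a)) measure) \<Rightarrow> 'i \<Rightarrow> ennreal" where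
  "a_vec I \<eta> \<tau> \<J> w \<rho>' Qh j =
     (\<Sum>\<^sub>\<infinity>J\<in>{J\<in>\<J>. j \<in> J}.
        ennreal (w J) *
        outer_integral \<rho>' (\<lambda>x. metric_integral \<eta> j (Qh J (restrict x (past I \<tau> J)))))"

end

theory Submission
  imports Defs
begin

text \<open>
  Write \<open>m j\<close> for the mean distance of the j-th coordinates under the product of \<open>\<rho>\<close> and \<open>\<rho>'\<close>. A vector
  \<open>\<beta>\<close> is called an influence bound on a finite set K of sites if \<open>\<bar>\<rho> f - \<rho>' f\<bar>\<close> is at most the sum of
  \<open>\<delta>\<^sub>i f * \<beta> i\<close> over \<open>i \<in> K\<close>, for all bounded measurable f with finite oscillations that depend only
  on the coordinates in K. The theorem says that \<open>D W\<^sup>-\<^sup>1 a\<close> is an influence bound, and it is reached by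
  improving bad influence bounds.

  Improvement. Let f depend only on sites of level at most k. The kernels of the blocks of level k
  preserve the marginals of \<open>\<rho>\<close> and \<open>\<rho>'\<close> on these sites, so f may be replaced by the lazy average
  \<open>P f = (1 - \<theta> \<Sum> w J) f + \<theta> \<Sum> w J \<gamma>\<^sup>J f\<close>; the exchange of \<open>\<gamma>'\<close> for \<open>\<gamma>\<close> costs \<open>\<theta> \<Sum> \<delta>\<^sub>i f * a i\<close>, and the
  couplings Q control the oscillations of \<open>P f\<close>. As a result an influence bound \<open>\<beta>\<close> may be replaced on
  level k by \<open>(1 - \<theta>) \<beta> + \<theta> (T \<beta> + a)\<close> with \<open>T = Id - W + R\<close> (lemma \<open>one_step\<close>). Blocks of lower
  levels do not preserve the marginal in question, which is why the levels are treated one at a time.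

  Freezing. Replacing the coordinates outside K by those of an independent sample of \<open>\<rho>'\<close> changes
  \<open>\<rho> f - \<rho>' f\<close> by at most \<open>3 \<Sum> \<delta>\<^sub>j f * m j\<close>, the sum over \<open>j \<notin> K\<close> (lemma \<open>gap_le_freeze\<close>). This does two things.
  It allows one to stay in a fixed finite set L although \<open>P f\<close> depends on infinitely many sites; then
  finitely much weight is involved, and one step size \<open>\<theta>\<close> serves for all iterations.
  And it carries an influence bound from the levels below k to level k with an error \<open>3 m\<close> there.

  Fixed point. Every vector \<open>b = D u\<close> solves \<open>W b = W u + R b\<close> (lemma \<open>diag_mult_mat_vec_D\<close>). Choosing
  \<open>u = W\<^sup>-\<^sup>1 a\<close> on L and \<open>u = W\<^sup>-\<^sup>1 a + 3 m\<close> off L makes b invariant under the improvement on L and large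
  enough off L to pay for freezing. Improving \<open>b + 3 m\<close> on level k repeatedly leaves b alone and turns the
  error into binomial averages of \<open>3 T\<^sup>r m\<close>, which tend to 0 because \<open>T\<^sup>r m\<close> tends to 0 and stays below
  \<open>D m\<close>. Since L is finite it has a lowest level, and induction over the levels shows that b is an
  influence bound on L (lemma \<open>influence_bound_supersolution\<close>).

  Limit. As L grows, b decreases to \<open>D W\<^sup>-\<^sup>1 a\<close>, because the difference at i is three times a tail of the
  convergent series \<open>\<Sum> D i j * m j\<close>. Freezing all but finitely many coordinates of a quasilocal f and
  dominated convergence extend the estimate from local functions to f.

  Sites with \<open>m j = 0\<close> are never put into L: freezing them is free, and at all other sites the entries of
  R are finite (lemma \<open>R_finite\<close>), so that the oscillations of \<open>P f\<close> in L stay finite.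
\<close>

section \<open>Sums in the extended nonnegative reals\<close>

lemma ennreal_summable_on [simp]: "(f :: 'b \<Rightarrow> ennreal) summable_on A"
  by (rule nonneg_summable_on_complete) simp

lemma infsum_eq_nn_integral:
  fixes f :: "'b \<Rightarrow> ennreal"
  assumes "countable A"
  shows "infsum f A = (\<integral>\<^sup>+ x. f x \<partial>count_space A)"
proof (cases "finite A")
  case True
  then show ?thesis by (simp add: nn_integral_count_space_finite)
next
  case False
  then have bij: "bij_betw (from_nat_into A) UNIV A"
    using assms by (rule bij_betw_from_nat_into[rotated])
  have "infsum f A = infsum (\<lambda>n. f (from_nat_into A n)) UNIV"
    using infsum_reindex_bij_betw[OF bij, of f] by simp
  also have "\<dots> = (\<Sum>n. f (from_nat_into A n))"
    by (rule sums_unique, rule has_sum_imp_sums, rule has_sum_infsum, simp)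
  also have "\<dots> = (\<integral>\<^sup>+ n. f (from_nat_into A n) \<partial>count_space UNIV)"
    by (simp add: nn_integral_count_space_nat)
  also have "\<dots> = (\<integral>\<^sup>+ x. f x \<partial>count_space A)"
    by (rule nn_integral_bij_count_space[OF bij])
  finally show ?thesis .
qed

lemma infsum_ennreal_cmult: "(\<Sum>\<^sub>\<infinity>x\<in>A. c * f x) = c * (\<Sum>\<^sub>\<infinity>x\<in>A. f x)"
  for f :: "'b \<Rightarrow> ennreal"
  by (simp add: nonneg_infsum_complete SUP_mult_left_ennreal sum_distrib_left)

lemma infsum_ennreal_swap:
  fixes f :: "'b \<Rightarrow> 'c \<Rightarrow> ennreal"
  assumes "countable A" "countable B"
  shows "(\<Sum>\<^sub>\<infinity>x\<in>A. \<Sum>\<^sub>\<infinity>y\<in>B. f x y) = (\<Sum>\<^sub>\<infinity>y\<in>B. \<Sum>\<^sub>\<infinity>x\<in>A. f x y)"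
  using assms
  unfolding infsum_eq_nn_integral[OF assms(1)] infsum_eq_nn_integral[OF assms(2)]
  by (intro nn_integral_count_space_nn_integral[of B "\<lambda>y x. f x y" "count_space A"]) auto

lemma finite_sum_le_infsum_ennreal:
  fixes f :: "'b \<Rightarrow> ennreal"
  assumes "finite F" "F \<subseteq> A"
  shows "sum f F \<le> infsum f A"
  using assms by (auto simp: nonneg_infsum_complete intro!: SUP_upper)

lemma infsum_ennreal_subset:
  fixes f :: "'b \<Rightarrow> ennreal"
  assumes "A \<subseteq> B"
  shows "infsum f A \<le> infsum f B"
  by (rule infsum_mono_neutral) (use assms in auto)

lemma infsum_ennreal_single:
  fixes f :: "'b \<Rightarrow> ennreal"
  assumes "i \<in> A" "\<And>j. j \<in> A \<Longrightarrow> j \<noteq> i \<Longrightarrow> f j = 0"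
  shows "infsum f A = f i"
proof -
  have "infsum f A = infsum f {i}"
    by (rule infsum_cong_neutral) (use assms in auto)
  then show ?thesis by simp
qed

lemma infsum_suminf_swap:
  fixes f :: "nat \<Rightarrow> 'c \<Rightarrow> ennreal"
  assumes "countable B"
  shows "(\<Sum>\<^sub>\<infinity>y\<in>B. \<Sum>n. f n y) = (\<Sum>n. \<Sum>\<^sub>\<infinity>y\<in>B. f n y)"
  using assms by (simp add: infsum_eq_nn_integral nn_integral_suminf)

lemma borel_measurable_infsum:
  fixes g :: "'b \<Rightarrow> 'c \<Rightarrow> ennreal"
  assumes "countable A" "\<And>i. i \<in> A \<Longrightarrow> g i \<in> borel_measurable M"
  shows "(\<lambda>x. \<Sum>\<^sub>\<infinity>i\<in>A. g i x) \<in> borel_measurable M"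
proof (cases "finite A")
  case True
  then show ?thesis using assms by simp
next
  case False
  then have bij: "bij_betw (from_nat_into A) UNIV A"
    using assms by (intro bij_betw_from_nat_into)
  have "(\<Sum>\<^sub>\<infinity>i\<in>A. g i x) = (\<Sum>n. g (from_nat_into A n) x)" for x
    unfolding infsum_reindex_bij_betw[OF bij, of "\<lambda>i. g i x", symmetric]
    by (rule sums_unique, rule has_sum_imp_sums, rule has_sum_infsum, simp)
  moreover have "from_nat_into A n \<in> A" for n using bij by (auto simp: bij_betw_def)
  ultimately show ?thesis using assms(2) by simp
qed

lemma nn_integral_infsum:
  assumes "countable A" "\<And>i. i \<in> A \<Longrightarrow> g i \<in> borel_measurable M"
  shows "(\<integral>\<^sup>+x. (\<Sum>\<^sub>\<infinity>i\<in>A. g i x) \<partial>M) = (\<Sum>\<^sub>\<infinity>i\<in>A. \<integral>\<^sup>+x. g i x \<partial>M)"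
  using assms by (simp add: infsum_eq_nn_integral nn_integral_count_space_nn_integral)

lemma infsum_ennreal_Times:
  fixes f :: "'b \<Rightarrow> 'c \<Rightarrow> ennreal"
  assumes A: "countable A" and B: "countable B"
  shows "(\<Sum>\<^sub>\<infinity>(x, y)\<in>A \<times> B. f x y) = (\<Sum>\<^sub>\<infinity>x\<in>A. \<Sum>\<^sub>\<infinity>y\<in>B. f x y)"
proof -
  let ?g = "\<lambda>p. (case p of (x, y) \<Rightarrow> f x y) * indicator (A \<times> B) p"
  have "(\<Sum>\<^sub>\<infinity>(x, y)\<in>A \<times> B. f x y) = (\<integral>\<^sup>+p. ?g p \<partial>count_space UNIV)"
    using A B by (simp add: infsum_eq_nn_integral nn_integral_count_space_indicator)
  also have "\<dots> = (\<integral>\<^sup>+x. \<integral>\<^sup>+y. ?g (x, y) \<partial>count_space UNIV \<partial>count_space UNIV)"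
    by (rule nn_integral_fst_count_space[symmetric])
  also have "\<dots> = (\<integral>\<^sup>+x. (\<integral>\<^sup>+y. f x y * indicator B y \<partial>count_space UNIV) * indicator A x \<partial>count_space UNIV)"
    by (intro nn_integral_cong) (auto simp: indicator_def intro!: nn_integral_cong)
  also have "\<dots> = (\<Sum>\<^sub>\<infinity>x\<in>A. \<Sum>\<^sub>\<infinity>y\<in>B. f x y)"
    using A B by (simp add: infsum_eq_nn_integral nn_integral_count_space_indicator)
  finally show ?thesis .
qed

text \<open>
  The tails are differences of the total and the partial sums; finiteness of the total is what makes
  truncated subtraction continuous here.
\<close>
lemma infsum_ennreal_tail_tendsto_0:
  fixes g :: "'b \<Rightarrow> ennreal"
  assumes "infsum g A < \<top>"
  shows "((\<lambda>L. infsum g (A - L)) \<longlongrightarrow> 0) (finite_subsets_at_top A)"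
proof -
  have lim: "(sum g \<longlongrightarrow> infsum g A) (finite_subsets_at_top A)"
    using has_sum_infsum[of g A] by (simp add: has_sum_def)
  have "((\<lambda>L. infsum g A - sum g L) \<longlongrightarrow> infsum g A - infsum g A) (finite_subsets_at_top A)"
    using assms by (intro tendsto_diff_ennreal lim) auto
  moreover have "infsum g A - infsum g A = 0" using assms by simp
  moreover have "\<forall>\<^sub>F L in finite_subsets_at_top A. infsum g A - sum g L = infsum g (A - L)"
  proof (rule eventually_finite_subsets_at_top_weakI)
    fix L assume L: "finite L" "L \<subseteq> A"
    have "infsum g A = sum g L + infsum g (A - L)"
      using L infsum_Un_disjoint[of g L "A - L"] by (simp add: Un_absorb1)
    moreover have "sum g L < \<top>"
      using finite_sum_le_infsum_ennreal[OF L, of g] assms by (rule order_le_less_trans)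
    ultimately show "infsum g A - sum g L = infsum g (A - L)"
      by (simp add: ennreal_add_diff_cancel_left less_top)
  qed
  ultimately show ?thesis by (simp add: tendsto_cong)
qed

section \<open>Matrices acting on vectors\<close>

definition mat_vec :: "'i set \<Rightarrow> 'i mat \<Rightarrow> ('i \<Rightarrow> ennreal) \<Rightarrow> 'i \<Rightarrow> ennreal" where
  "mat_vec I A u i = (\<Sum>\<^sub>\<infinity>j\<in>I. A i j * u j)"

lemma mat_vec_mono: "(\<And>j. j \<in> I \<Longrightarrow> u j \<le> v j) \<Longrightarrow> mat_vec I A u i \<le> mat_vec I A v i"
  unfolding mat_vec_def by (rule infsum_mono) (auto intro: mult_left_mono)

lemma mat_vec_cong: "(\<And>j. j \<in> I \<Longrightarrow> u j = v j) \<Longrightarrow> mat_vec I A u i = mat_vec I A v i"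
  unfolding mat_vec_def by (rule infsum_cong) auto

lemma mat_vec_add: "mat_vec I A (\<lambda>j. u j + v j) i = mat_vec I A u i + mat_vec I A v i"
  unfolding mat_vec_def by (simp add: distrib_left infsum_add)

lemma mat_vec_cmult: "mat_vec I A (\<lambda>j. c * u j) i = c * mat_vec I A u i"
  unfolding mat_vec_def infsum_ennreal_cmult[symmetric]
  by (simp add: mult_ac)

lemma mat_vec_id: "i \<in> I \<Longrightarrow> mat_vec I mat_id u i = u i"
  unfolding mat_vec_def by (subst infsum_ennreal_single[where i=i]) (auto simp: mat_id_def)

lemma mat_vec_mult:
  assumes "countable I"
  shows "mat_vec I (mat_mult I A B) u i = mat_vec I A (mat_vec I B u) i"
proof -
  have "mat_vec I (mat_mult I A B) u i = (\<Sum>\<^sub>\<infinity>j\<in>I. \<Sum>\<^sub>\<infinity>k\<in>I. A i k * B k j * u j)"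
    by (simp add: mat_vec_def mat_mult_def infsum_ennreal_cmult[symmetric] mult.commute[of _ "u _"])
  also have "\<dots> = (\<Sum>\<^sub>\<infinity>k\<in>I. \<Sum>\<^sub>\<infinity>j\<in>I. A i k * B k j * u j)"
    by (rule infsum_ennreal_swap) (use assms in auto)
  also have "\<dots> = mat_vec I A (mat_vec I B u) i"
    by (simp add: mat_vec_def infsum_ennreal_cmult[symmetric] mult.assoc)
  finally show ?thesis .
qed

lemma mat_vec_suminf:
  assumes "countable I"
  shows "mat_vec I (\<lambda>i j. \<Sum>n. A n i j) u i = (\<Sum>n. mat_vec I (A n) u i)"
  by (simp add: mat_vec_def infsum_suminf_swap[OF assms, symmetric])

text \<open>The Neumann series: splitting off the term of index 0 gives \<open>D = Id + W\<^sup>-\<^sup>1 R D\<close>.\<close>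
lemma mat_vec_D:
  assumes I: "countable I" and i: "i \<in> I"
  shows "mat_vec I (D_mat I W R) u i =
         u i + mat_vec I (mat_mult I (diag_inverse W) R) (mat_vec I (D_mat I W R) u) i"
proof -
  let ?M = "mat_mult I (diag_inverse W) R"
  have D: "mat_vec I (D_mat I W R) u j = (\<Sum>n. mat_vec I (mat_power I ?M n) u j)" for j
    using mat_vec_suminf[OF I, of "mat_power I ?M" u j]
    by (simp add: D_mat_def[abs_def])
  have "mat_vec I (D_mat I W R) u i =
      mat_vec I (mat_power I ?M 0) u i + (\<Sum>n. mat_vec I (mat_power I ?M (Suc n)) u i)"
    unfolding D by (subst suminf_offset[of _ 1]) auto
  also have "mat_vec I (mat_power I ?M 0) u i = u i"
    by (simp add: mat_vec_id i)
  also have "(\<Sum>n. mat_vec I (mat_power I ?M (Suc n)) u i) =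
             (\<Sum>n. mat_vec I ?M (mat_vec I (mat_power I ?M n) u) i)"
    by (simp add: mat_vec_mult I)
  also have "\<dots> = mat_vec I ?M (\<lambda>j. \<Sum>n. mat_vec I (mat_power I ?M n) u j) i"
    unfolding mat_vec_def[of I ?M]
    by (subst infsum_suminf_swap[OF I, symmetric]) simp
  also have "\<dots> = mat_vec I ?M (mat_vec I (D_mat I W R) u) i"
    by (simp only: D[abs_def])
  finally show ?thesis .
qed

lemma mat_vec_diag:
  assumes "i \<in> I" "\<And>j. j \<noteq> i \<Longrightarrow> A i j = 0"
  shows "mat_vec I A u i = A i i * u i"
  unfolding mat_vec_def using assms by (subst infsum_ennreal_single[where i=i]) auto

text \<open>
  Multiplying the Neumann identity by W turns \<open>b = D u\<close> into a solution of \<open>(Id - W + R) b + W u = b\<close>,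
  the fixed point equation of the improvement step.
\<close>
lemma diag_mult_mat_vec_D:
  assumes I: "countable I" and i: "i \<in> I" and W: "W i i \<noteq> 0" "W i i < \<top>"
  shows "W i i * mat_vec I (D_mat I W R) u i = W i i * u i + mat_vec I R (mat_vec I (D_mat I W R) u) i"
proof -
  have "W i i * inverse (W i i) = 1"
    using W by (metis ennreal_mult_divide_eq divide_ennreal_def mult.commute mult_1 top.not_eq_extremum mult_divide_eq_ennreal)
  then show ?thesis
    by (subst mat_vec_D[OF I i], subst mat_vec_mult[OF I], subst mat_vec_diag[OF i])
       (auto simp: diag_inverse_def distrib_left mult.assoc[symmetric])
qed

lemma le_mat_vec_D: "countable I \<Longrightarrow> i \<in> I \<Longrightarrow> u i \<le> mat_vec I (D_mat I W R) u i"
  by (subst mat_vec_D) auto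

section \<open>Lazy iteration of a null sequence\<close>

text \<open>
  The n-th iterate of the operator \<open>(1 - \<epsilon>) Id + \<epsilon> shift\<close> on sequences; its values are binomial averages of g.
  When \<open>g k = T\<^sup>k v\<close> for a linear T, it is \<open>((1 - \<epsilon>) Id + \<epsilon> T)\<^sup>n T\<^sup>k v\<close>; the recursive form avoids
  the binomial expansion.
\<close>
primrec lazy_iterate :: "real \<Rightarrow> (nat \<Rightarrow> ennreal) \<Rightarrow> nat \<Rightarrow> nat \<Rightarrow> ennreal" where
  "lazy_iterate \<epsilon> g 0 k = g k"
| "lazy_iterate \<epsilon> g (Suc n) k =
     ennreal (1 - \<epsilon>) * lazy_iterate \<epsilon> g n k + ennreal \<epsilon> * lazy_iterate \<epsilon> g n (Suc k)"

lemma affine_recursion_tendsto: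
  fixes x y :: "nat \<Rightarrow> real"
  assumes q: "0 \<le> q" "q < 1" and rec: "\<And>n. x (Suc n) = q * x n + y n" and y: "y \<longlonglongrightarrow> 0"
  shows "x \<longlonglongrightarrow> 0"
proof (rule LIMSEQ_I)
  fix r :: real assume r: "0 < r"
  have "(1 - q) * (r / 2) > 0" using r q by simp
  with y obtain N where N: "\<And>n. n \<ge> N \<Longrightarrow> \<bar>y n\<bar> < (1 - q) * (r / 2)"
    by (metis LIMSEQ_D diff_zero real_norm_def)
  have bd: "\<bar>x (N + n)\<bar> \<le> q ^ n * \<bar>x N\<bar> + r / 2" for n
  proof (induction n)
    case (Suc n)
    have "\<bar>x (N + Suc n)\<bar> \<le> q * \<bar>x (N + n)\<bar> + \<bar>y (N + n)\<bar>"
      using rec[of "N + n"] q abs_triangle_ineq[of "q * x (N + n)" "y (N + n)"] by (simp add: abs_mult)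
    also have "\<dots> \<le> q * (q ^ n * \<bar>x N\<bar> + r / 2) + (1 - q) * (r / 2)"
      using Suc N[of "N + n"] q by (intro add_mono mult_left_mono) (auto intro: less_imp_le)
    finally show ?case by (simp add: field_simps)
  qed (use r in auto)
  have "(\<lambda>n. q ^ n * \<bar>x N\<bar>) \<longlonglongrightarrow> 0"
    using q by (intro tendsto_mult_left_zero LIMSEQ_power_zero) auto
  then obtain M where M: "\<And>n. n \<ge> M \<Longrightarrow> \<bar>q ^ n * \<bar>x N\<bar>\<bar> < r / 2"
    using r by (metis LIMSEQ_D diff_zero half_gt_zero real_norm_def)
  show "\<exists>no. \<forall>n\<ge>no. norm (x n - 0) < r"
  proof (intro exI[of _ "N + M"] allI impI)
    fix n assume "n \<ge> N + M"
    then obtain k where k: "n = N + k" "k \<ge> M" by (metis add.assoc nat_le_iff_add)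
    show "norm (x n - 0) < r"
      using bd[of k] M[of k] k r by auto
  qed
qed

lemma lazy_iterate_bounded:
  assumes "0 \<le> \<epsilon>" "\<epsilon> \<le> 1" "\<And>k. g k \<le> C"
  shows "lazy_iterate \<epsilon> g n k \<le> C"
proof (induction n arbitrary: k)
  case (Suc n)
  have "lazy_iterate \<epsilon> g (Suc n) k \<le> ennreal (1 - \<epsilon>) * C + ennreal \<epsilon> * C"
    using Suc by (auto intro!: add_mono mult_left_mono)
  also have "\<dots> = C"
    using assms by (simp add: distrib_right[symmetric] ennreal_plus[symmetric] del: ennreal_plus)
  finally show ?case .
qed (use assms in auto)

text \<open>
  A binomial random variable with success probability \<open>\<epsilon> > 0\<close> leaves every bounded range, so averages of a
  null sequence tend to 0, provided the early terms are finite. Subtracting a small constant makes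
  g vanish from some index K on, and downward induction from K then handles one index at a time by a
  contracting affine recursion.
\<close>
lemma lazy_iterate_tendsto_0:
  assumes e: "0 < \<epsilon>" "\<epsilon> \<le> 1" and bd: "\<And>k. g k \<le> C" "C < \<top>" and g: "g \<longlonglongrightarrow> 0"
  shows "(\<lambda>n. lazy_iterate \<epsilon> g n k) \<longlonglongrightarrow> 0"
proof (rule order_tendstoI)
  fix r :: ennreal assume "0 < r"
  then obtain c where c: "0 < c" "c < r" using dense by blast
  then have cfin: "c < \<top>" by (meson order_less_le_trans top_greatest)
  obtain K where K: "\<And>k. k \<ge> K \<Longrightarrow> g k \<le> c"
    using order_tendstoD(2)[OF g c(1)] by (auto simp: eventually_sequentially intro: less_imp_le)
  \<comment> \<open>The iterates of the truncated sequence, as real numbers.\<close>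
  define x where "x = (\<lambda>n k. enn2real (lazy_iterate \<epsilon> (\<lambda>k. g k - c) n k))"
  have fin: "lazy_iterate \<epsilon> (\<lambda>k. g k - c) n k < \<top>" for n k
    using lazy_iterate_bounded[of \<epsilon> "\<lambda>k. g k - c" C n k] e bd
    by (meson diff_le_self_ennreal less_eq_real_def order_le_less_trans order_trans)
  have rec: "x (Suc n) k = (1 - \<epsilon>) * x n k + \<epsilon> * x n (Suc k)" for n k
    unfolding x_def using fin[of n k] fin[of n "Suc k"] e
    by (simp add: enn2real_plus enn2real_mult ennreal_mult_less_top)
  have tail: "lazy_iterate \<epsilon> (\<lambda>k. g k - c) n k = 0" if "k \<ge> K" for n k
    using that by (induction n arbitrary: k) (auto simp: diff_eq_0_iff_ennreal K order_le_less_trans[OF K cfin])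
  have lim: "(\<lambda>n. x n k) \<longlonglongrightarrow> 0" for k
  proof (cases "k \<ge> K")
    case False
    then have "k \<le> K" by simp
    then show ?thesis
    proof (induction k rule: inc_induct)
      case base
      then show ?case by (simp add: x_def tail)
    next
      case (step k)
      show ?case
        by (rule affine_recursion_tendsto[of "1 - \<epsilon>" _ "\<lambda>n. \<epsilon> * x n (Suc k)"])
           (use e rec step in \<open>auto intro!: tendsto_mult_right_zero\<close>)
    qed
  qed (simp add: x_def tail)
  have split: "lazy_iterate \<epsilon> g n k \<le> lazy_iterate \<epsilon> (\<lambda>k. g k - c) n k + c" for n k
  proof (induction n arbitrary: k)
    case 0
    then show ?case by (simp add: add.commute) (metis ennreal_minus_le_iff order_refl)
  next
    case (Suc n)
    have one: "ennreal (1 - \<epsilon>) * c + ennreal \<epsilon> * c = c"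
      using e by (simp add: distrib_right[symmetric] ennreal_plus[symmetric] del: ennreal_plus)
    have "lazy_iterate \<epsilon> g (Suc n) k \<le>
       ennreal (1 - \<epsilon>) * (lazy_iterate \<epsilon> (\<lambda>k. g k - c) n k + c)
       + ennreal \<epsilon> * (lazy_iterate \<epsilon> (\<lambda>k. g k - c) n (Suc k) + c)"
      using Suc by (auto intro!: add_mono mult_left_mono)
    also have "\<dots> = lazy_iterate \<epsilon> (\<lambda>k. g k - c) (Suc n) k + (ennreal (1 - \<epsilon>) * c + ennreal \<epsilon> * c)"
      by (simp add: distrib_left add_ac)
    finally show ?case by (simp add: one)
  qed
  have "(\<lambda>n. ennreal (x n k) + c) \<longlonglongrightarrow> ennreal 0 + c"
    by (intro tendsto_intros lim) 
  then have "\<forall>\<^sub>F n in sequentially. ennreal (x n k) + c < r"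
    using c by (intro order_tendstoD) auto
  moreover have "ennreal (x n k) = lazy_iterate \<epsilon> (\<lambda>k. g k - c) n k" for n
    unfolding x_def using fin by simp
  ultimately show "\<forall>\<^sub>F n in sequentially. lazy_iterate \<epsilon> g n k < r"
    using split by (auto elim!: eventually_mono intro: order_le_less_trans)
qed auto

section \<open>Oscillations and frozen coordinates\<close>

lemma kernel_integral_measurable:
  fixes F :: "'b \<Rightarrow> 'c \<Rightarrow> real"
  assumes F: "(\<lambda>(x, u). F x u) \<in> borel_measurable (M \<Otimes>\<^sub>M N)" and L: "L \<in> M \<rightarrow>\<^sub>M prob_algebra N"
  shows "(\<lambda>x. \<integral>u. F x u \<partial>L x) \<in> borel_measurable M"
proof -
  note [measurable] = F measurable_prob_algebraD[OF L]
  note measurable_distr2[measurable]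
  have "(\<lambda>x. integral\<^sup>L (distr (L x) (M \<Otimes>\<^sub>M N) (\<lambda>y. (x, y))) (\<lambda>(x, y). F x y)) \<in> borel_measurable M"
    by measurable
  then show ?thesis
    by (rule measurable_cong[THEN iffD1, rotated]) (simp add: integral_distr)
qed

lemma ennreal_abs_integral_diff_le:
  fixes f g :: "'b \<Rightarrow> real"
  assumes "integrable M f" "integrable M g"
  shows "ennreal \<bar>(\<integral>x. f x \<partial>M) - (\<integral>x. g x \<partial>M)\<bar> \<le> (\<integral>\<^sup>+x. ennreal \<bar>f x - g x\<bar> \<partial>M)"
proof -
  have "ennreal \<bar>(\<integral>x. f x \<partial>M) - (\<integral>x. g x \<partial>M)\<bar> = ennreal (norm (\<integral>x. f x - g x \<partial>M))"
    using assms by simp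
  also have "\<dots> \<le> (\<integral>\<^sup>+x. ennreal (norm (f x - g x)) \<partial>M)"
    by (rule integral_norm_bound_ennreal) (use assms in auto)
  finally show ?thesis by simp
qed

lemma bounded_measurableI:
  "f \<in> borel_measurable N \<Longrightarrow> (\<And>x. x \<in> space N \<Longrightarrow> \<bar>f x\<bar> \<le> B) \<Longrightarrow> bounded_measurable N f"
  unfolding bounded_measurable_def bounded_real by auto

lemma prob_algebraD:
  assumes "\<kappa> \<in> N \<rightarrow>\<^sub>M prob_algebra M" "x \<in> space N"
  shows "prob_space (\<kappa> x)" "sets (\<kappa> x) = sets M" "space (\<kappa> x) = space M"
proof -
  have "\<kappa> x \<in> space (prob_algebra M)" using assms by (rule measurable_space)
  then show "prob_space (\<kappa> x)" and *: "sets (\<kappa> x) = sets M" by (auto simp: space_prob_algebra)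
  show "space (\<kappa> x) = space M" using * by (rule sets_eq_imp_space_eq)
qed

lemma quasilocal_iff_tendsto:
  "quasilocal N S f \<longleftrightarrow> (\<forall>x\<in>space (PiM N S). \<forall>z\<in>space (PiM N S).
     ((\<lambda>J. f (merge J (N - J) (z, x))) \<longlongrightarrow> f z) (finite_subsets_at_top N))"
  unfolding quasilocal_def by (simp add: tendsto_rabs_zero_iff LIM_zero_iff)

lemma merge_in_space:
  assumes "\<And>i. i \<in> K \<Longrightarrow> x i \<in> space (S i)" "\<And>i. i \<in> L \<Longrightarrow> y i \<in> space (S i)" "N = K \<union> L"
  shows "merge K L (x, y) \<in> space (PiM N S)"
  using assms by (auto simp: space_PiM PiE_iff merge_def extensional_def)

lemma measurable_merge_components:
  assumes g: "\<And>i. i \<in> K \<Longrightarrow> (\<lambda>\<omega>. g \<omega> i) \<in> M \<rightarrow>\<^sub>M S i"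
    and h: "\<And>i. i \<in> L \<Longrightarrow> (\<lambda>\<omega>. h \<omega> i) \<in> M \<rightarrow>\<^sub>M S i" and N: "N = K \<union> L"
  shows "(\<lambda>\<omega>. merge K L (g \<omega>, h \<omega>)) \<in> M \<rightarrow>\<^sub>M PiM N S"
proof (rule measurable_PiM_single')
  fix i assume "i \<in> N"
  then show "(\<lambda>\<omega>. merge K L (g \<omega>, h \<omega>) i) \<in> M \<rightarrow>\<^sub>M S i"
    using g[of i] h[of i] N by (cases "i \<in> K") (auto simp: merge_def)
next
  show "(\<lambda>\<omega> i. merge K L (g \<omega>, h \<omega>) i) \<in> space M \<rightarrow> (\<Pi>\<^sub>E i\<in>N. space (S i))"
    using measurable_space[OF g] measurable_space[OF h] N by (auto simp: merge_def PiE_iff extensional_def)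
qed

definition depends_on :: "'i set \<Rightarrow> ('i \<Rightarrow> 'a measure) \<Rightarrow> 'i set \<Rightarrow> (('i \<Rightarrow> 'a) \<Rightarrow> real) \<Rightarrow> bool" where
  "depends_on I S K f \<longleftrightarrow>
     (\<forall>x\<in>space (PiM I S). \<forall>z\<in>space (PiM I S). (\<forall>i\<in>K. x i = z i) \<longrightarrow> f x = f z)"

lemma depends_onD:
  "depends_on I S K f \<Longrightarrow> x \<in> space (PiM I S) \<Longrightarrow> z \<in> space (PiM I S) \<Longrightarrow> (\<And>i. i \<in> K \<Longrightarrow> x i = z i)
   \<Longrightarrow> f x = f z"
  unfolding depends_on_def by blast

text \<open>The coordinates in K are kept, the others are set to those of y.\<close>
definition freeze :: "'i set \<Rightarrow> 'i set \<Rightarrow> ('i \<Rightarrow> 'a) \<Rightarrow> (('i \<Rightarrow> 'a) \<Rightarrow> real) \<Rightarrow> ('i \<Rightarrow> 'a) \<Rightarrow> real" where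
  "freeze I K y f x = f (merge K (I - K) (x, y))"

locale two_measures =
  fixes I :: "'i set"
    and S :: "'i \<Rightarrow> 'a measure"
    and \<eta> :: "'i \<Rightarrow> 'a \<Rightarrow> 'a \<Rightarrow> real"
    and \<rho> \<rho>' :: "('i \<Rightarrow> 'a) measure"
  assumes sites: "site_spaces I S \<eta>"
    and prob: "prob_measure_on (PiM I S) \<rho>"
    and prob': "prob_measure_on (PiM I S) \<rho>'"
begin

abbreviation \<Omega> where "\<Omega> \<equiv> space (PiM I S)"
abbreviation \<delta> where "\<delta> \<equiv> osc I S \<eta>"

definition mean_dist :: "'i \<Rightarrow> ennreal" where
  "mean_dist j = metric_integral \<eta> j (\<rho> \<Otimes>\<^sub>M \<rho>')"

definition gap :: "(('i \<Rightarrow> 'a) \<Rightarrow> real) \<Rightarrow> ennreal" where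
  "gap f = ennreal \<bar>(\<integral>x. f x \<partial>\<rho>) - (\<integral>x. f x \<partial>\<rho>')\<bar>"

lemma countable_I: "countable I"
  using sites by (simp add: site_spaces_def)

lemma metric: "i \<in> I \<Longrightarrow> Metric_space (space (S i)) (\<eta> i)"
  using sites by (simp add: site_spaces_def)

lemma eta_nonneg [simp]: "i \<in> I \<Longrightarrow> 0 \<le> \<eta> i u v"
  by (rule Metric_space.nonneg[OF metric])

lemma eta_commute: "i \<in> I \<Longrightarrow> \<eta> i u v = \<eta> i v u"
  by (rule Metric_space.commute[OF metric])

lemma measurable_eta: "i \<in> I \<Longrightarrow> (\<lambda>(u, v). \<eta> i u v) \<in> borel_measurable (S i \<Otimes>\<^sub>M S i)"
  using sites by (simp add: site_spaces_def)

lemma measurable_eta_comp [measurable (raw)]: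
  assumes "i \<in> I" "g \<in> M \<rightarrow>\<^sub>M S i" "h \<in> M \<rightarrow>\<^sub>M S i"
  shows "(\<lambda>\<omega>. \<eta> i (g \<omega>) (h \<omega>)) \<in> borel_measurable M"
proof -
  have "(\<lambda>\<omega>. (\<lambda>(u, v). \<eta> i u v) (g \<omega>, h \<omega>)) \<in> borel_measurable M"
    by (rule measurable_compose[OF _ measurable_eta[OF assms(1)]]) (use assms in measurable)
  then show ?thesis by simp
qed

lemma sets_rho [simp, measurable_cong]: "sets \<rho> = sets (PiM I S)"
  and sets_rho' [simp, measurable_cong]: "sets \<rho>' = sets (PiM I S)"
  using prob prob' by (auto simp: prob_measure_on_def)

lemma space_rho [simp]: "space \<rho> = \<Omega>" and space_rho' [simp]: "space \<rho>' = \<Omega>"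
  using sets_rho sets_rho' sets_eq_imp_space_eq by blast+

sublocale rho: prob_space \<rho> using prob by (simp add: prob_measure_on_def)
sublocale rho': prob_space \<rho>' using prob' by (simp add: prob_measure_on_def)

lemma Omega_nonempty: "\<Omega> \<noteq> {}"
  using rho.not_empty by simp

lemma Omega_component: "x \<in> \<Omega> \<Longrightarrow> i \<in> I \<Longrightarrow> x i \<in> space (S i)"
  by (auto simp: space_PiM PiE_iff)

lemma Omega_eqI: "x \<in> \<Omega> \<Longrightarrow> z \<in> \<Omega> \<Longrightarrow> (\<And>i. i \<in> I \<Longrightarrow> x i = z i) \<Longrightarrow> x = z"
  by (auto simp: space_PiM PiE_iff intro: extensionalityI)

lemma merge_Omega: "x \<in> \<Omega> \<Longrightarrow> z \<in> \<Omega> \<Longrightarrow> merge K (I - K) (x, z) \<in> \<Omega>" if "K \<subseteq> I"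
  using that by (intro merge_in_space) (auto simp: Omega_component)

lemma bounded_measurableD:
  assumes "bounded_measurable (PiM I S) f"
  shows "f \<in> borel_measurable (PiM I S)" "\<exists>B\<ge>0. \<forall>x\<in>\<Omega>. \<bar>f x\<bar> \<le> B"
  using assms unfolding bounded_measurable_def bounded_real
  by (auto) (meson abs_ge_zero order_trans dual_order.trans linear)

lemma bounded_measurable_integrable:
  assumes "bounded_measurable (PiM I S) f"
  shows "integrable \<rho> f" "integrable \<rho>' f"
proof -
  obtain B where "\<forall>x\<in>\<Omega>. \<bar>f x\<bar> \<le> B" using bounded_measurableD[OF assms] by blast
  then show "integrable \<rho> f" "integrable \<rho>' f"
    using bounded_measurableD(1)[OF assms]
    by (auto intro!: rho.integrable_const_bound[of _ B] rho'.integrable_const_bound[of _ B] AE_I2)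
qed

lemma osc_bound:
  assumes "i \<in> I" "x \<in> \<Omega>" "z \<in> \<Omega>" "\<And>k. k \<in> I - {i} \<Longrightarrow> x k = z k"
  shows "ennreal \<bar>f x - f z\<bar> \<le> \<delta> i f * ennreal (\<eta> i (x i) (z i))"
proof (cases "x i = z i")
  case True
  then have "x = z" using assms by (intro Omega_eqI) auto
  then show ?thesis by simp
next
  case False
  then have mem: "(x, z) \<in> differ_only_at I S i"
    using assms by (auto simp: differ_only_at_def)
  have pos: "\<eta> i (x i) (z i) > 0"
    using False assms metric[of i] Omega_component[of _ i]
    by (metis Metric_space.mdist_pos_eq)
  have "ennreal (\<bar>f x - f z\<bar> / \<eta> i (x i) (z i)) \<le> \<delta> i f"
    unfolding osc_def by (rule SUP_upper2[OF mem]) simp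
  then have "ennreal (\<bar>f x - f z\<bar> / \<eta> i (x i) (z i)) * ennreal (\<eta> i (x i) (z i))
      \<le> \<delta> i f * ennreal (\<eta> i (x i) (z i))"
    by (rule mult_right_mono) simp
  then show ?thesis using pos by (simp add: ennreal_mult[symmetric])
qed

lemma osc_leI:
  assumes i: "i \<in> I" and
    le: "\<And>x z. x \<in> \<Omega> \<Longrightarrow> z \<in> \<Omega> \<Longrightarrow> (\<And>k. k \<in> I - {i} \<Longrightarrow> x k = z k) \<Longrightarrow> x i \<noteq> z i
      \<Longrightarrow> ennreal \<bar>f x - f z\<bar> \<le> C * ennreal (\<eta> i (x i) (z i))"
  shows "\<delta> i f \<le> C"
  unfolding osc_def
proof (rule SUP_least, clarify)
  fix x z assume "(x, z) \<in> differ_only_at I S i"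
  then have *: "x \<in> \<Omega>" "z \<in> \<Omega>" "\<And>k. k \<in> I - {i} \<Longrightarrow> x k = z k" "x i \<noteq> z i"
    by (auto simp: differ_only_at_def)
  have pos: "\<eta> i (x i) (z i) > 0"
    using * i metric[of i] Omega_component[of _ i]
    by (metis Metric_space.mdist_pos_eq)
  have "ennreal (\<bar>f x - f z\<bar> / \<eta> i (x i) (z i)) = ennreal \<bar>f x - f z\<bar> / ennreal (\<eta> i (x i) (z i))"
    using pos by (simp add: divide_ennreal)
  also have "\<dots> \<le> (C * ennreal (\<eta> i (x i) (z i))) / ennreal (\<eta> i (x i) (z i))"
    by (rule divide_right_mono_ennreal) (rule le[OF *])
  also have "\<dots> = C"
    using pos by (intro ennreal_mult_divide_eq) auto
  finally show "ennreal (\<bar>f x - f z\<bar> / \<eta> i (x i) (z i)) \<le> C" .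
qed

lemma osc_depends_on:
  assumes "depends_on I S K f" "i \<in> I" "i \<notin> K" "K \<subseteq> I"
  shows "\<delta> i f = 0"
proof -
  have "\<delta> i f \<le> 0"
  proof (rule osc_leI[OF assms(2)])
    fix x z assume "x \<in> \<Omega>" "z \<in> \<Omega>" "\<And>k. k \<in> I - {i} \<Longrightarrow> x k = z k"
    then have "f x = f z" using assms by (intro depends_onD[OF assms(1)]) blast+
    then show "ennreal \<bar>f x - f z\<bar> \<le> 0 * ennreal (\<eta> i (x i) (z i))" by simp
  qed
  then show ?thesis by simp
qed

text \<open>The coordinates of x are changed into those of z one at a time, each at the cost of one oscillation.\<close>
lemma osc_finite_path:
  assumes "finite J" "J \<subseteq> I" "x \<in> \<Omega>" "z \<in> \<Omega>" "\<And>k. k \<in> I - J \<Longrightarrow> x k = z k"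
  shows "ennreal \<bar>f x - f z\<bar> \<le> (\<Sum>i\<in>J. \<delta> i f * ennreal (\<eta> i (x i) (z i)))"
  using assms
proof (induction J arbitrary: x rule: finite_induct)
  case empty
  then have "x = z" by (intro Omega_eqI) auto
  then show ?case by simp
next
  case (insert i J)
  define y where "y = x(i := z i)"
  have y: "y \<in> \<Omega>" using insert.prems Omega_component[of z i]
    by (auto simp: y_def space_PiM PiE_iff extensional_def)
  have y': "y i = z i" "\<And>k. k \<noteq> i \<Longrightarrow> y k = x k" by (auto simp: y_def)
  have yz: "y k = z k" if "k \<in> I - J" for k
    using that insert.prems(4)[of k] by (cases "k = i") (auto simp: y')
  have "ennreal \<bar>f x - f z\<bar> \<le> ennreal (\<bar>f x - f y\<bar> + \<bar>f y - f z\<bar>)"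
    by (intro ennreal_leI) simp
  also have "\<dots> = ennreal \<bar>f x - f y\<bar> + ennreal \<bar>f y - f z\<bar>" by simp
  also have "\<dots> \<le> \<delta> i f * ennreal (\<eta> i (x i) (y i)) + (\<Sum>k\<in>J. \<delta> k f * ennreal (\<eta> k (y k) (z k)))"
    using insert.prems insert.hyps y
    by (intro add_mono osc_bound insert.IH) (auto simp: y' yz)
  also have "(\<Sum>k\<in>J. \<delta> k f * ennreal (\<eta> k (y k) (z k))) = (\<Sum>k\<in>J. \<delta> k f * ennreal (\<eta> k (x k) (z k)))"
    using insert.hyps by (intro sum.cong refl, subst y'(2)) auto
  finally show ?case using insert.hyps by (simp add: y')
qed

text \<open>
  By quasilocality, f at z is the limit of f at configurations that differ from x at
  finitely many sites, and for these the telescoping bound applies.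
\<close>
lemma quasilocal_osc_sum:
  assumes q: "quasilocal I S f" and x: "x \<in> \<Omega>" and z: "z \<in> \<Omega>"
  shows "ennreal \<bar>f x - f z\<bar> \<le> (\<Sum>\<^sub>\<infinity>i\<in>I. \<delta> i f * ennreal (\<eta> i (x i) (z i)))"
    (is "_ \<le> ?R")
proof -
  let ?m = "\<lambda>J. merge J (I - J) (z, x)"
  have lim: "((\<lambda>J. \<bar>f (?m J) - f z\<bar>) \<longlongrightarrow> 0) (finite_subsets_at_top I)"
    using q x z by (auto simp: quasilocal_def)
  then have "((\<lambda>J. f (?m J)) \<longlongrightarrow> f z) (finite_subsets_at_top I)"
    by (metis LIM_zero_cancel tendsto_rabs_zero_cancel)
  then have "((\<lambda>J. ennreal \<bar>f x - f (?m J)\<bar>) \<longlongrightarrow> ennreal \<bar>f x - f z\<bar>) (finite_subsets_at_top I)"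
    by (intro tendsto_intros)
  moreover have "\<forall>\<^sub>F J in finite_subsets_at_top I. ennreal \<bar>f x - f (?m J)\<bar> \<le> ?R"
  proof (rule eventually_finite_subsets_at_top_weakI)
    fix J assume J: "finite J" "J \<subseteq> I"
    have "ennreal \<bar>f x - f (?m J)\<bar> \<le> (\<Sum>i\<in>J. \<delta> i f * ennreal (\<eta> i (x i) (?m J i)))"
      using J x z by (intro osc_finite_path merge_Omega) (auto simp: merge_def)
    also have "\<dots> = (\<Sum>i\<in>J. \<delta> i f * ennreal (\<eta> i (x i) (z i)))"
      by (intro sum.cong) (auto simp: merge_def)
    also have "\<dots> \<le> ?R" using J by (rule finite_sum_le_infsum_ennreal)
    finally show "ennreal \<bar>f x - f (?m J)\<bar> \<le> ?R" .
  qed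
  ultimately show ?thesis
    by (intro tendsto_upperbound) auto
qed

lemma depends_on_quasilocal:
  assumes "depends_on I S K f" "finite K" "K \<subseteq> I"
  shows "quasilocal I S f"
  unfolding quasilocal_def
proof (intro ballI tendsto_eventually)
  fix x z assume x: "x \<in> \<Omega>" and z: "z \<in> \<Omega>"
  have "\<forall>\<^sub>F J in finite_subsets_at_top I. K \<subseteq> J \<and> J \<subseteq> I"
    using assms by (auto simp: eventually_finite_subsets_at_top)
  then show "\<forall>\<^sub>F J in finite_subsets_at_top I. \<bar>f (merge J (I - J) (z, x)) - f z\<bar> = 0"
  proof eventually_elim
    case (elim J)
    then have "merge J (I - J) (z, x) \<in> \<Omega>" using x z by (intro merge_Omega) auto
    moreover have "\<forall>i\<in>K. merge J (I - J) (z, x) i = z i" using elim by (auto simp: merge_def)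
    ultimately have "f (merge J (I - J) (z, x)) = f z"
      using z by (intro depends_onD[OF assms(1)]) blast+
    then show ?case by simp
  qed
qed

lemma freeze_measurable:
  assumes "bounded_measurable (PiM I S) f" "K \<subseteq> I" "y \<in> \<Omega>"
  shows "bounded_measurable (PiM I S) (freeze I K y f)"
proof -
  obtain B where B: "\<forall>x\<in>\<Omega>. \<bar>f x\<bar> \<le> B" using bounded_measurableD[OF assms(1)] by blast
  have "(\<lambda>x. merge K (I - K) (x, y)) \<in> PiM I S \<rightarrow>\<^sub>M PiM I S"
    using assms by (intro measurable_merge_components) (auto intro!: measurable_const Omega_component)
  then have "freeze I K y f \<in> borel_measurable (PiM I S)"
    unfolding freeze_def[abs_def] by (rule measurable_compose) (rule bounded_measurableD[OF assms(1)])
  then show ?thesis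
    using B assms by (intro bounded_measurableI[of _ _ B]) (auto simp: freeze_def merge_Omega)
qed

lemma freeze_depends_on:
  "K \<subseteq> I \<Longrightarrow> y \<in> \<Omega> \<Longrightarrow> depends_on I S K (freeze I K y f)"
  unfolding depends_on_def freeze_def
  by (intro ballI impI arg_cong[of _ _ f]) (auto simp: merge_def fun_eq_iff)

lemma osc_freeze_le:
  assumes "K \<subseteq> I" "y \<in> \<Omega>" "i \<in> K"
  shows "\<delta> i (freeze I K y f) \<le> \<delta> i f"
proof (rule osc_leI)
  fix x z assume *: "x \<in> \<Omega>" "z \<in> \<Omega>" "\<And>k. k \<in> I - {i} \<Longrightarrow> x k = z k"
  have "ennreal \<bar>f (merge K (I - K) (x, y)) - f (merge K (I - K) (z, y))\<bar> \<le>
     \<delta> i f * ennreal (\<eta> i (merge K (I - K) (x, y) i) (merge K (I - K) (z, y) i))"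
    using assms * by (intro osc_bound merge_Omega) (auto simp: merge_def)
  then show "ennreal \<bar>freeze I K y f x - freeze I K y f z\<bar> \<le> \<delta> i f * ennreal (\<eta> i (x i) (z i))"
    using assms by (simp add: freeze_def merge_def)
qed (use assms in auto)

lemma mean_dist_iterated: "i \<in> I \<Longrightarrow> mean_dist i = (\<integral>\<^sup>+z. \<integral>\<^sup>+x. ennreal (\<eta> i (x i) (z i)) \<partial>\<rho> \<partial>\<rho>')"
proof -
  assume i: "i \<in> I"
  interpret pair_sigma_finite \<rho> \<rho>' ..
  have "(\<lambda>p. ennreal (\<eta> i (fst p i) (snd p i))) \<in> borel_measurable (\<rho> \<Otimes>\<^sub>M \<rho>')"
    using i by measurable
  from nn_integral_snd[OF this] show ?thesis
    by (simp add: mean_dist_def metric_integral_def case_prod_beta')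
qed

text \<open>Two independent samples of \<open>\<rho>'\<close> are compared through a third point drawn from \<open>\<rho>\<close>.\<close>
lemma mean_dist_self: 
  assumes i: "i \<in> I"
  shows "(\<integral>\<^sup>+y. \<integral>\<^sup>+x. ennreal (\<eta> i (x i) (y i)) \<partial>\<rho>' \<partial>\<rho>') \<le> 2 * mean_dist i"
proof -
  interpret pair_sigma_finite \<rho> \<rho>' ..
  interpret pair': pair_sigma_finite \<rho>' \<rho>' ..
  note [measurable] = i
  define q where "q = (\<lambda>y. \<integral>\<^sup>+u. ennreal (\<eta> i (u i) (y i)) \<partial>\<rho>)"
  have [measurable]: "q \<in> borel_measurable \<rho>'" unfolding q_def by measurable
  have qm: "(\<lambda>u. ennreal (\<eta> i (u i) (y i))) \<in> borel_measurable \<rho>" if "y \<in> \<Omega>" for y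
    by (measurable, use that i in \<open>auto intro: Omega_component\<close>)
  have "(\<integral>\<^sup>+y. \<integral>\<^sup>+x. ennreal (\<eta> i (x i) (y i)) \<partial>\<rho>' \<partial>\<rho>') =
        (\<integral>\<^sup>+y. \<integral>\<^sup>+x. \<integral>\<^sup>+u. ennreal (\<eta> i (x i) (y i)) \<partial>\<rho> \<partial>\<rho>' \<partial>\<rho>')"
    by (simp add: rho.emeasure_space_1[simplified])
  also have "\<dots> \<le> (\<integral>\<^sup>+y. \<integral>\<^sup>+x. \<integral>\<^sup>+u. ennreal (\<eta> i (u i) (x i)) + ennreal (\<eta> i (u i) (y i)) \<partial>\<rho> \<partial>\<rho>' \<partial>\<rho>')"
  proof (intro nn_integral_mono)
    fix y x u assume "y \<in> space \<rho>'" "x \<in> space \<rho>'" "u \<in> space \<rho>"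
    then have "\<eta> i (x i) (y i) \<le> \<eta> i (x i) (u i) + \<eta> i (u i) (y i)"
      using i by (intro Metric_space.triangle[OF metric]) (auto simp: Omega_component)
    then show "ennreal (\<eta> i (x i) (y i)) \<le> ennreal (\<eta> i (u i) (x i)) + ennreal (\<eta> i (u i) (y i))"
      using i by (simp add: ennreal_plus[symmetric] eta_commute[OF i, of "x i"] ennreal_leI del: ennreal_plus)
  qed
  also have "\<dots> = (\<integral>\<^sup>+y. \<integral>\<^sup>+x. q x + q y \<partial>\<rho>' \<partial>\<rho>')"
    unfolding q_def using qm by (intro nn_integral_cong nn_integral_add) auto
  also have "\<dots> = (\<integral>\<^sup>+y. (\<integral>\<^sup>+x. q x \<partial>\<rho>') + q y \<partial>\<rho>')"
    by (simp add: nn_integral_add rho'.emeasure_space_1[simplified])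
  also have "\<dots> = mean_dist i + mean_dist i"
    by (simp add: nn_integral_add rho'.emeasure_space_1[simplified] mean_dist_iterated[OF i] q_def[symmetric])
  finally show ?thesis by (simp add: mult_2)
qed

text \<open>
  For each y the two integrals of f move by the distances to y at the frozen sites. The left side does
  not depend on y, so y may be averaged over \<open>\<rho>'\<close>; the samples of \<open>\<rho>\<close> then contribute \<open>m j\<close> and those of
  \<open>\<rho>'\<close> contribute at most \<open>2 m j\<close>. Averaging avoids choosing a configuration y for which
  all of these distances are finite.
\<close>
lemma gap_le_freeze:
  assumes f: "bounded_measurable (PiM I S) f" "quasilocal I S f" and K: "K \<subseteq> I"
    and B: "\<And>y. y \<in> \<Omega> \<Longrightarrow> gap (freeze I K y f) \<le> B"
  shows "gap f \<le> B + (\<Sum>\<^sub>\<infinity>j\<in>I - K. \<delta> j f * (3 * mean_dist j))"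
proof -
  define p where "p = (\<lambda>M j y. \<integral>\<^sup>+x. ennreal (\<eta> j (x j) (y j)) \<partial>(M :: ('i \<Rightarrow> 'a) measure))"
  have cnt: "countable (I - K)" using countable_I by (rule countable_subset[rotated]) auto
  have err: "(\<integral>\<^sup>+x. ennreal \<bar>f x - freeze I K y f x\<bar> \<partial>M) \<le> (\<Sum>\<^sub>\<infinity>j\<in>I - K. \<delta> j f * p M j y)"
    if y: "y \<in> \<Omega>" and M: "sets M = sets (PiM I S)" for y M
  proof -
    note [measurable_cong] = M
    have sp: "space M = \<Omega>" using M by (rule sets_eq_imp_space_eq)
    have "(\<integral>\<^sup>+x. ennreal \<bar>f x - freeze I K y f x\<bar> \<partial>M)
        \<le> (\<integral>\<^sup>+x. (\<Sum>\<^sub>\<infinity>j\<in>I - K. \<delta> j f * ennreal (\<eta> j (x j) (y j))) \<partial>M)"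
    proof (intro nn_integral_mono)
      fix x assume x: "x \<in> space M"
      let ?z = "merge K (I - K) (x, y)"
      have "ennreal \<bar>f x - f ?z\<bar> \<le> (\<Sum>\<^sub>\<infinity>j\<in>I. \<delta> j f * ennreal (\<eta> j (x j) (?z j)))"
        using x y K f by (intro quasilocal_osc_sum merge_Omega) (auto simp: sp)
      also have "\<dots> = (\<Sum>\<^sub>\<infinity>j\<in>I - K. \<delta> j f * ennreal (\<eta> j (x j) (y j)))"
      proof (rule infsum_cong_neutral)
        fix j assume j: "j \<in> I - (I - K)"
        then have "\<eta> j (x j) (x j) = 0"
          using x Metric_space.mdist_zero[OF metric] by (auto simp: sp Omega_component)
        then show "\<delta> j f * ennreal (\<eta> j (x j) (?z j)) = 0" using j by (simp add: merge_def)
      qed (auto simp: merge_def)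
      finally show "ennreal \<bar>f x - freeze I K y f x\<bar> \<le> (\<Sum>\<^sub>\<infinity>j\<in>I - K. \<delta> j f * ennreal (\<eta> j (x j) (y j)))"
        by (simp add: freeze_def)
    qed
    also have "\<dots> = (\<Sum>\<^sub>\<infinity>j\<in>I - K. \<integral>\<^sup>+x. \<delta> j f * ennreal (\<eta> j (x j) (y j)) \<partial>M)"
      using y by (intro nn_integral_infsum cnt) (measurable, auto intro!: Omega_component)
    also have "\<dots> = (\<Sum>\<^sub>\<infinity>j\<in>I - K. \<delta> j f * p M j y)"
      unfolding p_def using y
      by (intro infsum_cong nn_integral_cmult) (measurable, auto intro!: Omega_component)
    finally show ?thesis .
  qed
  have pt: "gap f \<le> B + (\<Sum>\<^sub>\<infinity>j\<in>I - K. \<delta> j f * (p \<rho> j y + p \<rho>' j y))" if y: "y \<in> \<Omega>" for y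
  proof -
    let ?g = "freeze I K y f"
    note int = bounded_measurable_integrable[OF f(1)] bounded_measurable_integrable[OF freeze_measurable[OF f(1) K y]]
    have "gap f \<le> ennreal (\<bar>(\<integral>x. ?g x \<partial>\<rho>) - (\<integral>x. ?g x \<partial>\<rho>')\<bar> +
       (\<bar>(\<integral>x. f x \<partial>\<rho>) - (\<integral>x. ?g x \<partial>\<rho>)\<bar> + \<bar>(\<integral>x. f x \<partial>\<rho>') - (\<integral>x. ?g x \<partial>\<rho>')\<bar>))"
      unfolding gap_def by (intro ennreal_leI) linarith
    also have "\<dots> = gap ?g + (ennreal \<bar>(\<integral>x. f x \<partial>\<rho>) - (\<integral>x. ?g x \<partial>\<rho>)\<bar> + ennreal \<bar>(\<integral>x. f x \<partial>\<rho>') - (\<integral>x. ?g x \<partial>\<rho>')\<bar>)"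
      by (simp add: gap_def)
    also have "\<dots> \<le> B + ((\<Sum>\<^sub>\<infinity>j\<in>I - K. \<delta> j f * p \<rho> j y) + (\<Sum>\<^sub>\<infinity>j\<in>I - K. \<delta> j f * p \<rho>' j y))"
      using int y
      by (intro add_mono B order_trans[OF ennreal_abs_integral_diff_le err]) auto
    also have "\<dots> = B + (\<Sum>\<^sub>\<infinity>j\<in>I - K. \<delta> j f * (p \<rho> j y + p \<rho>' j y))"
      by (simp add: infsum_add distrib_left)
    finally show ?thesis .
  qed
  have pm: "p M j \<in> borel_measurable \<rho>'" if "j \<in> I" "M = \<rho> \<or> M = \<rho>'" for j M
  proof -
    interpret M: prob_space M using that rho.prob_space_axioms rho'.prob_space_axioms by auto
    note [measurable] = that(1)
    have [measurable_cong]: "sets M = sets (PiM I S)" using that by auto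
    show ?thesis unfolding p_def by measurable
  qed
  have "gap f = (\<integral>\<^sup>+y. gap f \<partial>\<rho>')" by (simp add: rho'.emeasure_space_1[simplified])
  also have "\<dots> \<le> (\<integral>\<^sup>+y. B + (\<Sum>\<^sub>\<infinity>j\<in>I - K. \<delta> j f * (p \<rho> j y + p \<rho>' j y)) \<partial>\<rho>')"
    by (intro nn_integral_mono pt) simp
  also have "\<dots> = B + (\<integral>\<^sup>+y. (\<Sum>\<^sub>\<infinity>j\<in>I - K. \<delta> j f * (p \<rho> j y + p \<rho>' j y)) \<partial>\<rho>')"
    using pm by (subst nn_integral_add) (auto simp: rho'.emeasure_space_1[simplified] intro!: borel_measurable_infsum cnt)
  also have "\<dots> = B + (\<Sum>\<^sub>\<infinity>j\<in>I - K. \<integral>\<^sup>+y. \<delta> j f * (p \<rho> j y + p \<rho>' j y) \<partial>\<rho>')"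
    using pm by (subst nn_integral_infsum[OF cnt]) auto
  also have "\<dots> \<le> B + (\<Sum>\<^sub>\<infinity>j\<in>I - K. \<delta> j f * (3 * mean_dist j))"
  proof (intro add_left_mono infsum_mono)
    fix j assume "j \<in> I - K" then have j: "j \<in> I" by simp
    have "(\<integral>\<^sup>+y. p \<rho> j y + p \<rho>' j y \<partial>\<rho>') = (\<integral>\<^sup>+y. p \<rho> j y \<partial>\<rho>') + (\<integral>\<^sup>+y. p \<rho>' j y \<partial>\<rho>')"
      using pm j by (intro nn_integral_add) auto
    also have "\<dots> \<le> mean_dist j + 2 * mean_dist j"
      using mean_dist_self[OF j] mean_dist_iterated[OF j] by (intro add_mono) (auto simp: p_def)
    also have "\<dots> = 3 * mean_dist j"
      using distrib_right[of 1 2 "mean_dist j"] by simp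
    finally show "(\<integral>\<^sup>+y. \<delta> j f * (p \<rho> j y + p \<rho>' j y) \<partial>\<rho>') \<le> \<delta> j f * (3 * mean_dist j)"
      using pm j by (subst nn_integral_cmult) (auto intro: mult_left_mono)
  qed auto
  finally show ?thesis .
qed

end

section \<open>Updating a single block\<close>

locale one_sided_coupled_updates = two_measures I S \<eta> \<rho> \<rho>'
  for I :: "'i set"
    and S :: "'i \<Rightarrow> 'a measure"
    and \<eta> :: "'i \<Rightarrow> 'a \<Rightarrow> 'a \<Rightarrow> real"
    and \<rho> \<rho>' :: "('i \<Rightarrow> 'a) measure" +
  fixes \<tau> :: "'i \<Rightarrow> int"
    and \<J> :: "'i set set"
    and \<gamma> \<gamma>' :: "'i set \<Rightarrow> ('i \<Rightarrow> 'a) \<Rightarrow> ('i \<Rightarrow> 'a) measure"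
    and Q :: "'i set \<Rightarrow> ('i \<Rightarrow> 'a) \<times> ('i \<Rightarrow> 'a) \<Rightarrow> (('i \<Rightarrow> 'a) \<times> ('i \<Rightarrow> 'a)) measure"
    and Qh :: "'i set \<Rightarrow> ('i \<Rightarrow> 'a) \<Rightarrow> (('i \<Rightarrow> 'a) \<times> ('i \<Rightarrow> 'a)) measure"
    and w :: "'i set \<Rightarrow> real"
  assumes rule: "one_sided_coupled_update_rule I S \<tau> \<J> \<rho> \<rho>' \<gamma> \<gamma>' Q Qh"
    and w_pos: "J \<in> \<J> \<Longrightarrow> w J > 0"
    and kernel_quasilocal: "J \<in> \<J> \<Longrightarrow> quasilocal_kernel (past I \<tau> J) J S (\<gamma> J)"
begin

abbreviation R where "R \<equiv> R_mat I S \<eta> \<tau> \<J> w Q"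
abbreviation W where "W \<equiv> W_mat \<J> w"
abbreviation a where "a \<equiv> a_vec I \<eta> \<tau> \<J> w \<rho>' Qh"

lemma cover: "is_cover I \<J>"
  using rule by (simp add: one_sided_coupled_update_rule_def one_sided_local_update_rule_def)

lemma block: "finite J" "J \<subseteq> I" "J \<noteq> {}" "i \<in> J \<Longrightarrow> \<tau> i = level \<tau> J" if J: "J \<in> \<J>"
proof -
  show f: "finite J" and "J \<subseteq> I" using cover J by (auto simp: is_cover_def)
  show ne: "J \<noteq> {}" and "i \<in> J \<Longrightarrow> \<tau> i = level \<tau> J"
  proof -
    have *: "J \<noteq> {}" "Min (\<tau> ` J) = Max (\<tau> ` J)"
      using rule J by (auto simp: one_sided_coupled_update_rule_def one_sided_local_update_rule_def)
    then show "J \<noteq> {}" by simp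
    assume "i \<in> J"
    then show "\<tau> i = level \<tau> J"
      using * f unfolding level_def
      by (metis Max_ge Min_le antisym finite_imageI imageI)
  qed
qed

lemma past_iff: "i \<in> past I \<tau> J \<longleftrightarrow> i \<in> I \<and> \<tau> i \<le> level \<tau> J"
  by (simp add: past_def sites_upto_def)

lemma past_subset: "past I \<tau> J \<subseteq> I"
  by (auto simp: past_iff)

lemma block_subset_past: "J \<in> \<J> \<Longrightarrow> J \<subseteq> past I \<tau> J"
  using block by (fastforce simp: past_iff)

lemma restrict_past: "x \<in> \<Omega> \<Longrightarrow> restrict x (past I \<tau> J) \<in> space (PiM (past I \<tau> J) S)"
  by (auto simp: space_PiM past_iff PiE_iff)

lemma measurable_restrict_past: "(\<lambda>x. restrict x (past I \<tau> J)) \<in> PiM I S \<rightarrow>\<^sub>M PiM (past I \<tau> J) S"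
  by (rule measurable_restrict_subset[OF past_subset])

lemma kernels:
  assumes "J \<in> \<J>"
  shows "\<gamma> J \<in> PiM (past I \<tau> J) S \<rightarrow>\<^sub>M prob_algebra (PiM J S)"
    and "\<gamma>' J \<in> PiM (past I \<tau> J) S \<rightarrow>\<^sub>M prob_algebra (PiM J S)"
    and "Qh J \<in> PiM (past I \<tau> J) S \<rightarrow>\<^sub>M prob_algebra (PiM J S \<Otimes>\<^sub>M PiM J S)"
    and "x \<in> space (PiM (past I \<tau> J) S) \<Longrightarrow> is_coupling (PiM J S) (Qh J x) (\<gamma> J x) (\<gamma>' J x)"
    and "(x, z) \<in> single_site_pairs (past I \<tau> J) S \<Longrightarrow> is_coupling (PiM J S) (Q J (x, z)) (\<gamma> J x) (\<gamma> J z)"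
    and "kernel_invariant (past I \<tau> J) J S (marginal (past I \<tau> J) S \<rho>) (\<gamma> J)"
    and "kernel_invariant (past I \<tau> J) J S (marginal (past I \<tau> J) S \<rho>') (\<gamma>' J)"
  using rule assms
  by (auto simp: one_sided_coupled_update_rule_def one_sided_local_update_rule_def transition_kernel_def)

text \<open>
  The function \<open>\<gamma>\<^sup>J f\<close>, with the block kernel as a parameter so that it serves for both \<open>\<gamma>\<close> and \<open>\<gamma>'\<close>.
\<close>
definition update :: "('i set \<Rightarrow> ('i \<Rightarrow> 'a) \<Rightarrow> ('i \<Rightarrow> 'a) measure) \<Rightarrow> 'i set \<Rightarrow> (('i \<Rightarrow> 'a) \<Rightarrow> real)
    \<Rightarrow> ('i \<Rightarrow> 'a) \<Rightarrow> real" where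
  "update \<kappa> J f x = (\<integral>u. f (merge J (I - J) (u, x)) \<partial>\<kappa> J (restrict x (past I \<tau> J)))"

lemma merge_block_Omega:
  assumes "J \<in> \<J>" "u \<in> space (PiM J S)" "x \<in> \<Omega>"
  shows "merge J (I - J) (u, x) \<in> \<Omega>"
  using assms block(2)[OF assms(1)] by (intro merge_in_space) (auto simp: Omega_component space_PiM PiE_iff)

lemma measurable_merge_block:
  assumes "J \<in> \<J>" "x \<in> \<Omega>"
  shows "(\<lambda>u. merge J (I - J) (u, x)) \<in> PiM J S \<rightarrow>\<^sub>M PiM I S"
  using assms block(2)[OF assms(1)]
  by (intro measurable_merge_components) (auto intro!: measurable_const Omega_component)

lemma update_bounded_measurable:
  assumes J: "J \<in> \<J>" and \<kappa>: "\<kappa> J \<in> PiM (past I \<tau> J) S \<rightarrow>\<^sub>M prob_algebra (PiM J S)"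
    and f: "bounded_measurable (PiM I S) f"
  shows "bounded_measurable (PiM I S) (update \<kappa> J f)"
proof -
  obtain B where B: "0 \<le> B" "\<forall>x\<in>\<Omega>. \<bar>f x\<bar> \<le> B" using bounded_measurableD[OF f] by blast
  have "(\<lambda>p. merge J (I - J) (snd p, fst p)) \<in> PiM I S \<Otimes>\<^sub>M PiM J S \<rightarrow>\<^sub>M PiM I S"
    using block(2)[OF J] by (intro measurable_merge_components) auto
  then have "(\<lambda>p. f (merge J (I - J) (snd p, fst p))) \<in> borel_measurable (PiM I S \<Otimes>\<^sub>M PiM J S)"
    by (rule measurable_compose) (rule bounded_measurableD[OF f])
  then have "update \<kappa> J f \<in> borel_measurable (PiM I S)"
    unfolding update_def[abs_def]
    by (intro kernel_integral_measurable[where N = "PiM J S"] measurable_compose[OF measurable_restrict_past \<kappa>])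
       (simp add: case_prod_beta')
  moreover have "\<bar>update \<kappa> J f x\<bar> \<le> B" if x: "x \<in> \<Omega>" for x
  proof -
    let ?k = "\<kappa> J (restrict x (past I \<tau> J))"
    note K = prob_algebraD[OF \<kappa> restrict_past[OF x]]
    interpret k: prob_space ?k by (rule K)
    have "(\<lambda>u. f (merge J (I - J) (u, x))) \<in> borel_measurable ?k"
      using measurable_compose[OF measurable_merge_block[OF J x] bounded_measurableD(1)[OF f]]
        measurable_cong_sets[OF K(2) refl] by blast
    moreover have "\<bar>f (merge J (I - J) (u, x))\<bar> \<le> B" if "u \<in> space ?k" for u
      using B(2) merge_block_Omega[OF J _ x] K(3) that by simp
    ultimately have int: "integrable ?k (\<lambda>u. f (merge J (I - J) (u, x)))"
      and bd: "AE u in ?k. f (merge J (I - J) (u, x)) \<le> B" "AE u in ?k. - B \<le> f (merge J (I - J) (u, x))"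
      by (auto intro!: k.integrable_const_bound[of _ B] AE_I2 simp: abs_le_iff) (metis minus_le_iff)
    show ?thesis
      using k.integral_le_const[OF int bd(1)] k.integral_ge_const[OF int bd(2)]
      by (simp add: update_def abs_le_iff)
  qed
  ultimately show ?thesis by (rule bounded_measurableI)
qed

text \<open>
  Invariance is given for functions on the configurations of the past. A function f that depends only on
  K in the past is such a function once the later coordinates are filled with those of an arbitrary y.
\<close>
lemma update_invariant_of_kernel_invariant:
  assumes J: "J \<in> \<J>" and \<kappa>: "\<kappa> J \<in> PiM (past I \<tau> J) S \<rightarrow>\<^sub>M prob_algebra (PiM J S)"
    and \<mu>: "sets \<mu> = sets (PiM I S)" 
    and inv: "kernel_invariant (past I \<tau> J) J S (marginal (past I \<tau> J) S \<mu>) (\<kappa> J)"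
    and f: "bounded_measurable (PiM I S) f" and K: "depends_on I S K f" "K \<subseteq> past I \<tau> J"
  shows "(\<integral>x. update \<kappa> J f x \<partial>\<mu>) = (\<integral>x. f x \<partial>\<mu>)"
proof -
  let ?P = "past I \<tau> J"
  obtain y where y: "y \<in> \<Omega>" using Omega_nonempty by blast
  define g where "g = (\<lambda>p. f (merge ?P (I - ?P) (p, y)))"
  have sp: "space \<mu> = \<Omega>" using \<mu> by (rule sets_eq_imp_space_eq)
  have rP: "(\<lambda>x. restrict x ?P) \<in> \<mu> \<rightarrow>\<^sub>M PiM ?P S"
    using measurable_restrict_past measurable_cong_sets[OF \<mu> refl] by blast
  obtain B where B: "0 \<le> B" "\<forall>x\<in>\<Omega>. \<bar>f x\<bar> \<le> B" using bounded_measurableD[OF f] by blast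
  have mP: "merge ?P (I - ?P) (p, y) \<in> \<Omega>" if "p \<in> space (PiM ?P S)" for p
    using that y by (intro merge_in_space) (auto simp: Omega_component space_PiM PiE_iff past_iff)
  have "(\<lambda>p. merge ?P (I - ?P) (p, y)) \<in> PiM ?P S \<rightarrow>\<^sub>M PiM I S"
    using y by (intro measurable_merge_components) (auto intro!: measurable_const Omega_component simp: past_iff)
  then have gm: "g \<in> borel_measurable (PiM ?P S)"
    unfolding g_def by (rule measurable_compose) (rule bounded_measurableD[OF f])
  then have "bounded_measurable (PiM ?P S) g"
    using B mP by (intro bounded_measurableI[of _ _ B]) (auto simp: g_def)
  then have "(\<integral>p. g p \<partial>marginal ?P S \<mu>) = (\<integral>p. (\<integral>u. g (merge J (?P - J) (u, p)) \<partial>\<kappa> J p) \<partial>marginal ?P S \<mu>)"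
    using inv by (simp add: kernel_invariant_def)
  moreover have "(\<integral>p. g p \<partial>marginal ?P S \<mu>) = (\<integral>x. g (restrict x ?P) \<partial>\<mu>)"
    unfolding marginal_def using gm rP by (simp add: integral_distr)
  moreover have "(\<integral>x. g (restrict x ?P) \<partial>\<mu>) = (\<integral>x. f x \<partial>\<mu>)"
  proof (rule Bochner_Integration.integral_cong)
    fix x assume "x \<in> space \<mu>"
    then have x: "x \<in> \<Omega>" by (simp add: sp)
    show "g (restrict x ?P) = f x"
      unfolding g_def using K x mP[OF restrict_past[OF x]]
      by (intro depends_onD[OF K(1)]) (auto simp: merge_def)
  qed simp
  moreover have "(\<integral>p. (\<integral>u. g (merge J (?P - J) (u, p)) \<partial>\<kappa> J p) \<partial>marginal ?P S \<mu>) =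
      (\<integral>x. (\<integral>u. g (merge J (?P - J) (u, restrict x ?P)) \<partial>\<kappa> J (restrict x ?P)) \<partial>\<mu>)"
  proof -
    have "(\<lambda>p. merge J (?P - J) (snd p, fst p)) \<in> PiM ?P S \<Otimes>\<^sub>M PiM J S \<rightarrow>\<^sub>M PiM ?P S"
      using block_subset_past[OF J] by (intro measurable_merge_components) auto
    then have "(\<lambda>p. g (merge J (?P - J) (snd p, fst p))) \<in> borel_measurable (PiM ?P S \<Otimes>\<^sub>M PiM J S)"
      by (rule measurable_compose) (rule gm)
    then have "(\<lambda>p. (\<integral>u. g (merge J (?P - J) (u, p)) \<partial>\<kappa> J p)) \<in> borel_measurable (PiM ?P S)"
      by (intro kernel_integral_measurable[where N = "PiM J S"] \<kappa>) (simp add: case_prod_beta')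
    then show ?thesis unfolding marginal_def using rP by (simp add: integral_distr)
  qed
  moreover have "(\<integral>x. (\<integral>u. g (merge J (?P - J) (u, restrict x ?P)) \<partial>\<kappa> J (restrict x ?P)) \<partial>\<mu>) =
      (\<integral>x. update \<kappa> J f x \<partial>\<mu>)"
    unfolding update_def
  proof (intro Bochner_Integration.integral_cong refl)
    fix x u assume "x \<in> space \<mu>" and u: "u \<in> space (\<kappa> J (restrict x ?P))"
    then have x: "x \<in> \<Omega>" by (simp add: sp)
    have u: "u \<in> space (PiM J S)" using u prob_algebraD[OF \<kappa> restrict_past[OF x]] by simp
    have "merge J (?P - J) (u, restrict x ?P) \<in> space (PiM ?P S)"
      using block_subset_past[OF J] x u
      by (intro merge_in_space) (auto simp: space_PiM PiE_iff past_iff)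
    then show "g (merge J (?P - J) (u, restrict x ?P)) = f (merge J (I - J) (u, x))"
      unfolding g_def using K(2) past_subset[of J]
      by (intro depends_onD[OF K(1)] mP merge_block_Omega[OF J u x]) (auto simp: merge_def)
  qed
  ultimately show ?thesis by simp
qed

lemma update_invariant:
  assumes J: "J \<in> \<J>" and f: "bounded_measurable (PiM I S) f" and K: "depends_on I S K f" "K \<subseteq> past I \<tau> J"
  shows "(\<integral>x. update \<gamma> J f x \<partial>\<rho>) = (\<integral>x. f x \<partial>\<rho>)" "(\<integral>x. update \<gamma>' J f x \<partial>\<rho>') = (\<integral>x. f x \<partial>\<rho>')"
  using kernels[OF J] by (auto intro!: update_invariant_of_kernel_invariant[OF J _ _ _ f K])

text \<open>
  In \<open>\<gamma>\<^sup>J f\<close> the argument enters through the kernel and through f itself. Because K is finite, the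
  second dependence becomes constant as soon as the configurations agree on K, which leaves a fixed
  function on the block; there quasilocality of the kernel applies.
\<close>
lemma update_quasilocal:
  assumes J: "J \<in> \<J>" and f: "bounded_measurable (PiM I S) f" and K: "depends_on I S K f" "finite K" "K \<subseteq> past I \<tau> J"
  shows "quasilocal I S (update \<gamma> J f)"
  unfolding quasilocal_iff_tendsto
proof (intro ballI)
  fix x z assume x: "x \<in> \<Omega>" and z: "z \<in> \<Omega>"
  let ?P = "past I \<tau> J"
  obtain B where B: "0 \<le> B" "\<forall>x\<in>\<Omega>. \<bar>f x\<bar> \<le> B" using bounded_measurableD[OF f] by blast
  define \<phi> where "\<phi> = (\<lambda>u. f (merge J (I - J) (u, z)))"
  have "\<phi> \<in> borel_measurable (PiM J S)"
    unfolding \<phi>_def by (rule measurable_compose[OF measurable_merge_block[OF J z]]) (rule bounded_measurableD[OF f])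
  then have \<phi>: "bounded_measurable (PiM J S) \<phi>"
    using B merge_block_Omega[OF J _ z] by (intro bounded_measurableI[of _ _ B]) (auto simp: \<phi>_def)
  have "quasilocal J S \<phi>"
    unfolding quasilocal_iff_tendsto finite_subsets_at_top_finite[OF block(1)[OF J]]
  proof (intro ballI tendsto_eventually)
    fix u v assume "u \<in> space (PiM J S)" "v \<in> space (PiM J S)"
    then have "merge J (J - J) (v, u) = v" by (auto simp: merge_def space_PiM PiE_iff extensional_def)
    then show "\<forall>\<^sub>F L in principal {J}. \<phi> (merge L (J - L) (v, u)) = \<phi> v"
      by (simp add: eventually_principal)
  qed
  with kernel_quasilocal[OF J] \<phi> have "quasilocal ?P S (\<lambda>p. \<integral>u. \<phi> u \<partial>\<gamma> J p)"
    by (simp add: quasilocal_kernel_def)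
  then have lim: "((\<lambda>L. \<integral>u. \<phi> u \<partial>\<gamma> J (merge L (?P - L) (restrict z ?P, restrict x ?P)))
      \<longlongrightarrow> (\<integral>u. \<phi> u \<partial>\<gamma> J (restrict z ?P))) (finite_subsets_at_top ?P)"
    unfolding quasilocal_iff_tendsto using restrict_past x z by blast
  have "filterlim (\<lambda>L. L \<inter> ?P) (finite_subsets_at_top ?P) (finite_subsets_at_top I)"
    unfolding filterlim_finite_subsets_at_top eventually_finite_subsets_at_top
  proof (intro allI impI)
    fix X assume "finite X \<and> X \<subseteq> ?P"
    then show "\<exists>Xa. finite Xa \<and> Xa \<subseteq> I \<and> (\<forall>Y. finite Y \<and> Xa \<subseteq> Y \<and> Y \<subseteq> I \<longrightarrow>
        finite (Y \<inter> ?P) \<and> X \<subseteq> Y \<inter> ?P \<and> Y \<inter> ?P \<subseteq> ?P)"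
      using past_subset[of J] by (intro exI[of _ X]) auto
  qed
  from filterlim_compose[OF lim this]
  have lim': "((\<lambda>L. \<integral>u. \<phi> u \<partial>\<gamma> J (merge (L \<inter> ?P) (?P - (L \<inter> ?P)) (restrict z ?P, restrict x ?P)))
      \<longlongrightarrow> (\<integral>u. \<phi> u \<partial>\<gamma> J (restrict z ?P))) (finite_subsets_at_top I)" .
  have ev: "\<forall>\<^sub>F L in finite_subsets_at_top I. finite L \<and> K \<subseteq> L \<and> L \<subseteq> I"
    using K past_subset[of J] by (auto simp: eventually_finite_subsets_at_top)
  have "\<forall>\<^sub>F L in finite_subsets_at_top I.
     (\<integral>u. \<phi> u \<partial>\<gamma> J (merge (L \<inter> ?P) (?P - (L \<inter> ?P)) (restrict z ?P, restrict x ?P)))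
      = update \<gamma> J f (merge L (I - L) (z, x))"
    using ev
  proof eventually_elim
    case (elim L)
    let ?m = "merge L (I - L) (z, x)"
    have m: "?m \<in> \<Omega>" using elim x z by (intro merge_Omega) auto
    have r: "restrict ?m ?P = merge (L \<inter> ?P) (?P - (L \<inter> ?P)) (restrict z ?P, restrict x ?P)"
      using past_subset[of J] by (auto simp: merge_def fun_eq_iff)
    show ?case
      unfolding update_def r[symmetric]
    proof (intro Bochner_Integration.integral_cong refl)
      fix u assume "u \<in> space (\<gamma> J (restrict ?m ?P))"
      then have u: "u \<in> space (PiM J S)" using prob_algebraD[OF kernels(1)[OF J] restrict_past[OF m]] by simp
      show "\<phi> u = f (merge J (I - J) (u, ?m))"
        unfolding \<phi>_def using elim K(3) past_subset[of J]
        by (intro depends_onD[OF K(1)] merge_block_Omega[OF J u] m z) (auto simp: merge_def)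
    qed
  qed
  from Lim_transform_eventually[OF lim' this]
  show "((\<lambda>L. update \<gamma> J f (merge L (I - L) (z, x))) \<longlongrightarrow> update \<gamma> J f z) (finite_subsets_at_top I)"
    by (simp add: update_def \<phi>_def)
qed

text \<open>
  Both integrals are taken over the coupling q. Inside the block the two configurations then differ by the
  coupled pair, outside of it as x and z do. This serves for the couplings Q (x and z differ at one site)
  and for the couplings of \<open>\<gamma>\<close> with \<open>\<gamma>'\<close> (x and z equal).
\<close>
lemma coupling_bound:
  assumes J: "J \<in> \<J>" and f: "bounded_measurable (PiM I S) f" and K: "depends_on I S K f" "finite K" "K \<subseteq> I"
    and q: "is_coupling (PiM J S) q \<mu> \<nu>" and x: "x \<in> \<Omega>" and z: "z \<in> \<Omega>"
  shows "ennreal \<bar>(\<integral>u. f (merge J (I - J) (u, x)) \<partial>\<mu>) - (\<integral>u. f (merge J (I - J) (u, z)) \<partial>\<nu>)\<bar>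
     \<le> (\<Sum>i\<in>K \<inter> J. \<delta> i f * metric_integral \<eta> i q) + (\<Sum>i\<in>K - J. \<delta> i f * ennreal (\<eta> i (x i) (z i)))"
proof -
  let ?N = "PiM J S \<Otimes>\<^sub>M PiM J S"
  have q': "prob_space q" "sets q = sets ?N" "distr q (PiM J S) fst = \<mu>" "distr q (PiM J S) snd = \<nu>"
    using q by (auto simp: is_coupling_def prob_measure_on_def)
  interpret q: prob_space q by (rule q')
  have spq: "space q = space ?N" using q'(2) by (rule sets_eq_imp_space_eq)
  note [measurable_cong] = q'(2)
  obtain B where B: "0 \<le> B" "\<forall>x\<in>\<Omega>. \<bar>f x\<bar> \<le> B" using bounded_measurableD[OF f] by blast
  let ?f = "\<lambda>x u. f (merge J (I - J) (u, x))"
  have fm [measurable]: "?f x \<in> borel_measurable (PiM J S)" if "x \<in> \<Omega>" for x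
    by (rule measurable_compose[OF measurable_merge_block[OF J that]]) (rule bounded_measurableD[OF f])
  have int: "integrable q (\<lambda>p. ?f x (fst p))" "integrable q (\<lambda>p. ?f z (snd p))"
    using B merge_block_Omega[OF J] x z fm[OF x] fm[OF z]
    by (auto intro!: q.integrable_const_bound[of _ B] simp: spq space_pair_measure)
  have "(\<integral>u. ?f x u \<partial>\<mu>) = (\<integral>p. ?f x (fst p) \<partial>q)" "(\<integral>u. ?f z u \<partial>\<nu>) = (\<integral>p. ?f z (snd p) \<partial>q)"
    unfolding q'(3,4)[symmetric] using fm[OF x] fm[OF z] by (auto simp: integral_distr)
  then have "ennreal \<bar>(\<integral>u. ?f x u \<partial>\<mu>) - (\<integral>u. ?f z u \<partial>\<nu>)\<bar> \<le> (\<integral>\<^sup>+p. ennreal \<bar>?f x (fst p) - ?f z (snd p)\<bar> \<partial>q)"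
    using ennreal_abs_integral_diff_le[OF int] by simp
  also have "\<dots> \<le> (\<integral>\<^sup>+p. (\<Sum>i\<in>K \<inter> J. \<delta> i f * ennreal (\<eta> i (fst p i) (snd p i))) +
       (\<Sum>i\<in>K - J. \<delta> i f * ennreal (\<eta> i (x i) (z i))) \<partial>q)"
  proof (intro nn_integral_mono)
    fix p assume "p \<in> space q"
    then have p: "fst p \<in> space (PiM J S)" "snd p \<in> space (PiM J S)" by (auto simp: spq space_pair_measure)
    let ?x = "merge J (I - J) (fst p, x)" and ?z = "merge J (I - J) (snd p, z)"
    have xz: "?x \<in> \<Omega>" "?z \<in> \<Omega>" using p x z merge_block_Omega[OF J] by auto
    \<comment> \<open>f sees only K, so ?x may be changed into ?z off K; then the finite path bound applies.\<close>
    define y where "y = merge K (I - K) (?x, ?z)"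
    have y: "y \<in> \<Omega>" unfolding y_def by (rule merge_Omega[OF K(3) xz])
    have "f ?x = f y" using xz y by (intro depends_onD[OF K(1)]) (auto simp: y_def merge_def)
    then have "ennreal \<bar>f ?x - f ?z\<bar> = ennreal \<bar>f y - f ?z\<bar>" by simp
    also have "\<dots> \<le> (\<Sum>i\<in>K. \<delta> i f * ennreal (\<eta> i (y i) (?z i)))"
      using K xz y by (intro osc_finite_path) (auto simp: y_def merge_def)
    also have "\<dots> = (\<Sum>i\<in>K. \<delta> i f * ennreal (\<eta> i (?x i) (?z i)))"
      by (intro sum.cong) (auto simp: y_def merge_def)
    also have "\<dots> = (\<Sum>i\<in>K \<inter> J. \<delta> i f * ennreal (\<eta> i (?x i) (?z i))) + (\<Sum>i\<in>K - J. \<delta> i f * ennreal (\<eta> i (?x i) (?z i)))"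
      using K(2) by (rule sum.Int_Diff)
    also have "\<dots> = (\<Sum>i\<in>K \<inter> J. \<delta> i f * ennreal (\<eta> i (fst p i) (snd p i))) + (\<Sum>i\<in>K - J. \<delta> i f * ennreal (\<eta> i (x i) (z i)))"
      using K(3) by (intro arg_cong2[where f = "(+)"] sum.cong) (auto simp: merge_def)
    finally show "ennreal \<bar>?f x (fst p) - ?f z (snd p)\<bar> \<le> \<dots>" .
  qed
  also have "\<dots> = (\<Sum>i\<in>K \<inter> J. \<delta> i f * metric_integral \<eta> i q) + (\<Sum>i\<in>K - J. \<delta> i f * ennreal (\<eta> i (x i) (z i)))"
  proof -
    have [measurable]: "(\<lambda>p. ennreal (\<eta> i (fst p i) (snd p i))) \<in> borel_measurable q" if "i \<in> K \<inter> J" for i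
      using that K by (auto intro!: measurable_compose[OF _ measurable_ennreal] measurable_eta_comp)
    show ?thesis
      by (subst nn_integral_add) (auto simp: nn_integral_sum nn_integral_cmult metric_integral_def case_prod_beta' q.emeasure_space_1)
  qed
  finally show ?thesis .
qed

text \<open>
  The integrals of the metrics are measurable in x, so the sum can be taken out of the integral; an
  ordinary integral is dominated by the outer one.
\<close>
lemma update_discrepancy:
  assumes J: "J \<in> \<J>" and f: "bounded_measurable (PiM I S) f" and K: "depends_on I S K f" "finite K" "K \<subseteq> I"
  shows "ennreal \<bar>(\<integral>x. update \<gamma> J f x \<partial>\<rho>') - (\<integral>x. update \<gamma>' J f x \<partial>\<rho>')\<bar>
    \<le> (\<Sum>i\<in>K \<inter> J. \<delta> i f * outer_integral \<rho>' (\<lambda>x. metric_integral \<eta> i (Qh J (restrict x (past I \<tau> J)))))"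
proof -
  let ?h = "\<lambda>i x. metric_integral \<eta> i (Qh J (restrict x (past I \<tau> J)))"
  have hm: "?h i \<in> borel_measurable \<rho>'" if "i \<in> K \<inter> J" for i
  proof -
    have "(\<lambda>p. ennreal (\<eta> i (fst p i) (snd p i))) \<in> borel_measurable (PiM J S \<Otimes>\<^sub>M PiM J S)"
      using that K by (auto intro!: measurable_compose[OF _ measurable_ennreal] measurable_eta_comp)
    from measurable_compose[OF measurable_compose[OF measurable_restrict_past measurable_prob_algebraD[OF kernels(3)[OF J]]]
        nn_integral_measurable_subprob_algebra[OF this]]
    have "(\<lambda>x. \<integral>\<^sup>+p. ennreal (\<eta> i (fst p i) (snd p i)) \<partial>Qh J (restrict x (past I \<tau> J))) \<in> borel_measurable (PiM I S)" .
    then show ?thesis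
      by (simp add: metric_integral_def case_prod_beta' measurable_cong_sets[OF sets_rho' refl])
  qed
  have "ennreal \<bar>(\<integral>x. update \<gamma> J f x \<partial>\<rho>') - (\<integral>x. update \<gamma>' J f x \<partial>\<rho>')\<bar>
      \<le> (\<integral>\<^sup>+x. ennreal \<bar>update \<gamma> J f x - update \<gamma>' J f x\<bar> \<partial>\<rho>')"
    using update_bounded_measurable[where \<kappa> = \<gamma>, OF J kernels(1)[OF J] f] update_bounded_measurable[where \<kappa> = \<gamma>', OF J kernels(2)[OF J] f]
    by (intro ennreal_abs_integral_diff_le bounded_measurable_integrable)
  also have "\<dots> \<le> (\<integral>\<^sup>+x. (\<Sum>i\<in>K \<inter> J. \<delta> i f * ?h i x) \<partial>\<rho>')"
  proof (intro nn_integral_mono)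
    fix x assume "x \<in> space \<rho>'"
    then have x: "x \<in> \<Omega>" by simp
    have zero: "\<eta> i (x i) (x i) = 0" if "i \<in> K" for i
      using that K x Metric_space.mdist_zero[OF metric] by (auto simp: Omega_component)
    show "ennreal \<bar>update \<gamma> J f x - update \<gamma>' J f x\<bar> \<le> (\<Sum>i\<in>K \<inter> J. \<delta> i f * ?h i x)"
      using coupling_bound[OF J f K kernels(4)[OF J restrict_past[OF x]] x x]
      by (simp add: update_def zero)
  qed
  also have "\<dots> = (\<Sum>i\<in>K \<inter> J. \<delta> i f * (\<integral>\<^sup>+x. ?h i x \<partial>\<rho>'))"
    by (subst nn_integral_sum) (auto intro!: sum.cong nn_integral_cmult borel_measurable_times_ennreal hm)
  also have "\<dots> \<le> (\<Sum>i\<in>K \<inter> J. \<delta> i f * outer_integral \<rho>' (?h i))"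
    unfolding outer_integral_def
    by (intro sum_mono mult_left_mono Inf_greatest) (auto intro!: nn_integral_mono)
  finally show ?thesis .
qed

lemma update_osc_pair:
  assumes J: "J \<in> \<J>" and f: "bounded_measurable (PiM I S) f" and K: "depends_on I S K f" "finite K" "K \<subseteq> past I \<tau> J"
    and j: "j \<in> I" and x: "x \<in> \<Omega>" and z: "z \<in> \<Omega>" and xz: "\<And>k. k \<in> I - {j} \<Longrightarrow> x k = z k" "x j \<noteq> z j"
  shows "\<tau> j > level \<tau> J \<Longrightarrow> update \<gamma> J f x = update \<gamma> J f z"
    and "\<tau> j \<le> level \<tau> J \<Longrightarrow> ennreal \<bar>update \<gamma> J f x - update \<gamma> J f z\<bar> \<le>
      (\<Sum>i\<in>K \<inter> J. \<delta> i f * metric_integral \<eta> i (Q J (restrict x (past I \<tau> J), restrict z (past I \<tau> J))))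
      + (if j \<in> J then 0 else \<delta> j f * ennreal (\<eta> j (x j) (z j)))"
proof -
  let ?P = "past I \<tau> J"
  have KI: "K \<subseteq> I" using K past_subset by blast
  {
    assume "\<tau> j > level \<tau> J"
    then have jP: "j \<notin> ?P" by (simp add: past_iff)
    then have "restrict x ?P = restrict z ?P" using xz past_subset[of J] by (intro restrict_ext) auto
    moreover have "f (merge J (I - J) (u, x)) = f (merge J (I - J) (u, z))" if "u \<in> space (PiM J S)" for u
      using that K KI jP xz
      by (intro depends_onD[OF K(1)] merge_block_Omega[OF J _ x] merge_block_Omega[OF J _ z]) (auto simp: merge_def)
    ultimately show "update \<gamma> J f x = update \<gamma> J f z"
      unfolding update_def using prob_algebraD[OF kernels(1)[OF J] restrict_past[OF z]]
      by (auto intro!: Bochner_Integration.integral_cong)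
  next
    assume "\<tau> j \<le> level \<tau> J"
    then have jP: "j \<in> ?P" using j by (simp add: past_iff)
    have "{i \<in> ?P. restrict x ?P i \<noteq> restrict z ?P i} = {j}"
      using jP xz past_subset[of J] by auto
    then have "(restrict x ?P, restrict z ?P) \<in> single_site_pairs ?P S"
      using restrict_past x z by (simp add: single_site_pairs_def)
    from coupling_bound[OF J f K(1,2) KI kernels(5)[OF J this] x z]
    have A: "ennreal \<bar>update \<gamma> J f x - update \<gamma> J f z\<bar> \<le>
      (\<Sum>i\<in>K \<inter> J. \<delta> i f * metric_integral \<eta> i (Q J (restrict x ?P, restrict z ?P))) +
      (\<Sum>i\<in>K - J. \<delta> i f * ennreal (\<eta> i (x i) (z i)))"
      by (simp add: update_def)
    have B: "(\<Sum>i\<in>K - J. \<delta> i f * ennreal (\<eta> i (x i) (z i))) \<le> (if j \<in> J then 0 else \<delta> j f * ennreal (\<eta> j (x j) (z j)))"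
    proof -
      have zero: "\<eta> i (x i) (z i) = 0" if "i \<in> K" "i \<noteq> j" for i
      proof -
        have "i \<in> I" using that KI by blast
        then show ?thesis
          using xz(1)[of i] that Metric_space.mdist_zero[OF metric] Omega_component[OF z] by auto
      qed
      have "(\<Sum>i\<in>K - J. \<delta> i f * ennreal (\<eta> i (x i) (z i))) = (\<Sum>i\<in>(K - J) \<inter> {j}. \<delta> i f * ennreal (\<eta> i (x i) (z i)))"
      proof (intro sum.mono_neutral_right ballI)
        fix i assume "i \<in> (K - J) - (K - J) \<inter> {j}"
        then show "\<delta> i f * ennreal (\<eta> i (x i) (z i)) = 0" using zero[of i] by auto
      qed (use K(2) in auto)
      also have "\<dots> \<le> (if j \<in> J then 0 else \<delta> j f * ennreal (\<eta> j (x j) (z j)))"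
        by (cases "j \<in> K - J") auto
      finally show ?thesis .
    qed
    show "ennreal \<bar>update \<gamma> J f x - update \<gamma> J f z\<bar> \<le>
      (\<Sum>i\<in>K \<inter> J. \<delta> i f * metric_integral \<eta> i (Q J (restrict x ?P, restrict z ?P)))
      + (if j \<in> J then 0 else \<delta> j f * ennreal (\<eta> j (x j) (z j)))"
      using A add_left_mono[OF B] by (rule order_trans)
  }
qed

end

section \<open>Lazy updates of one level\<close>

context one_sided_coupled_updates
begin

text \<open>A finite family F keeps all sums finite and the function measurable and quasilocal without limits.\<close>
definition lazy_update :: "real \<Rightarrow> 'i set set \<Rightarrow> (('i \<Rightarrow> 'a) \<Rightarrow> real) \<Rightarrow> ('i \<Rightarrow> 'a) \<Rightarrow> real" where
  "lazy_update \<theta> F f x = (1 - \<theta> * (\<Sum>J\<in>F. w J)) * f x + \<theta> * (\<Sum>J\<in>F. w J * update \<gamma> J f x)"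

definition level_blocks :: "int \<Rightarrow> 'i set set" where
  "level_blocks k = {J\<in>\<J>. level \<tau> J = k}"

lemma past_level: "J \<in> level_blocks k \<Longrightarrow> past I \<tau> J = sites_upto I \<tau> k"
  by (auto simp: level_blocks_def past_def)

text \<open>
  A block of level k meets K only in sites of level k, so the blocks of F contribute only to these sites.
\<close>
lemma block_sum_swap:
  fixes d :: "'i \<Rightarrow> ennreal" and q :: "'i set \<Rightarrow> 'i \<Rightarrow> ennreal"
  assumes F: "finite F" "F \<subseteq> level_blocks k" and K: "finite K"
  shows "(\<Sum>J\<in>F. c J * (\<Sum>i\<in>K \<inter> J. d i * q J i)) =
         (\<Sum>i\<in>{i\<in>K. \<tau> i = k}. d i * (\<Sum>J\<in>{J\<in>F. i \<in> J}. c J * q J i))"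
proof -
  let ?K = "{i\<in>K. \<tau> i = k}"
  have "(\<Sum>J\<in>F. c J * (\<Sum>i\<in>K \<inter> J. d i * q J i)) = (\<Sum>J\<in>F. \<Sum>i\<in>?K. if i \<in> J then d i * (c J * q J i) else 0)"
  proof (rule sum.cong[OF refl])
    fix J assume J: "J \<in> F"
    have "K \<inter> J = {i\<in>?K. i \<in> J}"
      using J F block(4) by (auto simp: level_blocks_def)
    then show "c J * (\<Sum>i\<in>K \<inter> J. d i * q J i) = (\<Sum>i\<in>?K. if i \<in> J then d i * (c J * q J i) else 0)"
      using K by (simp add: sum.inter_filter sum_distrib_left mult.left_commute flip: sum.inter_filter)
  qed
  also have "\<dots> = (\<Sum>i\<in>?K. \<Sum>J\<in>F. if i \<in> J then d i * (c J * q J i) else 0)"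
    by (rule sum.swap)
  also have "\<dots> = (\<Sum>i\<in>?K. d i * (\<Sum>J\<in>{J\<in>F. i \<in> J}. c J * q J i))"
    using F by (simp add: sum_distrib_left flip: sum.inter_filter)
  finally show ?thesis .
qed

lemma bounded_measurable_cmult: "bounded_measurable (PiM I S) f \<Longrightarrow> bounded_measurable (PiM I S) (\<lambda>x. c * f x)"
proof -
  assume f: "bounded_measurable (PiM I S) f"
  obtain B where B: "\<forall>x\<in>\<Omega>. \<bar>f x\<bar> \<le> B" using bounded_measurableD[OF f] by blast
  show ?thesis
    using B bounded_measurableD(1)[OF f]
    by (intro bounded_measurableI[of _ _ "\<bar>c\<bar> * B"]) (auto simp: abs_mult intro: mult_left_mono)
qed

lemma bounded_measurable_add:
  assumes "bounded_measurable (PiM I S) f" "bounded_measurable (PiM I S) g"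
  shows "bounded_measurable (PiM I S) (\<lambda>x. f x + g x)"
proof -
  obtain B C where "\<forall>x\<in>\<Omega>. \<bar>f x\<bar> \<le> B" "\<forall>x\<in>\<Omega>. \<bar>g x\<bar> \<le> C"
    using bounded_measurableD[OF assms(1)] bounded_measurableD[OF assms(2)] by blast
  then show ?thesis
    using bounded_measurableD(1)[OF assms(1)] bounded_measurableD(1)[OF assms(2)]
    by (intro bounded_measurableI[of _ _ "B + C"]) (auto intro: order_trans[OF abs_triangle_ineq] add_mono)
qed

lemma bounded_measurable_sum:
  "finite F \<Longrightarrow> (\<And>J. J \<in> F \<Longrightarrow> bounded_measurable (PiM I S) (g J)) \<Longrightarrow> bounded_measurable (PiM I S) (\<lambda>x. \<Sum>J\<in>F. g J x)"
  by (induction F rule: finite_induct) (auto intro: bounded_measurable_add bounded_measurableI[of _ _ 0])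

context
  fixes k :: int and K :: "'i set" and F :: "'i set set" and \<theta> :: real and f :: "('i \<Rightarrow> 'a) \<Rightarrow> real"
  assumes F: "finite F" "F \<subseteq> level_blocks k"
    and K: "finite K" "K \<subseteq> sites_upto I \<tau> k"
    and \<theta>: "0 \<le> \<theta>" "\<theta> * (\<Sum>J\<in>F. w J) \<le> 1"
    and f: "bounded_measurable (PiM I S) f" "depends_on I S K f"
begin

lemma sites_in_I: "K \<subseteq> I" using K by (auto simp: sites_upto_def)

lemma blocks_in_J: "J \<in> F \<Longrightarrow> J \<in> \<J>" and sites_in_past: "J \<in> F \<Longrightarrow> K \<subseteq> past I \<tau> J" and blocks_level: "J \<in> F \<Longrightarrow> level \<tau> J = k"
  using F K past_level[of J k] by (auto simp: level_blocks_def)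

lemma w_nonneg: "J \<in> F \<Longrightarrow> 0 \<le> w J"
  using blocks_in_J w_pos by (auto intro: less_imp_le)

lemma lazy_update_bounded_measurable: "bounded_measurable (PiM I S) (lazy_update \<theta> F f)"
  unfolding lazy_update_def[abs_def]
  by (intro bounded_measurable_add bounded_measurable_cmult bounded_measurable_sum F f
      update_bounded_measurable[where \<kappa> = \<gamma>] kernels(1) blocks_in_J)

lemma lazy_update_quasilocal: "quasilocal I S (lazy_update \<theta> F f)"
proof -
  have "quasilocal I S f" by (rule depends_on_quasilocal[OF f(2) K(1) sites_in_I])
  moreover have "quasilocal I S (update \<gamma> J f)" if "J \<in> F" for J
    using that blocks_in_J sites_in_past by (intro update_quasilocal[OF _ f K(1)])
  ultimately show ?thesis
    unfolding quasilocal_iff_tendsto lazy_update_def by (auto intro!: tendsto_intros)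
qed

lemma osc_lazy_update_beyond:
  assumes j: "j \<in> I" "\<tau> j > k"
  shows "\<delta> j (lazy_update \<theta> F f) = 0"
proof -
  have "\<delta> j (lazy_update \<theta> F f) \<le> 0"
  proof (rule osc_leI[OF j(1)])
    fix x z assume xz: "x \<in> \<Omega>" "z \<in> \<Omega>" "\<And>k. k \<in> I - {j} \<Longrightarrow> x k = z k" "x j \<noteq> z j"
    have "update \<gamma> J f x = update \<gamma> J f z" if "J \<in> F" for J
      using that j sites_in_past blocks_level by (intro update_osc_pair(1)[OF blocks_in_J f K(1) _ j(1) xz]) auto
    moreover have "f x = f z"
    proof (rule depends_onD[OF f(2) xz(1,2)])
      fix i assume "i \<in> K"
      then have "i \<in> I - {j}" using K j by (auto simp: sites_upto_def)
      then show "x i = z i" by (rule xz(3))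
    qed
    ultimately show "ennreal \<bar>lazy_update \<theta> F f x - lazy_update \<theta> F f z\<bar> \<le> 0 * ennreal (\<eta> j (x j) (z j))"
      by (simp add: lazy_update_def)
  qed
  then show ?thesis by simp
qed

text \<open>
  A block that contains j erases the dependence on \<open>x j\<close>, which gives the factor in front of \<open>\<delta>\<^sub>j f\<close>; what an
  update at i feels of \<open>x j\<close> is collected by R. Summing over the blocks before taking the supremum over pairs is
  essential, since R is a supremum of sums.
\<close>
lemma osc_lazy_update:
  assumes j: "j \<in> I" "\<tau> j \<le> k"
  shows "\<delta> j (lazy_update \<theta> F f) \<le> ennreal (1 - \<theta> * (\<Sum>J\<in>{J\<in>F. j \<in> J}. w J)) * \<delta> j f
    + ennreal \<theta> * (\<Sum>i\<in>{i\<in>K. \<tau> i = k}. \<delta> i f * R i j)"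
proof (rule osc_leI[OF j(1)])
  fix x z assume xz: "x \<in> \<Omega>" "z \<in> \<Omega>" "\<And>k. k \<in> I - {j} \<Longrightarrow> x k = z k" "x j \<noteq> z j"
  let ?\<eta> = "ennreal (\<eta> j (x j) (z j))"
  define q where "q = (\<lambda>J i. metric_integral \<eta> i (Q J (restrict x (past I \<tau> J), restrict z (past I \<tau> J))))"
  have eta_pos: "\<eta> j (x j) (z j) > 0"
    using xz(4) Metric_space.mdist_pos_eq[OF metric[OF j(1)]] Omega_component[OF xz(1) j(1)] Omega_component[OF xz(2) j(1)]
    by blast
  have upd: "ennreal \<bar>update \<gamma> J f x - update \<gamma> J f z\<bar> \<le>
      (\<Sum>i\<in>K \<inter> J. \<delta> i f * q J i) + (if j \<in> J then 0 else \<delta> j f * ?\<eta>)" if "J \<in> F" for J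
    unfolding q_def using that j sites_in_past blocks_level by (intro update_osc_pair(2)[OF blocks_in_J f K(1) _ j(1) xz]) auto
  have Rq: "(\<Sum>J\<in>{J\<in>F. i \<in> J}. ennreal (w J) * q J i) \<le> R i j * ?\<eta>" if i: "\<tau> i = k" for i
  proof -
    let ?s = "\<Sum>\<^sub>\<infinity>J\<in>{J\<in>\<J>. i \<in> J}. ennreal (w J) * q J i"
    have "(x, z) \<in> differ_only_at I S j" using xz by (auto simp: differ_only_at_def)
    then have "1 / ?\<eta> * ?s \<le> R i j"
      using i j by (auto simp: R_mat_def q_def intro!: SUP_upper2[of "(x, z)"])
    then have "(1 / ?\<eta> * ?s) * ?\<eta> \<le> R i j * ?\<eta>" by (rule mult_right_mono) simp
    moreover have "(1 / ?\<eta> * ?s) * ?\<eta> = ?s"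
    proof -
      have "(1 / ?\<eta> * ?s) * ?\<eta> = ?s * ?\<eta> / ?\<eta>" by (simp add: divide_ennreal_def mult_ac)
      also have "\<dots> = ?s" using eta_pos by (intro ennreal_mult_divide_eq) auto
      finally show ?thesis .
    qed
    moreover have "(\<Sum>J\<in>{J\<in>F. i \<in> J}. ennreal (w J) * q J i) \<le> ?s"
      using F blocks_in_J by (intro finite_sum_le_infsum_ennreal) auto
    ultimately show ?thesis by simp
  qed
  have "\<bar>lazy_update \<theta> F f x - lazy_update \<theta> F f z\<bar> \<le>
      (1 - \<theta> * (\<Sum>J\<in>F. w J)) * \<bar>f x - f z\<bar> + \<theta> * (\<Sum>J\<in>F. w J * \<bar>update \<gamma> J f x - update \<gamma> J f z\<bar>)"
  proof -
    have "lazy_update \<theta> F f x - lazy_update \<theta> F f z =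
      (1 - \<theta> * (\<Sum>J\<in>F. w J)) * (f x - f z) + \<theta> * (\<Sum>J\<in>F. w J * (update \<gamma> J f x - update \<gamma> J f z))"
      by (simp add: lazy_update_def algebra_simps sum_subtractf)
    also have "\<bar>\<dots>\<bar> \<le> \<bar>(1 - \<theta> * (\<Sum>J\<in>F. w J)) * (f x - f z)\<bar> + \<bar>\<theta> * (\<Sum>J\<in>F. w J * (update \<gamma> J f x - update \<gamma> J f z))\<bar>"
      by (rule abs_triangle_ineq)
    also have "\<dots> \<le> (1 - \<theta> * (\<Sum>J\<in>F. w J)) * \<bar>f x - f z\<bar> + \<theta> * (\<Sum>J\<in>F. w J * \<bar>update \<gamma> J f x - update \<gamma> J f z\<bar>)"
      using \<theta> w_nonneg
      by (intro add_mono) (auto simp: abs_mult intro!: mult_left_mono order_trans[OF sum_abs] sum_mono)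
    finally show ?thesis .
  qed
  then have "ennreal \<bar>lazy_update \<theta> F f x - lazy_update \<theta> F f z\<bar> \<le>
      ennreal ((1 - \<theta> * (\<Sum>J\<in>F. w J)) * \<bar>f x - f z\<bar> + \<theta> * (\<Sum>J\<in>F. w J * \<bar>update \<gamma> J f x - update \<gamma> J f z\<bar>))"
    by (rule ennreal_leI)
  also have "\<dots> = ennreal (1 - \<theta> * (\<Sum>J\<in>F. w J)) * ennreal \<bar>f x - f z\<bar> +
      ennreal \<theta> * (\<Sum>J\<in>F. ennreal (w J) * ennreal \<bar>update \<gamma> J f x - update \<gamma> J f z\<bar>)"
    using \<theta> w_nonneg by (simp add: ennreal_plus ennreal_mult sum_nonneg flip: sum_ennreal)
  also have "\<dots> \<le> ennreal (1 - \<theta> * (\<Sum>J\<in>F. w J)) * (\<delta> j f * ?\<eta>) +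
      ennreal \<theta> * (\<Sum>J\<in>F. ennreal (w J) * ((\<Sum>i\<in>K \<inter> J. \<delta> i f * q J i) + (if j \<in> J then 0 else \<delta> j f * ?\<eta>)))"
    using xz j upd by (intro add_mono mult_left_mono sum_mono osc_bound) auto
  also have "\<dots> = (ennreal (1 - \<theta> * (\<Sum>J\<in>F. w J)) + ennreal \<theta> * (\<Sum>J\<in>{J\<in>F. j \<notin> J}. ennreal (w J))) * (\<delta> j f * ?\<eta>)
      + ennreal \<theta> * (\<Sum>J\<in>F. ennreal (w J) * (\<Sum>i\<in>K \<inter> J. \<delta> i f * q J i))"
  proof -
    have "(\<Sum>J\<in>F. ennreal (w J) * (if j \<in> J then 0 else \<delta> j f * ?\<eta>)) = (\<Sum>J\<in>{J\<in>F. j \<notin> J}. ennreal (w J)) * (\<delta> j f * ?\<eta>)"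
      using F(1) by (auto simp: sum_distrib_right sum.inter_filter intro!: sum.cong)
    then show ?thesis
      by (simp add: distrib_left distrib_right sum.distrib mult.assoc add_ac)
  qed
  also have "ennreal (1 - \<theta> * (\<Sum>J\<in>F. w J)) + ennreal \<theta> * (\<Sum>J\<in>{J\<in>F. j \<notin> J}. ennreal (w J)) =
      ennreal (1 - \<theta> * (\<Sum>J\<in>{J\<in>F. j \<in> J}. w J))"
  proof -
    have "(\<Sum>J\<in>F. w J) = (\<Sum>J\<in>{J\<in>F. j \<in> J}. w J) + (\<Sum>J\<in>{J\<in>F. j \<notin> J}. w J)"
      using F(1) by (subst sum.union_disjoint[symmetric]) (auto intro!: sum.cong)
    then have "1 - \<theta> * (\<Sum>J\<in>{J\<in>F. j \<in> J}. w J) = (1 - \<theta> * (\<Sum>J\<in>F. w J)) + \<theta> * (\<Sum>J\<in>{J\<in>F. j \<notin> J}. w J)"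
      by (simp add: algebra_simps)
    then have "ennreal (1 - \<theta> * (\<Sum>J\<in>{J\<in>F. j \<in> J}. w J)) =
        ennreal (1 - \<theta> * (\<Sum>J\<in>F. w J)) + ennreal (\<theta> * (\<Sum>J\<in>{J\<in>F. j \<notin> J}. w J))"
      using \<theta> w_nonneg by (simp only:) (intro ennreal_plus mult_nonneg_nonneg sum_nonneg; simp)
    moreover have "0 \<le> (\<Sum>J\<in>{J\<in>F. j \<notin> J}. w J)"
      using w_nonneg by (intro sum_nonneg) auto
    moreover have "(\<Sum>J\<in>{J\<in>F. j \<notin> J}. ennreal (w J)) = ennreal (\<Sum>J\<in>{J\<in>F. j \<notin> J}. w J)"
      using w_nonneg by (intro sum_ennreal) auto
    ultimately show ?thesis
      using \<theta> by (simp add: ennreal_mult)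
  qed
  also have "(\<Sum>J\<in>F. ennreal (w J) * (\<Sum>i\<in>K \<inter> J. \<delta> i f * q J i)) =
      (\<Sum>i\<in>{i\<in>K. \<tau> i = k}. \<delta> i f * (\<Sum>J\<in>{J\<in>F. i \<in> J}. ennreal (w J) * q J i))"
    by (rule block_sum_swap[OF F K(1)])
  also have "\<dots> \<le> (\<Sum>i\<in>{i\<in>K. \<tau> i = k}. \<delta> i f * (R i j * ?\<eta>))"
    using Rq by (intro sum_mono mult_left_mono) auto
  also have "ennreal (1 - \<theta> * (\<Sum>J\<in>{J\<in>F. j \<in> J}. w J)) * (\<delta> j f * ?\<eta>) +
      ennreal \<theta> * (\<Sum>i\<in>{i\<in>K. \<tau> i = k}. \<delta> i f * (R i j * ?\<eta>)) =
    (ennreal (1 - \<theta> * (\<Sum>J\<in>{J\<in>F. j \<in> J}. w J)) * \<delta> j f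
      + ennreal \<theta> * (\<Sum>i\<in>{i\<in>K. \<tau> i = k}. \<delta> i f * R i j)) * ?\<eta>"
    by (simp add: distrib_right mult.assoc sum_distrib_right)
  finally show "ennreal \<bar>lazy_update \<theta> F f x - lazy_update \<theta> F f z\<bar> \<le> \<dots>"
    by (blast intro: add_left_mono mult_left_mono zero_le)
qed

text \<open>
  \<open>\<rho>\<close> does not notice the update at all, and \<open>\<rho>'\<close> would not notice the one by \<open>\<gamma>'\<close>; the price is the
  difference between \<open>\<gamma>\<close> and \<open>\<gamma>'\<close> under \<open>\<rho>'\<close>.
\<close>
lemma gap_lazy_update:
  "gap f \<le> gap (lazy_update \<theta> F f) + ennreal \<theta> * (\<Sum>i\<in>{i\<in>K. \<tau> i = k}. \<delta> i f * a i)"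
proof -
  let ?P = "lazy_update \<theta> F f" and ?c = "1 - \<theta> * (\<Sum>J\<in>F. w J)"
  note int = bounded_measurable_integrable
  have ub: "bounded_measurable (PiM I S) (update \<gamma> J f)" "bounded_measurable (PiM I S) (update \<gamma>' J f)" if "J \<in> F" for J
    using update_bounded_measurable[where \<kappa> = \<gamma>, OF blocks_in_J[OF that] kernels(1)[OF blocks_in_J[OF that]] f(1)]
      update_bounded_measurable[where \<kappa> = \<gamma>', OF blocks_in_J[OF that] kernels(2)[OF blocks_in_J[OF that]] f(1)] by auto
  have inv: "(\<integral>x. update \<gamma> J f x \<partial>\<rho>) = (\<integral>x. f x \<partial>\<rho>)" "(\<integral>x. update \<gamma>' J f x \<partial>\<rho>') = (\<integral>x. f x \<partial>\<rho>')" if "J \<in> F" for J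
    using update_invariant[OF blocks_in_J[OF that] f sites_in_past[OF that]] by auto
  have 1: "(\<integral>x. ?P x \<partial>\<rho>) = (\<integral>x. f x \<partial>\<rho>)"
  proof -
    have "(\<integral>x. ?P x \<partial>\<rho>) = ?c * (\<integral>x. f x \<partial>\<rho>) + \<theta> * (\<Sum>J\<in>F. w J * (\<integral>x. update \<gamma> J f x \<partial>\<rho>))"
      unfolding lazy_update_def using int(1)[OF f(1)] int(1)[OF ub(1)] by simp
    also have "\<dots> = (\<integral>x. f x \<partial>\<rho>)"
      by (simp add: inv algebra_simps sum_distrib_left sum_distrib_right)
    finally show ?thesis .
  qed
  have 2: "(\<integral>x. ?P x \<partial>\<rho>') - (\<integral>x. f x \<partial>\<rho>') = 
      \<theta> * (\<Sum>J\<in>F. w J * ((\<integral>x. update \<gamma> J f x \<partial>\<rho>') - (\<integral>x. update \<gamma>' J f x \<partial>\<rho>')))"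
  proof -
    have "(\<integral>x. ?P x \<partial>\<rho>') = ?c * (\<integral>x. f x \<partial>\<rho>') + \<theta> * (\<Sum>J\<in>F. w J * (\<integral>x. update \<gamma> J f x \<partial>\<rho>'))"
      unfolding lazy_update_def using int(2)[OF f(1)] int(2)[OF ub(1)] by simp
    also have "\<dots> = (\<integral>x. f x \<partial>\<rho>') + \<theta> * (\<Sum>J\<in>F. w J * ((\<integral>x. update \<gamma> J f x \<partial>\<rho>') - (\<integral>x. f x \<partial>\<rho>')))"
      by (simp add: algebra_simps sum_subtractf sum_distrib_left sum_distrib_right)
    finally show ?thesis by (simp add: inv)
  qed
  have "gap f \<le> gap ?P + ennreal \<bar>(\<integral>x. ?P x \<partial>\<rho>') - (\<integral>x. f x \<partial>\<rho>')\<bar>"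
    unfolding gap_def 1[symmetric] by (subst ennreal_plus[symmetric]; (rule ennreal_leI)?) simp_all
  also have "ennreal \<bar>(\<integral>x. ?P x \<partial>\<rho>') - (\<integral>x. f x \<partial>\<rho>')\<bar> \<le>
     ennreal (\<theta> * (\<Sum>J\<in>F. w J * \<bar>(\<integral>x. update \<gamma> J f x \<partial>\<rho>') - (\<integral>x. update \<gamma>' J f x \<partial>\<rho>')\<bar>))"
    unfolding 2 using \<theta> w_nonneg
    by (intro ennreal_leI) (auto simp: abs_mult intro!: mult_left_mono order_trans[OF sum_abs] sum_mono)
  also have "\<dots> = ennreal \<theta> * (\<Sum>J\<in>F. ennreal (w J) * ennreal \<bar>(\<integral>x. update \<gamma> J f x \<partial>\<rho>') - (\<integral>x. update \<gamma>' J f x \<partial>\<rho>')\<bar>)"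
    using \<theta> w_nonneg by (simp add: ennreal_mult sum_nonneg flip: sum_ennreal)
  also have "\<dots> \<le> ennreal \<theta> * (\<Sum>J\<in>F. ennreal (w J) * (\<Sum>i\<in>K \<inter> J. \<delta> i f *
      outer_integral \<rho>' (\<lambda>x. metric_integral \<eta> i (Qh J (restrict x (past I \<tau> J))))))"
    using blocks_in_J by (intro mult_left_mono sum_mono update_discrepancy f K sites_in_I) auto
  also have "\<dots> = ennreal \<theta> * (\<Sum>i\<in>{i\<in>K. \<tau> i = k}. \<delta> i f * (\<Sum>J\<in>{J\<in>F. i \<in> J}. ennreal (w J) *
      outer_integral \<rho>' (\<lambda>x. metric_integral \<eta> i (Qh J (restrict x (past I \<tau> J))))))"
    by (subst block_sum_swap[OF F K(1)]) simp
  also have "\<dots> \<le> ennreal \<theta> * (\<Sum>i\<in>{i\<in>K. \<tau> i = k}. \<delta> i f * a i)"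
    using F blocks_in_J unfolding a_vec_def
    by (intro mult_left_mono sum_mono finite_sum_le_infsum_ennreal) auto
  finally show ?thesis by (blast intro: add_left_mono)
qed

end

end

section \<open>Influence bounds and their improvement\<close>

locale one_sided_comparison = one_sided_coupled_updates I S \<eta> \<rho> \<rho>' \<tau> \<J> \<gamma> \<gamma>' Q Qh w
  for I :: "'i set"
    and S :: "'i \<Rightarrow> 'a measure"
    and \<eta> :: "'i \<Rightarrow> 'a \<Rightarrow> 'a \<Rightarrow> real"
    and \<rho> \<rho>' :: "('i \<Rightarrow> 'a) measure"
    and \<tau> :: "'i \<Rightarrow> int"
    and \<J> :: "'i set set"
    and \<gamma> \<gamma>' :: "'i set \<Rightarrow> ('i \<Rightarrow> 'a) \<Rightarrow> ('i \<Rightarrow> 'a) measure"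
    and Q :: "'i set \<Rightarrow> ('i \<Rightarrow> 'a) \<times> ('i \<Rightarrow> 'a) \<Rightarrow> (('i \<Rightarrow> 'a) \<times> ('i \<Rightarrow> 'a)) measure"
    and Qh :: "'i set \<Rightarrow> ('i \<Rightarrow> 'a) \<Rightarrow> (('i \<Rightarrow> 'a) \<times> ('i \<Rightarrow> 'a)) measure"
    and w :: "'i set \<Rightarrow> real" +
  assumes W_le_1: "i \<in> I \<Longrightarrow> W_mat \<J> w i i \<le> 1"
    and D_mean_dist_finite: "i \<in> I \<Longrightarrow> mat_vec I (D_mat I (W_mat \<J> w) (R_mat I S \<eta> \<tau> \<J> w Q)) mean_dist i < \<top>"
    and power_tendsto_0: "i \<in> I \<Longrightarrow>
      (\<lambda>n. mat_vec I (mat_power I (\<lambda>k l. mat_id k l - W_mat \<J> w k l + R_mat I S \<eta> \<tau> \<J> w Q k l) n) mean_dist i) \<longlonglongrightarrow> 0"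
begin

abbreviation D where "D \<equiv> D_mat I W R"
abbreviation T where "T \<equiv> \<lambda>k l. mat_id k l - W k l + R k l"

text \<open>The diagonal of W as real numbers, for use in the factors \<open>1 - \<theta> W\<close>.\<close>
definition diag_weight :: "'i \<Rightarrow> real" where "diag_weight i = enn2real (W i i)"

lemma W_eq_diag_weight: "i \<in> I \<Longrightarrow> W i i = ennreal (diag_weight i)" and diag_weight_le_1: "i \<in> I \<Longrightarrow> diag_weight i \<le> 1"
  and diag_weight_nonneg: "0 \<le> diag_weight i" and W_nonzero: "i \<in> I \<Longrightarrow> W i i \<noteq> 0"
proof -
  show "0 \<le> diag_weight i" by (simp add: diag_weight_def)
  assume i: "i \<in> I"
  have fin: "W i i < \<top>" using W_le_1[OF i] by (rule order_le_less_trans) simp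
  then show "W i i = ennreal (diag_weight i)" by (simp add: diag_weight_def)
  then show "diag_weight i \<le> 1" using W_le_1[OF i] by simp
  obtain J where J: "J \<in> \<J>" "i \<in> J" using cover i by (auto simp: is_cover_def)
  have "ennreal (w J) \<le> W i i"
    using finite_sum_le_infsum_ennreal[of "{J}" "{J\<in>\<J>. i \<in> J}" "\<lambda>J. ennreal (w J)"] J
    by (simp add: W_mat_def)
  then show "W i i \<noteq> 0" using w_pos[OF J(1)] by auto
qed

lemma mat_vec_T:
  assumes i: "i \<in> I"
  shows "mat_vec I T u i = ennreal (1 - diag_weight i) * u i + mat_vec I R u i"
proof -
  have "mat_vec I T u i = mat_vec I (\<lambda>k l. mat_id k l - W k l) u i + mat_vec I R u i"
    by (simp add: mat_vec_def distrib_right infsum_add)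
  also have "mat_vec I (\<lambda>k l. mat_id k l - W k l) u i = (1 - W i i) * u i"
    using i by (subst mat_vec_diag) (auto simp: mat_id_def W_mat_def)
  also have "1 - W i i = ennreal (1 - diag_weight i)"
    unfolding W_eq_diag_weight[OF i] ennreal_1[symmetric] using diag_weight_nonneg[of i] by (rule ennreal_minus)
  finally show ?thesis .
qed

lemma W_mat_vec_D:
  assumes i: "i \<in> I"
  shows "W i i * mat_vec I D u i = W i i * u i + mat_vec I R (mat_vec I D u) i"
  using W_nonzero[OF i] W_eq_diag_weight[OF i] by (intro diag_mult_mat_vec_D countable_I i) auto

text \<open>
  The vector \<open>h = D m\<close> dominates m and satisfies \<open>T h = h - W m \<le> h\<close>, so it dominates all \<open>T\<^sup>n m\<close>.
\<close>
lemma power_T_bound: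
  "i \<in> I \<Longrightarrow> mat_vec I (mat_power I T n) mean_dist i \<le> mat_vec I D mean_dist i"
proof (induction n arbitrary: i)
  case 0
  then show ?case by (simp add: mat_vec_id le_mat_vec_D countable_I)
next
  case (Suc n)
  let ?h = "mat_vec I D mean_dist"
  have "mat_vec I (mat_power I T (Suc n)) mean_dist i = mat_vec I T (mat_vec I (mat_power I T n) mean_dist) i"
    by (simp add: mat_vec_mult countable_I)
  also have "\<dots> \<le> mat_vec I T ?h i" using Suc by (intro mat_vec_mono)
  also have "\<dots> = ennreal (1 - diag_weight i) * ?h i + mat_vec I R ?h i" by (rule mat_vec_T[OF Suc.prems])
  also have "\<dots> \<le> ennreal (1 - diag_weight i) * ?h i + W i i * ?h i"
    unfolding W_mat_vec_D[OF Suc.prems] by (intro add_left_mono) simp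
  also have "\<dots> = ?h i"
    using diag_weight_le_1[OF Suc.prems] diag_weight_nonneg[of i]
    by (simp add: W_eq_diag_weight[OF Suc.prems] distrib_right[symmetric] ennreal_plus[symmetric] del: ennreal_plus)
  finally show ?case .
qed

text \<open>An infinite entry of R at a site of positive mean distance would make \<open>D m\<close> infinite.\<close>
lemma R_finite:
  assumes i: "i \<in> I" and j: "j \<in> I" and m: "mean_dist j \<noteq> 0"
  shows "R i j < \<top>"
proof (rule ccontr)
  let ?h = "mat_vec I D mean_dist"
  assume "\<not> R i j < \<top>"
  then have "R i j = \<top>" by (simp add: not_less top_unique)
  then have "\<top> = (\<Sum>l\<in>{j}. R i l * mean_dist l)" using m by (simp add: ennreal_top_mult)
  also have "\<dots> \<le> mat_vec I R mean_dist i"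
    unfolding mat_vec_def using j by (intro finite_sum_le_infsum_ennreal) auto
  also have "\<dots> \<le> mat_vec I R ?h i" by (intro mat_vec_mono le_mat_vec_D countable_I)
  also have "\<dots> \<le> W i i * ?h i" unfolding W_mat_vec_D[OF i] by simp
  also have "\<dots> < \<top>" using D_mean_dist_finite[OF i] W_eq_diag_weight[OF i] by (simp add: ennreal_mult_less_top)
  finally show False by simp
qed

definition influence_bound :: "'i set \<Rightarrow> ('i \<Rightarrow> ennreal) \<Rightarrow> bool" where
  "influence_bound K \<beta> \<longleftrightarrow> (\<forall>f. bounded_measurable (PiM I S) f \<and> depends_on I S K f \<and> (\<forall>i\<in>I. \<delta> i f < \<top>)
      \<longrightarrow> gap f \<le> (\<Sum>i\<in>K. \<delta> i f * \<beta> i))"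

lemma influence_boundD:
  "influence_bound K \<beta> \<Longrightarrow> bounded_measurable (PiM I S) f \<Longrightarrow> depends_on I S K f \<Longrightarrow>
   (\<And>i. i \<in> K \<Longrightarrow> \<delta> i f < \<top>) \<Longrightarrow> K \<subseteq> I \<Longrightarrow> gap f \<le> (\<Sum>i\<in>K. \<delta> i f * \<beta> i)"
proof -
  assume *: "influence_bound K \<beta>" "bounded_measurable (PiM I S) f" "depends_on I S K f"
   "\<And>i. i \<in> K \<Longrightarrow> \<delta> i f < \<top>" "K \<subseteq> I"
  then have "\<delta> i f < \<top>" if "i \<in> I" for i
    using that osc_depends_on[of K f i] by (cases "i \<in> K") auto
  then show ?thesis using * unfolding influence_bound_def by blast
qed

text \<open>
  An influence bound on K gives an estimate for functions that depend on all sites: the frozen function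
  depends on K only, and its oscillations are no larger.
\<close>
lemma influence_bound_freeze:
  assumes K: "finite K" "K \<subseteq> I" and \<beta>: "influence_bound K \<beta>"
    and f: "bounded_measurable (PiM I S) f" "quasilocal I S f" "\<And>i. i \<in> K \<Longrightarrow> \<delta> i f < \<top>"
  shows "gap f \<le> (\<Sum>i\<in>K. \<delta> i f * \<beta> i) + (\<Sum>\<^sub>\<infinity>j\<in>I - K. \<delta> j f * (3 * mean_dist j))"
proof (rule gap_le_freeze[OF f(1,2) K(2)])
  fix y assume y: "y \<in> \<Omega>"
  have "gap (freeze I K y f) \<le> (\<Sum>i\<in>K. \<delta> i (freeze I K y f) * \<beta> i)"
    using K y f order_le_less_trans[OF osc_freeze_le[OF K(2) y] f(3)]
    by (intro influence_boundD[OF \<beta> freeze_measurable freeze_depends_on]) auto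
  also have "\<dots> \<le> (\<Sum>i\<in>K. \<delta> i f * \<beta> i)"
    using osc_freeze_le[OF K(2) y] by (intro sum_mono mult_right_mono) auto
  finally show "gap (freeze I K y f) \<le> (\<Sum>i\<in>K. \<delta> i f * \<beta> i)" .
qed

text \<open>
  The improvement with a finite family of blocks. The lazy update depends on sites outside K; those of
  level at most k are frozen, which \<open>\<beta>\<close> can pay for by assumption, and those of higher levels have
  no influence at all.
\<close>
lemma one_step_finite:
  assumes F: "finite F" "F \<subseteq> level_blocks k"
    and K: "finite K" "K \<subseteq> sites_upto I \<tau> k" "\<And>i. i \<in> K \<Longrightarrow> mean_dist i \<noteq> 0"
    and \<theta>: "0 \<le> \<theta>" "\<theta> * (\<Sum>J\<in>F. w J) \<le> 1"
    and \<beta>: "influence_bound K \<beta>" "\<And>j. j \<in> I - K \<Longrightarrow> \<tau> j \<le> k \<Longrightarrow> 3 * mean_dist j \<le> \<beta> j"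
    and f: "bounded_measurable (PiM I S) f" "depends_on I S K f" "\<And>i. i \<in> K \<Longrightarrow> \<delta> i f < \<top>"
  shows "gap f \<le> (\<Sum>i\<in>K. ennreal (1 - \<theta> * (\<Sum>J\<in>{J\<in>F. i \<in> J}. w J)) * (\<delta> i f * \<beta> i))
     + ennreal \<theta> * (\<Sum>i\<in>{i\<in>K. \<tau> i = k}. \<delta> i f * (a i + mat_vec I R \<beta> i))"
proof -
  let ?P = "lazy_update \<theta> F f" and ?K = "{i\<in>K. \<tau> i = k}"
  let ?v = "\<lambda>j. ennreal (1 - \<theta> * (\<Sum>J\<in>{J\<in>F. j \<in> J}. w J)) * \<delta> j f"
  let ?r = "\<lambda>j. \<Sum>i\<in>?K. \<delta> i f * R i j"
  have KI: "K \<subseteq> I" using K by (auto simp: sites_upto_def)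
  have oscP: "\<delta> j ?P \<le> ?v j + ennreal \<theta> * ?r j" if "j \<in> I" "\<tau> j \<le> k" for j
    using that by (rule osc_lazy_update[OF F K(1,2) \<theta> f(1,2)])
  have fin: "\<delta> j ?P < \<top>" if "j \<in> K" for j
  proof -
    have "j \<in> I" "\<tau> j \<le> k" using that K by (auto simp: sites_upto_def)
    moreover have "?v j + ennreal \<theta> * ?r j < \<top>"
    proof -
      have "\<delta> i f * R i j < \<top>" if "i \<in> ?K" for i
        using that \<open>j \<in> K\<close> f(3)[of i] R_finite[of i j] KI K(3) by (auto simp: ennreal_mult_less_top)
      then have "?r j < \<top>" using K(1) by simp
      then show ?thesis using f(3)[OF \<open>j \<in> K\<close>] by (simp add: ennreal_mult_less_top)
    qed
    ultimately show ?thesis using oscP by (blast intro: order_le_less_trans)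
  qed
  have "gap ?P \<le> (\<Sum>j\<in>K. \<delta> j ?P * \<beta> j) + (\<Sum>\<^sub>\<infinity>j\<in>I - K. \<delta> j ?P * (3 * mean_dist j))"
    by (intro influence_bound_freeze K KI \<beta> fin
        lazy_update_bounded_measurable[OF F K(1,2) \<theta> f(1,2)] lazy_update_quasilocal[OF F K(1,2) \<theta> f(1,2)])
  also have "\<dots> \<le> (\<Sum>\<^sub>\<infinity>j\<in>K. (?v j + ennreal \<theta> * ?r j) * \<beta> j) + (\<Sum>\<^sub>\<infinity>j\<in>I - K. (?v j + ennreal \<theta> * ?r j) * \<beta> j)"
  proof (intro add_mono infsum_mono)
    show "(\<Sum>j\<in>K. \<delta> j ?P * \<beta> j) \<le> (\<Sum>\<^sub>\<infinity>j\<in>K. (?v j + ennreal \<theta> * ?r j) * \<beta> j)"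
      using oscP K by (auto simp: sites_upto_def intro!: sum_mono mult_right_mono)
    fix j assume j: "j \<in> I - K"
    show "\<delta> j ?P * (3 * mean_dist j) \<le> (?v j + ennreal \<theta> * ?r j) * \<beta> j"
    proof (cases "\<tau> j \<le> k")
      case True
      then show ?thesis using j oscP \<beta>(2) by (intro mult_mono) auto
    next
      case False
      then show ?thesis using j by (simp add: osc_lazy_update_beyond[OF F K(1,2) \<theta> f(1,2)])
    qed
  qed auto
  also have "\<dots> = (\<Sum>\<^sub>\<infinity>j\<in>I. (?v j + ennreal \<theta> * ?r j) * \<beta> j)"
    using KI by (subst infsum_Un_disjoint[symmetric]) (auto simp: Un_absorb1 intro!: arg_cong2[where f = infsum])
  also have "\<dots> = (\<Sum>\<^sub>\<infinity>j\<in>I. ?v j * \<beta> j) + ennreal \<theta> * (\<Sum>\<^sub>\<infinity>j\<in>I. ?r j * \<beta> j)"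
    by (simp add: distrib_right infsum_add mult.assoc infsum_ennreal_cmult)
  also have "(\<Sum>\<^sub>\<infinity>j\<in>I. ?v j * \<beta> j) = (\<Sum>\<^sub>\<infinity>j\<in>K. ?v j * \<beta> j)"
    using KI osc_depends_on[OF f(2) _ _ KI] by (intro infsum_cong_neutral) auto
  also have "(\<Sum>\<^sub>\<infinity>j\<in>I. ?r j * \<beta> j) = (\<Sum>\<^sub>\<infinity>i\<in>?K. \<Sum>\<^sub>\<infinity>j\<in>I. \<delta> i f * (R i j * \<beta> j))"
    using K(1) by (subst infsum_ennreal_swap[OF _ countable_I]) (auto simp: countable_finite sum_distrib_right mult.assoc)
  also have "\<dots> = (\<Sum>i\<in>?K. \<delta> i f * mat_vec I R \<beta> i)"
    using K(1) by (simp add: infsum_ennreal_cmult mat_vec_def)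
  finally have P: "gap ?P \<le> (\<Sum>j\<in>K. ?v j * \<beta> j) + ennreal \<theta> * (\<Sum>i\<in>?K. \<delta> i f * mat_vec I R \<beta> i)"
    using K(1) by simp
  have "gap f \<le> gap ?P + ennreal \<theta> * (\<Sum>i\<in>?K. \<delta> i f * a i)"
    by (rule gap_lazy_update[OF F K(1,2) \<theta> f(1,2)])
  also have "\<dots> \<le> ((\<Sum>j\<in>K. ?v j * \<beta> j) + ennreal \<theta> * (\<Sum>i\<in>?K. \<delta> i f * mat_vec I R \<beta> i)) + ennreal \<theta> * (\<Sum>i\<in>?K. \<delta> i f * a i)"
    by (intro add_right_mono P)
  finally show ?thesis
    by (simp add: distrib_left sum.distrib mult.assoc add_ac)
qed

text \<open>
  For a site of level k in K, the family of blocks of level k that meet K contains all the blocks through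
  that site, so finite subfamilies exhaust its weight.
\<close>
lemma diag_weight_limit:
  assumes "i \<in> K" "\<tau> i = k"
  shows "((\<lambda>F. ennreal (\<Sum>J\<in>{J\<in>F. i \<in> J}. w J)) \<longlongrightarrow> W i i)
    (finite_subsets_at_top {J\<in>level_blocks k. J \<inter> K \<noteq> {}})" (is "(_ \<longlongrightarrow> _) (finite_subsets_at_top ?B)")
proof -
  have B: "J \<in> ?B" if "J \<in> \<J>" "i \<in> J" for J
    using that assms block(4)[of J i] by (auto simp: level_blocks_def)
  have "(\<Sum>\<^sub>\<infinity>J\<in>{J\<in>\<J>. i \<in> J}. ennreal (w J)) = (\<Sum>\<^sub>\<infinity>J\<in>?B. if i \<in> J then ennreal (w J) else 0)"
  proof (rule infsum_cong_neutral)
    fix J assume "J \<in> {J\<in>\<J>. i \<in> J} - ?B"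
    then show "ennreal (w J) = 0" using B by blast
  qed (auto simp: level_blocks_def)
  then have "W i i = (\<Sum>\<^sub>\<infinity>J\<in>?B. if i \<in> J then ennreal (w J) else 0)"
    by (simp add: W_mat_def)
  then have "(sum (\<lambda>J. if i \<in> J then ennreal (w J) else 0) \<longlongrightarrow> W i i) (finite_subsets_at_top ?B)"
    using has_sum_infsum[of "\<lambda>J. if i \<in> J then ennreal (w J) else 0" ?B] by (simp add: has_sum_def)
  moreover have "\<forall>\<^sub>F F in finite_subsets_at_top ?B.
      sum (\<lambda>J. if i \<in> J then ennreal (w J) else 0) F = ennreal (\<Sum>J\<in>{J\<in>F. i \<in> J}. w J)"
  proof (rule eventually_finite_subsets_at_top_weakI)
    fix F assume F: "finite F" "F \<subseteq> ?B"
    then have "0 \<le> w J" if "J \<in> F" for J using that w_pos[of J] by (auto simp: level_blocks_def)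
    then show "sum (\<lambda>J. if i \<in> J then ennreal (w J) else 0) F = ennreal (\<Sum>J\<in>{J\<in>F. i \<in> J}. w J)"
      using F(1) by (subst sum_ennreal[symmetric]) (auto simp: sum.inter_filter)
  qed
  ultimately show ?thesis by (rule Lim_transform_eventually)
qed

lemma block_weight_le:
  assumes F: "finite F" "F \<subseteq> level_blocks k" and i: "i \<in> I"
  shows "(\<Sum>J\<in>{J\<in>F. i \<in> J}. w J) \<le> 1"
proof -
  have F': "F \<subseteq> \<J>" using F by (auto simp: level_blocks_def)
  have "(\<Sum>J\<in>{J\<in>F. i \<in> J}. ennreal (w J)) \<le> W i i"
    unfolding W_mat_def using F F' by (auto intro!: finite_sum_le_infsum_ennreal)
  also have "\<dots> \<le> 1" by (rule W_le_1[OF i])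
  finally show ?thesis
    using F' w_pos by (subst (asm) sum_ennreal) (auto intro: less_imp_le)
qed

text \<open>
  Every block counted here meets K, and each site carries weight at most 1. This is why a step size that depends
  only on the number of sites in K is small enough.
\<close>
lemma total_weight_le:
  assumes F: "finite F" "F \<subseteq> {J\<in>level_blocks k. J \<inter> K \<noteq> {}}" and K: "finite K" "K \<subseteq> I"
  shows "(\<Sum>J\<in>F. w J) \<le> real (card K)"
proof -
  have pos: "0 \<le> w J" if "J \<in> F" for J using that F w_pos[of J] by (auto simp: level_blocks_def)
  have "(\<Sum>J\<in>F. w J) \<le> (\<Sum>J\<in>F. \<Sum>i\<in>K. if i \<in> J then w J else 0)"
  proof (rule sum_mono)
    fix J assume J: "J \<in> F"
    then obtain i where i: "i \<in> K" "i \<in> J" using F by blast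
    then show "w J \<le> (\<Sum>i\<in>K. if i \<in> J then w J else 0)"
      using member_le_sum[of i K "\<lambda>i. if i \<in> J then w J else 0"] pos[OF J] K by auto
  qed
  also have "\<dots> = (\<Sum>i\<in>K. \<Sum>J\<in>{J\<in>F. i \<in> J}. w J)"
    using F(1) by (subst sum.swap) (simp add: sum.inter_filter)
  also have "\<dots> \<le> (\<Sum>i\<in>K. 1)"
    using F K by (intro sum_mono block_weight_le[of F k]) auto
  finally show ?thesis by simp
qed

text \<open>
  The supersolution b reproduces itself, and only the error e on level k evolves, by the lazy version of T.
  Finite families of blocks are exhausted at the end: their influence enters through \<open>R\<close> and \<open>a\<close>, which
  are already maximal, and only the diagonal factors have to converge. The step size is at most \<open>1 / 2\<close>
  so that these factors have a nonzero limit, and multiplication by a possibly infinite \<open>\<beta> i\<close> is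
  continuous there.
\<close>
lemma one_step:
  assumes K: "finite K" "K \<subseteq> sites_upto I \<tau> k" "\<And>i. i \<in> K \<Longrightarrow> mean_dist i \<noteq> 0"
    and \<theta>: "\<theta> = 1 / real (card K + 2)"
    and b: "\<And>j. j \<in> I - K \<Longrightarrow> \<tau> j \<le> k \<Longrightarrow> 3 * mean_dist j \<le> b j"
      "\<And>i. i \<in> K \<Longrightarrow> a i + mat_vec I R b i \<le> W i i * b i"
    and ib: "influence_bound K (\<lambda>i. b i + (if \<tau> i = k then e i else 0))"
  shows "influence_bound K (\<lambda>i. b i + (if \<tau> i = k then ennreal (1 - \<theta>) * e i + ennreal \<theta> * mat_vec I T e i else 0))"
  unfolding influence_bound_def
proof (intro allI impI, elim conjE)
  fix f assume f: "bounded_measurable (PiM I S) f" "depends_on I S K f" "\<forall>i\<in>I. \<delta> i f < \<top>"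
  let ?\<beta> = "\<lambda>i. b i + (if \<tau> i = k then e i else 0)" and ?B = "{J\<in>level_blocks k. J \<inter> K \<noteq> {}}"
  let ?K = "{i\<in>K. \<tau> i = k}"
  have \<theta>': "0 \<le> \<theta>" "\<theta> \<le> 1 / 2" "\<theta> * real (card K) \<le> 1" by (auto simp: \<theta> field_simps)
  have KI: "K \<subseteq> I" using K by (auto simp: sites_upto_def)
  let ?G = "\<lambda>F. (\<Sum>i\<in>K. ennreal (1 - \<theta> * (\<Sum>J\<in>{J\<in>F. i \<in> J}. w J)) * (\<delta> i f * ?\<beta> i))
     + ennreal \<theta> * (\<Sum>i\<in>?K. \<delta> i f * (a i + mat_vec I R ?\<beta> i))"
  let ?w = "\<lambda>i. if \<tau> i = k then diag_weight i else 0"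
  let ?L = "(\<Sum>i\<in>K. ennreal (1 - \<theta> * ?w i) * (\<delta> i f * ?\<beta> i))
     + ennreal \<theta> * (\<Sum>i\<in>?K. \<delta> i f * (a i + mat_vec I R ?\<beta> i))"
  have "gap f \<le> ?G F" if F: "finite F" "F \<subseteq> ?B" for F
  proof (rule one_step_finite[OF F(1) _ K \<theta>'(1) _ ib _ f(1,2)])
    show "\<theta> * (\<Sum>J\<in>F. w J) \<le> 1"
      using mult_left_mono[OF total_weight_le[OF F K(1) KI] \<theta>'(1)] \<theta>'(3) by linarith
    show "3 * mean_dist j \<le> ?\<beta> j" if "j \<in> I - K" "\<tau> j \<le> k" for j
      using b(1)[OF that] by (rule order_trans) simp
  qed (use F f KI in auto)
  then have ev: "\<forall>\<^sub>F F in finite_subsets_at_top ?B. gap f \<le> ?G F"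
    by (intro eventually_finite_subsets_at_top_weakI)
  have "(?G \<longlongrightarrow> ?L) (finite_subsets_at_top ?B)"
  proof (intro tendsto_add tendsto_const tendsto_sum tendsto_mult_ennreal)
    fix i assume i: "i \<in> K"
    then have iI: "i \<in> I" using KI by auto
    show "((\<lambda>F. ennreal (1 - \<theta> * (\<Sum>J\<in>{J\<in>F. i \<in> J}. w J))) \<longlongrightarrow> ennreal (1 - \<theta> * ?w i)) (finite_subsets_at_top ?B)"
    proof (cases "\<tau> i = k")
      case True
      have pos: "\<forall>\<^sub>F F in finite_subsets_at_top ?B. 0 \<le> (\<Sum>J\<in>{J\<in>F. i \<in> J}. w J)"
        using w_pos by (intro eventually_finite_subsets_at_top_weakI sum_nonneg) (auto simp: level_blocks_def intro: less_imp_le)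
      have "((\<lambda>F. \<Sum>J\<in>{J\<in>F. i \<in> J}. w J) \<longlongrightarrow> diag_weight i) (finite_subsets_at_top ?B)"
        using diag_weight_limit[OF i True] unfolding W_eq_diag_weight[OF iI]
        by (rule tendsto_ennrealD[OF _ pos diag_weight_nonneg])
      then show ?thesis using True by (auto intro!: tendsto_intros)
    next
      case False
      have "\<forall>\<^sub>F F in finite_subsets_at_top ?B. ennreal (1 - \<theta> * (\<Sum>J\<in>{J\<in>F. i \<in> J}. w J)) = ennreal (1 - \<theta> * ?w i)"
      proof (rule eventually_finite_subsets_at_top_weakI)
        fix F assume "F \<subseteq> ?B"
        then have no_block: "{J\<in>F. i \<in> J} = {}"
          using False block(4)[of _ i] by (auto simp: level_blocks_def)
        show "ennreal (1 - \<theta> * (\<Sum>J\<in>{J\<in>F. i \<in> J}. w J)) = ennreal (1 - \<theta> * ?w i)"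
          unfolding no_block using False by simp
      qed
      then show ?thesis by (rule tendsto_eventually)
    qed
    have "\<theta> * ?w i \<le> 1 / 2 * 1"
      using \<theta>' diag_weight_le_1[OF iI] diag_weight_nonneg[of i] by (intro mult_mono) auto
    then have "ennreal (1 - \<theta> * ?w i) \<noteq> 0" by simp
    then show "\<not> (ennreal (1 - \<theta> * ?w i) = 0 \<and> \<delta> i f * ?\<beta> i = \<infinity> \<or> ennreal (1 - \<theta> * ?w i) = \<infinity> \<and> \<delta> i f * ?\<beta> i = 0)"
      by auto
  qed
  from tendsto_lowerbound[OF this ev] have "gap f \<le> ?L" by simp
  also have "?L = (\<Sum>i\<in>K. ennreal (1 - \<theta> * ?w i) * (\<delta> i f * ?\<beta> i) +
      (if \<tau> i = k then ennreal \<theta> * (\<delta> i f * (a i + mat_vec I R ?\<beta> i)) else 0))"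
    by (simp only: sum.distrib sum_distrib_left[of "ennreal \<theta>"]) (simp only: sum.inter_filter[OF K(1)])
  also have "\<dots> \<le> (\<Sum>i\<in>K. \<delta> i f * (b i + (if \<tau> i = k then ennreal (1 - \<theta>) * e i + ennreal \<theta> * mat_vec I T e i else 0)))"
  proof (rule sum_mono)
    fix i assume i: "i \<in> K"
    then have iI: "i \<in> I" using KI by auto
    show "ennreal (1 - \<theta> * ?w i) * (\<delta> i f * ?\<beta> i) +
      (if \<tau> i = k then ennreal \<theta> * (\<delta> i f * (a i + mat_vec I R ?\<beta> i)) else 0) \<le>
      \<delta> i f * (b i + (if \<tau> i = k then ennreal (1 - \<theta>) * e i + ennreal \<theta> * mat_vec I T e i else 0))"
    proof (cases "\<tau> i = k")
      case True
      let ?c = "ennreal (1 - \<theta> * diag_weight i)"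
      have th: "\<theta> * diag_weight i \<le> \<theta>" "\<theta> \<le> 1" "0 \<le> \<theta> * diag_weight i"
        using \<theta>' diag_weight_le_1[OF iI] diag_weight_nonneg[of i] by (auto intro: mult_left_le)
      have "mat_vec I R ?\<beta> i \<le> mat_vec I R b i + mat_vec I R e i"
        unfolding mat_vec_add[symmetric] by (intro mat_vec_mono) auto
      then have "a i + mat_vec I R ?\<beta> i \<le> (a i + mat_vec I R b i) + mat_vec I R e i"
        unfolding add.assoc by (rule add_left_mono)
      also have "\<dots> \<le> W i i * b i + mat_vec I R e i"
        by (rule add_right_mono[OF b(2)[OF i]])
      finally have step: "a i + mat_vec I R ?\<beta> i \<le> W i i * b i + mat_vec I R e i" .
      have c_eq: "?c = ennreal (1 - \<theta>) + ennreal \<theta> * ennreal (1 - diag_weight i)"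
        using th \<theta>' diag_weight_le_1[OF iI] by (simp add: ennreal_plus[symmetric] ennreal_mult[symmetric] algebra_simps del: ennreal_plus)
      have "?c * (b i + e i) + ennreal \<theta> * (a i + mat_vec I R ?\<beta> i)
         \<le> ?c * (b i + e i) + ennreal \<theta> * (W i i * b i + mat_vec I R e i)"
        by (intro add_left_mono mult_left_mono step) auto
      also have "\<dots> = (?c + ennreal (\<theta> * diag_weight i)) * b i + (?c * e i + ennreal \<theta> * mat_vec I R e i)"
        using \<theta>' diag_weight_nonneg[of i]
        by (simp add: W_eq_diag_weight[OF iI] distrib_left distrib_right ennreal_mult mult.assoc add_ac)
      also have "?c + ennreal (\<theta> * diag_weight i) = 1"
        using th by (simp add: ennreal_plus[symmetric] del: ennreal_plus)
      also have "1 * b i + (?c * e i + ennreal \<theta> * mat_vec I R e i)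
         = b i + (ennreal (1 - \<theta>) * e i + ennreal \<theta> * mat_vec I T e i)"
        unfolding c_eq by (simp add: mat_vec_T[OF iI] distrib_left distrib_right mult.assoc add_ac)
      finally have "\<delta> i f * (?c * (b i + e i) + ennreal \<theta> * (a i + mat_vec I R ?\<beta> i)) \<le>
          \<delta> i f * (b i + (ennreal (1 - \<theta>) * e i + ennreal \<theta> * mat_vec I T e i))"
        by (intro mult_left_mono) auto
      moreover have "\<delta> i f * (?c * (b i + e i) + ennreal \<theta> * (a i + mat_vec I R ?\<beta> i)) =
         ?c * (\<delta> i f * (b i + e i)) + ennreal \<theta> * (\<delta> i f * (a i + mat_vec I R ?\<beta> i))"
        by (simp only: distrib_left[of "\<delta> i f"] mult.left_commute[of "\<delta> i f"])
      ultimately show ?thesis using True by simp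
    qed simp
  qed
  finally show "gap f \<le> (\<Sum>i\<in>K. \<delta> i f * (b i + (if \<tau> i = k then ennreal (1 - \<theta>) * e i + ennreal \<theta> * mat_vec I T e i else 0)))" .
qed

end

section \<open>Induction over the levels, and passage to all sites\<close>

context one_sided_comparison
begin

text \<open>
  For \<open>r = 0\<close> this is \<open>((1 - \<theta>) Id + \<theta> T)\<^sup>n\<close> applied to \<open>3 m\<close>. The index r, the number of additional factors T,
  reduces convergence to the statement on scalar sequences at each site.
\<close>
definition lazy_error :: "real \<Rightarrow> nat \<Rightarrow> nat \<Rightarrow> 'i \<Rightarrow> ennreal" where
  "lazy_error \<theta> n r i = lazy_iterate \<theta> (\<lambda>r. 3 * mat_vec I (mat_power I T r) mean_dist i) n r"

lemma lazy_error_Suc: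
  "lazy_error \<theta> (Suc n) r i = ennreal (1 - \<theta>) * lazy_error \<theta> n r i + ennreal \<theta> * lazy_error \<theta> n (Suc r) i"
  by (simp add: lazy_error_def)

lemma mat_vec_lazy_error: "mat_vec I T (lazy_error \<theta> n r) i = lazy_error \<theta> n (Suc r) i"
proof (induction n arbitrary: r i)
  case 0
  then show ?case by (simp add: lazy_error_def[abs_def] mat_vec_cmult mat_vec_mult countable_I)
next
  case (Suc n)
  have "mat_vec I T (lazy_error \<theta> (Suc n) r) i =
    mat_vec I T (\<lambda>i. ennreal (1 - \<theta>) * lazy_error \<theta> n r i + ennreal \<theta> * lazy_error \<theta> n (Suc r) i) i"
    by (rule mat_vec_cong) (simp add: lazy_error_def)
  also have "\<dots> = lazy_error \<theta> (Suc n) (Suc r) i"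
    unfolding mat_vec_add mat_vec_cmult Suc.IH by (simp add: lazy_error_def)
  finally show ?case .
qed

lemma lazy_error_tendsto_0:
  assumes i: "i \<in> I" and \<theta>: "0 < \<theta>" "\<theta> \<le> 1"
  shows "(\<lambda>n. lazy_error \<theta> n 0 i) \<longlonglongrightarrow> 0"
  unfolding lazy_error_def
proof (rule lazy_iterate_tendsto_0[OF \<theta>, where C = "3 * mat_vec I D mean_dist i"])
  show "3 * mat_vec I D mean_dist i < \<top>"
    using D_mean_dist_finite[OF i] by (simp add: ennreal_mult_less_top)
  show "3 * mat_vec I (mat_power I T k) mean_dist i \<le> 3 * mat_vec I D mean_dist i" for k
    by (intro mult_left_mono power_T_bound i) auto
  have "(\<lambda>k. 3 * mat_vec I (mat_power I T k) mean_dist i) \<longlonglongrightarrow> 3 * 0"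
    by (intro ennreal_tendsto_cmult power_tendsto_0 i) auto
  then show "(\<lambda>k. 3 * mat_vec I (mat_power I T k) mean_dist i) \<longlonglongrightarrow> 0" by simp
qed

text \<open>
  Freezing level k of L costs \<open>3 m\<close> there, the initial error; each improvement step then applies
  \<open>(1 - \<theta>) Id + \<theta> T\<close> to the error, which vanishes in the limit. Finiteness of the oscillations is needed to pass to
  the limit inside the sum.
\<close>
lemma influence_bound_next_level:
  assumes L: "finite L" "L \<subseteq> I" "\<And>i. i \<in> L \<Longrightarrow> mean_dist i \<noteq> 0"
    and b: "\<And>j. j \<in> I - L \<Longrightarrow> 3 * mean_dist j \<le> b j" "\<And>i. i \<in> L \<Longrightarrow> a i + mat_vec I R b i \<le> W i i * b i"
    and prev: "influence_bound (L \<inter> sites_upto I \<tau> (k - 1)) b"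
  shows "influence_bound (L \<inter> sites_upto I \<tau> k) b"
proof -
  \<comment> \<open>Only the part of L up to level k matters; ?K' is its part below level k.\<close>
  let ?K = "L \<inter> sites_upto I \<tau> k" and ?K' = "L \<inter> sites_upto I \<tau> (k - 1)"
  define \<theta> where "\<theta> = 1 / real (card ?K + 2)"
  have \<theta>: "0 < \<theta>" "\<theta> \<le> 1" by (auto simp: \<theta>_def)
  have K: "finite ?K" "?K \<subseteq> I" "finite ?K'" "?K' \<subseteq> I" "?K' \<subseteq> ?K" using L by (auto simp: sites_upto_def)
  have iter: "influence_bound ?K (\<lambda>i. b i + (if \<tau> i = k then lazy_error \<theta> n 0 i else 0))" for n
  proof (induction n)
    case 0
    show ?case
      unfolding influence_bound_def
    proof (intro allI impI, elim conjE)
      fix f assume f: "bounded_measurable (PiM I S) f" "depends_on I S ?K f" "\<forall>i\<in>I. \<delta> i f < \<top>"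
      have "gap f \<le> (\<Sum>i\<in>?K'. \<delta> i f * b i) + (\<Sum>\<^sub>\<infinity>j\<in>I - ?K'. \<delta> j f * (3 * mean_dist j))"
        using f K depends_on_quasilocal[OF f(2) K(1,2)] by (intro influence_bound_freeze prev) auto
      also have "(\<Sum>\<^sub>\<infinity>j\<in>I - ?K'. \<delta> j f * (3 * mean_dist j)) = (\<Sum>\<^sub>\<infinity>j\<in>?K - ?K'. \<delta> j f * (3 * mean_dist j))"
        using K osc_depends_on[OF f(2) _ _ K(2)] by (intro infsum_cong_neutral) auto
      also have "\<dots> = (\<Sum>j\<in>?K - ?K'. \<delta> j f * (3 * mean_dist j))" using K by simp
      also have "(\<Sum>i\<in>?K'. \<delta> i f * b i) + \<dots> \<le>
          (\<Sum>i\<in>?K'. \<delta> i f * (b i + (if \<tau> i = k then lazy_error \<theta> 0 0 i else 0))) +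
          (\<Sum>i\<in>?K - ?K'. \<delta> i f * (b i + (if \<tau> i = k then lazy_error \<theta> 0 0 i else 0)))"
      proof (intro add_mono sum_mono mult_left_mono)
        fix j assume j: "j \<in> ?K - ?K'"
        then have "\<tau> j = k" "j \<in> I" by (auto simp: sites_upto_def)
        then show "3 * mean_dist j \<le> b j + (if \<tau> j = k then lazy_error \<theta> 0 0 j else 0)"
          by (simp add: lazy_error_def mat_vec_id add_increasing)
      qed auto
      also have "\<dots> = (\<Sum>i\<in>?K. \<delta> i f * (b i + (if \<tau> i = k then lazy_error \<theta> 0 0 i else 0)))"
        using K by (subst sum.subset_diff[of ?K' ?K]) (auto simp: add.commute)
      finally show "gap f \<le> (\<Sum>i\<in>?K. \<delta> i f * (b i + (if \<tau> i = k then lazy_error \<theta> 0 0 i else 0)))" .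
    qed
  next
    case (Suc n)
    have "influence_bound ?K (\<lambda>i. b i + (if \<tau> i = k then
        ennreal (1 - \<theta>) * lazy_error \<theta> n 0 i + ennreal \<theta> * mat_vec I T (lazy_error \<theta> n 0) i else 0))"
      using L b by (intro one_step[OF K(1) _ _ \<theta>_def _ _ Suc.IH]) (auto simp: sites_upto_def)
    then show ?case
      by (simp only: lazy_error_Suc mat_vec_lazy_error)
  qed
  show ?thesis
    unfolding influence_bound_def
  proof (intro allI impI, elim conjE)
    fix f assume f: "bounded_measurable (PiM I S) f" "depends_on I S ?K f" "\<forall>i\<in>I. \<delta> i f < \<top>"
    have "(\<lambda>n. \<Sum>i\<in>?K. \<delta> i f * (b i + (if \<tau> i = k then lazy_error \<theta> n 0 i else 0))) \<longlonglongrightarrow>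
        (\<Sum>i\<in>?K. \<delta> i f * (b i + (if \<tau> i = k then 0 else 0)))"
    proof (intro tendsto_sum ennreal_tendsto_cmult tendsto_add tendsto_const)
      fix i assume i: "i \<in> ?K"
      then show "\<delta> i f < \<top>" using f K by auto
      show "(\<lambda>n. if \<tau> i = k then lazy_error \<theta> n 0 i else 0) \<longlonglongrightarrow> (if \<tau> i = k then 0 else 0)"
        using i K lazy_error_tendsto_0[OF _ \<theta>, of i] by (cases "\<tau> i = k") auto
    qed
    moreover have "gap f \<le> (\<Sum>i\<in>?K. \<delta> i f * (b i + (if \<tau> i = k then lazy_error \<theta> n 0 i else 0)))" for n
      using iter[of n] f unfolding influence_bound_def by blast
    ultimately show "gap f \<le> (\<Sum>i\<in>?K. \<delta> i f * b i)"
      by (intro LIMSEQ_le_const[where X = "\<lambda>n. \<Sum>i\<in>?K. \<delta> i f * (b i + (if \<tau> i = k then lazy_error \<theta> n 0 i else 0))"]) auto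
  qed
qed

lemma influence_bound_empty: "influence_bound {} b"
  unfolding influence_bound_def
proof (intro allI impI, elim conjE)
  fix f assume f: "depends_on I S {} f"
  obtain y where y: "y \<in> \<Omega>" using Omega_nonempty by blast
  have c: "f x = f y" if "x \<in> \<Omega>" for x using depends_onD[OF f that y] by simp
  have "(\<integral>x. f x \<partial>\<rho>) = (\<integral>x. f y \<partial>\<rho>)" by (intro Bochner_Integration.integral_cong) (auto intro: c)
  moreover have "(\<integral>x. f x \<partial>\<rho>') = (\<integral>x. f y \<partial>\<rho>')" by (intro Bochner_Integration.integral_cong) (auto intro: c)
  ultimately show "gap f \<le> (\<Sum>i\<in>{}. \<delta> i f * b i)"
    by (simp add: gap_def rho.prob_space[simplified] rho'.prob_space[simplified])
qed

text \<open>
  A finite set L has no sites below its lowest level, and a function of no coordinates is constant; the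
  induction over the levels starts there.
\<close>
lemma influence_bound_supersolution:
  assumes L: "finite L" "L \<subseteq> I" "\<And>i. i \<in> L \<Longrightarrow> mean_dist i \<noteq> 0"
    and b: "\<And>j. j \<in> I - L \<Longrightarrow> 3 * mean_dist j \<le> b j" "\<And>i. i \<in> L \<Longrightarrow> a i + mat_vec I R b i \<le> W i i * b i"
  shows "influence_bound L b"
proof (cases "L = {}")
  case True
  then show ?thesis by (simp add: influence_bound_empty)
next
  case False
  have all: "influence_bound (L \<inter> sites_upto I \<tau> (Min (\<tau> ` L) - 1 + int n)) b" for n
  proof (induction n)
    case 0
    have "L \<inter> sites_upto I \<tau> (Min (\<tau> ` L) - 1 + int 0) = {}"
      using L Min_le[of "\<tau> ` L"] by (fastforce simp: sites_upto_def)
    then show ?case by (simp add: influence_bound_empty)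
  next
    case (Suc n)
    have "Min (\<tau> ` L) - 1 + int n = Min (\<tau> ` L) - 1 + int (Suc n) - 1" by simp
    then have "influence_bound (L \<inter> sites_upto I \<tau> (Min (\<tau> ` L) - 1 + int (Suc n) - 1)) b"
      using Suc by (simp only:)
    from influence_bound_next_level[OF L(1,2) _ _ _ this] show ?case using L(3) b by blast
  qed
  \<comment> \<open>After this many steps the highest level of L is reached.\<close>
  let ?n = "nat (Max (\<tau> ` L) - (Min (\<tau> ` L) - 1))"
  have "\<tau> i \<le> Min (\<tau> ` L) - 1 + int ?n" if "i \<in> L" for i
  proof -
    have "Min (\<tau> ` L) \<le> \<tau> i" "\<tau> i \<le> Max (\<tau> ` L)"
      using that L(1) by (auto intro: Min_le Max_ge)
    then show ?thesis by linarith
  qed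
  then have "L \<inter> sites_upto I \<tau> (Min (\<tau> ` L) - 1 + int ?n) = L"
    using L(2) by (auto simp: sites_upto_def)
  then show ?thesis using all[of ?n] by simp
qed

definition comparison_vec :: "'i \<Rightarrow> ennreal" where
  "comparison_vec = mat_vec I D (\<lambda>j. inverse (W j j) * a j)"

text \<open>
  The supersolution is \<open>D u\<close>. The term \<open>3 m\<close> in u, placed off L, pays for freezing the sites off L and shows up
  on L as the sum over \<open>I - L\<close>.
\<close>
lemma influence_bound_finite:
  assumes L: "finite L" "L \<subseteq> I" "\<And>i. i \<in> L \<Longrightarrow> mean_dist i \<noteq> 0"
  shows "influence_bound L (\<lambda>i. comparison_vec i + 3 * (\<Sum>\<^sub>\<infinity>j\<in>I - L. D i j * mean_dist j))"
proof -
  define u where "u = (\<lambda>j. inverse (W j j) * a j + (if j \<in> L then 0 else 3 * mean_dist j))"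
  have "influence_bound L (mat_vec I D u)"
  proof (rule influence_bound_supersolution[OF L])
    fix j assume j: "j \<in> I - L"
    then have "3 * mean_dist j \<le> u j" by (simp add: u_def add_increasing)
    also have "\<dots> \<le> mat_vec I D u j" using j by (intro le_mat_vec_D countable_I) auto
    finally show "3 * mean_dist j \<le> mat_vec I D u j" .
  next
    fix i assume i: "i \<in> L"
    then have iI: "i \<in> I" using L by auto
    have "W i i * inverse (W i i) = 1"
      using W_nonzero[OF iI] W_eq_diag_weight[OF iI] ennreal_divide_self[of "W i i"] by (simp add: divide_ennreal_def)
    then have "W i i * u i = a i" using i by (simp add: u_def mult.assoc[symmetric])
    then show "a i + mat_vec I R (mat_vec I D u) i \<le> W i i * mat_vec I D u i"
      by (simp add: W_mat_vec_D[OF iI])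
  qed
  moreover have "mat_vec I D u i = comparison_vec i + 3 * (\<Sum>\<^sub>\<infinity>j\<in>I - L. D i j * mean_dist j)" for i
  proof -
    have "mat_vec I D u i = comparison_vec i + mat_vec I D (\<lambda>j. if j \<in> L then 0 else 3 * mean_dist j) i"
      unfolding u_def mat_vec_add comparison_vec_def ..
    also have "mat_vec I D (\<lambda>j. if j \<in> L then 0 else 3 * mean_dist j) i = (\<Sum>\<^sub>\<infinity>j\<in>I - L. 3 * (D i j * mean_dist j))"
      unfolding mat_vec_def by (intro infsum_cong_neutral) (auto simp: mult.left_commute)
    finally show ?thesis by (simp add: infsum_ennreal_cmult)
  qed
  ultimately show ?thesis by (simp add: mat_vec_def[abs_def])
qed

text \<open>
  L runs through the finite sets of sites of positive mean distance; the sites of K with mean distance 0 are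
  frozen free of charge.
\<close>
lemma gap_local:
  assumes K: "finite K" "K \<subseteq> I"
    and f: "bounded_measurable (PiM I S) f" "depends_on I S K f" "\<And>i. i \<in> I \<Longrightarrow> \<delta> i f < \<top>"
  shows "gap f \<le> (\<Sum>i\<in>K. \<delta> i f * comparison_vec i)"
proof -
  define A where "A = {i\<in>I. mean_dist i \<noteq> 0}"
  define t where "t = (\<lambda>L i. \<Sum>\<^sub>\<infinity>j\<in>I - L. D i j * mean_dist j)"
  have t: "t L i = (\<Sum>\<^sub>\<infinity>j\<in>A - L. D i j * mean_dist j)" for L i
    unfolding t_def by (intro infsum_cong_neutral) (auto simp: A_def)
  have tlim: "((\<lambda>L. t L i) \<longlongrightarrow> 0) (finite_subsets_at_top A)" if i: "i \<in> I" for i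
    unfolding t
  proof (rule infsum_ennreal_tail_tendsto_0)
    have "(\<Sum>\<^sub>\<infinity>j\<in>A. D i j * mean_dist j) \<le> mat_vec I D mean_dist i"
      unfolding mat_vec_def by (rule infsum_ennreal_subset) (auto simp: A_def)
    then show "(\<Sum>\<^sub>\<infinity>j\<in>A. D i j * mean_dist j) < \<top>"
      using D_mean_dist_finite[OF i] by (rule order_le_less_trans)
  qed
  let ?B = "\<lambda>L. \<Sum>i\<in>K. \<delta> i f * (comparison_vec i + 3 * t L i)"
  have lim: "(?B \<longlongrightarrow> (\<Sum>i\<in>K. \<delta> i f * (comparison_vec i + 3 * 0))) (finite_subsets_at_top A)"
    using K f tlim by (intro tendsto_sum ennreal_tendsto_cmult tendsto_add tendsto_const) auto
  have "\<forall>\<^sub>F L in finite_subsets_at_top A. gap f \<le> ?B L"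
    unfolding eventually_finite_subsets_at_top
  proof (intro exI[of _ "K \<inter> A"] conjI allI impI; (elim conjE)?)
    fix L assume L: "finite L" "K \<inter> A \<subseteq> L" "L \<subseteq> A"
    then have LI: "L \<subseteq> I" by (auto simp: A_def)
    have "gap f \<le> (\<Sum>i\<in>L. \<delta> i f * (comparison_vec i + 3 * t L i)) + (\<Sum>\<^sub>\<infinity>j\<in>I - L. \<delta> j f * (3 * mean_dist j))"
      unfolding t_def using L LI f depends_on_quasilocal[OF f(2) K]
      by (intro influence_bound_freeze influence_bound_finite) (auto simp: A_def)
    also have "(\<Sum>\<^sub>\<infinity>j\<in>I - L. \<delta> j f * (3 * mean_dist j)) = 0"
    proof (rule infsum_0)
      fix j assume j: "j \<in> I - L"
      show "\<delta> j f * (3 * mean_dist j) = 0"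
        using j L osc_depends_on[OF f(2) _ _ K(2), of j] by (cases "j \<in> K") (auto simp: A_def)
    qed
    also have "(\<Sum>i\<in>L. \<delta> i f * (comparison_vec i + 3 * t L i)) = (\<Sum>i\<in>L \<inter> K. \<delta> i f * (comparison_vec i + 3 * t L i))"
      using L(1) LI osc_depends_on[OF f(2) _ _ K(2)] by (intro sum.mono_neutral_right) auto
    also have "\<dots> \<le> ?B L" using K by (intro sum_mono2) auto
    finally show "gap f \<le> ?B L" by (simp add: add_right_mono)
  qed (use K in \<open>auto simp: A_def\<close>)
  from tendsto_lowerbound[OF lim this] show ?thesis by simp
qed

text \<open>
  f is approximated pointwise by its frozen versions along an exhaustion of I by finite sets; a sequence of
  sets, rather than the net of all finite sets, is needed for dominated convergence.
\<close>
lemma gap_quasilocal: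
  assumes f: "bounded_measurable (PiM I S) f" "quasilocal I S f" "\<And>i. i \<in> I \<Longrightarrow> \<delta> i f < \<top>"
  shows "gap f \<le> (\<Sum>\<^sub>\<infinity>i\<in>I. \<delta> i f * comparison_vec i)"
proof -
  obtain y where y: "y \<in> \<Omega>" using Omega_nonempty by blast
  define L where "L = (\<lambda>n. {i\<in>I. to_nat_on I i < n})"
  have L: "finite (L n)" "L n \<subseteq> I" for n
  proof -
    have "inj_on (to_nat_on I) (L n)"
      using inj_on_to_nat_on[OF countable_I] by (rule inj_on_subset) (auto simp: L_def)
    moreover have "to_nat_on I ` L n \<subseteq> {..<n}" by (auto simp: L_def)
    ultimately show "finite (L n)" by (meson finite_lessThan inj_on_finite)
  qed (auto simp: L_def)
  have Llim: "filterlim L (finite_subsets_at_top I) sequentially"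
    unfolding filterlim_finite_subsets_at_top
  proof (intro allI impI)
    fix X assume X: "finite X \<and> X \<subseteq> I"
    then obtain N where "\<forall>i\<in>X. to_nat_on I i < N"
      using finite_nat_set_iff_bounded[of "to_nat_on I ` X"] by auto
    then show "\<forall>\<^sub>F n in sequentially. finite (L n) \<and> X \<subseteq> L n \<and> L n \<subseteq> I"
      using X L by (intro eventually_sequentiallyI[of N]) (auto simp: L_def intro: less_le_trans)
  qed
  let ?f = "\<lambda>n. freeze I (L n) y f"
  obtain B where B: "\<forall>x\<in>\<Omega>. \<bar>f x\<bar> \<le> B" using bounded_measurableD[OF f(1)] by blast
  have pointwise: "(\<lambda>n. ?f n x) \<longlonglongrightarrow> f x" if x: "x \<in> \<Omega>" for x
    using filterlim_compose[OF _ Llim, of "\<lambda>J. f (merge J (I - J) (x, y))" "nhds (f x)"] f(2) x y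
    by (simp add: quasilocal_iff_tendsto freeze_def)
  have fm: "bounded_measurable (PiM I S) (?f n)" for n
    by (rule freeze_measurable[OF f(1) L(2) y])
  have bd: "\<bar>?f n x\<bar> \<le> B" if "x \<in> \<Omega>" for n x
    using B merge_Omega[OF L(2) that y] by (simp add: freeze_def)
  have conv: "(\<lambda>n. \<integral>x. ?f n x \<partial>M) \<longlonglongrightarrow> (\<integral>x. f x \<partial>M)" if M: "M = \<rho> \<or> M = \<rho>'" for M
  proof (rule integral_dominated_convergence[where w = "\<lambda>_. B"])
    show "integrable M (\<lambda>_. B)" using M by auto
    show "f \<in> borel_measurable M" "\<And>n. ?f n \<in> borel_measurable M"
      using M bounded_measurable_integrable[OF f(1)] bounded_measurable_integrable[OF fm] by auto
    show "AE x in M. (\<lambda>n. ?f n x) \<longlonglongrightarrow> f x" using M pointwise by (auto intro!: AE_I2)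
    show "AE x in M. norm (?f n x) \<le> B" for n using M bd by (auto intro!: AE_I2)
  qed
  have lim: "(\<lambda>n. gap (?f n)) \<longlonglongrightarrow> gap f"
    unfolding gap_def using conv[of \<rho>] conv[of \<rho>'] by (intro tendsto_intros) auto
  have "gap (?f n) \<le> (\<Sum>\<^sub>\<infinity>i\<in>I. \<delta> i f * comparison_vec i)" for n
  proof -
    have fin: "\<delta> i (?f n) < \<top>" if "i \<in> I" for i
    proof (cases "i \<in> L n")
      case True
      then show ?thesis by (rule order_le_less_trans[OF osc_freeze_le[OF L(2) y] f(3)[OF that]])
    next
      case False
      then show ?thesis using osc_depends_on[OF freeze_depends_on[OF L(2) y] that False L(2)] by simp
    qed
    have "gap (?f n) \<le> (\<Sum>i\<in>L n. \<delta> i (?f n) * comparison_vec i)"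
      by (rule gap_local[OF L fm freeze_depends_on[OF L(2) y] fin])
    also have "\<dots> \<le> (\<Sum>i\<in>L n. \<delta> i f * comparison_vec i)"
      using osc_freeze_le[OF L(2) y] by (intro sum_mono mult_right_mono) auto
    also have "\<dots> \<le> (\<Sum>\<^sub>\<infinity>i\<in>I. \<delta> i f * comparison_vec i)"
      by (rule finite_sum_le_infsum_ennreal[OF L])
    finally show ?thesis .
  qed
  then show ?thesis by (intro LIMSEQ_le_const2[OF lim]) auto
qed

lemma infsum_comparison_vec:
  "(\<Sum>\<^sub>\<infinity>i\<in>I. d i * comparison_vec i) = (\<Sum>\<^sub>\<infinity>(i, j)\<in>I \<times> I. d i * D i j * inverse (W j j) * a j)"
  by (simp add: infsum_ennreal_Times countable_I comparison_vec_def mat_vec_def infsum_ennreal_cmult mult.assoc)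

end

theorem theorem2p12:
  fixes I :: "'i set"
    and S :: "'i \<Rightarrow> 'a measure"
    and \<eta> :: "'i \<Rightarrow> 'a \<Rightarrow> 'a \<Rightarrow> real"
    and \<tau> :: "'i \<Rightarrow> int"
    and \<J> :: "'i set set"
    and \<rho> \<rho>' :: "('i \<Rightarrow> 'a) measure"
    and \<gamma> \<gamma>' :: "'i set \<Rightarrow> ('i \<Rightarrow> 'a) \<Rightarrow> ('i \<Rightarrow> 'a) measure"
    and Q :: "'i set \<Rightarrow> ('i \<Rightarrow> 'a) \<times> ('i \<Rightarrow> 'a) \<Rightarrow> (('i \<Rightarrow> 'a) \<times> ('i \<Rightarrow> 'a)) measure"
    and Qh :: "'i set \<Rightarrow> ('i \<Rightarrow> 'a) \<Rightarrow> (('i \<Rightarrow> 'a) \<times> ('i \<Rightarrow> 'a)) measure"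
    and w :: "'i set \<Rightarrow> real"
    and W R D :: "'i \<Rightarrow> 'i \<Rightarrow> ennreal"
    and a :: "'i \<Rightarrow> ennreal"
    and f :: "('i \<Rightarrow> 'a) \<Rightarrow> real"
  defines "W \<equiv> W_mat \<J> w"
    and "R \<equiv> R_mat I S \<eta> \<tau> \<J> w Q"
    and "D \<equiv> D_mat I W R"
    and "a \<equiv> a_vec I \<eta> \<tau> \<J> w \<rho>' Qh"
  assumes "site_spaces I S \<eta>"
    and "prob_measure_on (PiM I S) \<rho>"
    and "prob_measure_on (PiM I S) \<rho>'"
    and "one_sided_coupled_update_rule I S \<tau> \<J> \<rho> \<rho>' \<gamma> \<gamma>' Q Qh"
    and "\<forall>J\<in>\<J>. w J > 0"
    and "\<forall>J\<in>\<J>. quasilocal_kernel (past I \<tau> J) J S (\<gamma> J)"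
    and "\<forall>i\<in>I. (\<Sum>\<^sub>\<infinity>j\<in>I. D i j * metric_integral \<eta> j (\<rho> \<Otimes>\<^sub>M \<rho>')) < \<infinity>"
    and "\<forall>i\<in>I. W i i \<le> 1"
    and "\<forall>i\<in>I. (\<lambda>n. \<Sum>\<^sub>\<infinity>j\<in>I.
            mat_power I (\<lambda>k l. mat_id k l - W k l + R k l) n i j * metric_integral \<eta> j (\<rho> \<Otimes>\<^sub>M \<rho>'))
          \<longlonglongrightarrow> 0"
    and "bounded_measurable (PiM I S) f"
    and "quasilocal I S f"
    and "\<forall>i\<in>I. osc I S \<eta> i f < \<infinity>"
  shows "ennreal \<bar>(\<integral>x. f x \<partial>\<rho>) - (\<integral>x. f x \<partial>\<rho>')\<bar>
         \<le> (\<Sum>\<^sub>\<infinity>(i, j)\<in>I \<times> I. osc I S \<eta> i f * D i j * inverse (W j j) * a j)"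
proof -
  interpret two_measures I S \<eta> \<rho> \<rho>'
    by unfold_locales fact+
  interpret one_sided_comparison I S \<eta> \<rho> \<rho>' \<tau> \<J> \<gamma> \<gamma>' Q Qh w
    using assms by unfold_locales (auto simp: mat_vec_def mean_dist_def[abs_def])
  have "gap f \<le> (\<Sum>\<^sub>\<infinity>i\<in>I. osc I S \<eta> i f * comparison_vec i)"
    using assms by (intro gap_quasilocal) auto
  then show ?thesis
    unfolding infsum_comparison_vec gap_def W_def R_def D_def a_def .
qed

end
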